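(* Let $a_{nr}\in L_{\pi_{nr}}$ be any normal integral basis generator of $L_{\pi_{nr}}/L$, i.e. $O_{\pi_{nr}}=O_LG\cdot a_{nr}$. Let $a\in\mathrm{Map}(G,L^c)$ be the element with $\mathbf r_G(a)=\mathbf r_G(a_{nr})\cdot\mathbf r_G(\varphi_s)$. Then $a\in L_\pi$ and $a$ is a normal integral basis generator of $L_\pi/L$, i.e. $O_\pi=O_LG\cdot a$.
   Context: $L$ is a finite extension of $\mathbb Q_p$ (a completion of a number field) with ring of integers $O_L$, uniformiser $\varpi$ and residue field of order $q$; $L^c$ is an algebraic closure, $\Omega_L=\mathrm{Gal}(L^c/L)$, $L^t$ and $L^{nr}$ the maximal tamely ramified and unramified extensions. Fix compatible roots of unity $\zeta_m$ ($\zeta_{mn}^m=\zeta_n$) and compatible roots $\varpi^{1/m}$ ($(\varpi^{1/mn})^m=\varpi^{1/n}$) for $m$ prime to $q$. Let $\phi,\sigma\in\mathrm{Gal}(L^t/L)$ be given by $\phi(\zeta_m)=\zeta_m^q$, $\phi(\varpi^{1/m})=\varpi^{1/m}$, $\sigma(\zeta_m)=\zeta_m$, $\sigma(\varpi^{1/m})=\zeta_m\varpi^{1/m}$; they topologically generate $\mathrm{Gal}(L^t/L)$ with $\phi\sigma\phi^{-1}=\sigma^q$. $G$ is a finite group with trivial Galois action. For continuous $\rho:\Omega_L\to G$, $L_\rho=\{a:G\to L^c\mid a(\gamma\rho(\omega))=\omega(a(\gamma))\ \forall\gamma,\omega\}$ with $G$ acting by $(g\cdot a)(\gamma)=a(\gamma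 g)$, and $O_\rho$ is the integral closure of $O_L$ in $L_\rho$. $\mathbf r_G:\mathrm{Map}(G,L^c)\to L^cG$, $a\mapsto\sum_{g}a(g)g^{-1}$ (a bijection). Let $\pi:\Omega_L\to G$ be a homomorphism factoring through $\mathrm{Gal}(L^t/L)$ (so $L_\pi/L$ is tame), $s=\pi(\sigma)$, $t=\pi(\phi)$ (so $tst^{-1}=s^q$ and $|s|$ is prime to $q$). Let $\pi_{nr}:\Omega_L\to G$ be the unramified homomorphism (factoring through $\mathrm{Gal}(L^{nr}/L)$) with $\pi_{nr}(\phi)=t$, i.e. $\pi_{nr}(\sigma^m\phi^n)=t^n$. Set $\beta_s=\frac1{|s|}\sum_{i=0}^{|s|-1}\varpi^{i/|s|}$ and define $\varphi_s\in\mathrm{Map}(G,L^c)$ by $\varphi_s(s^i)=\sigma^i(\beta_s)$ and $\varphi_s(g)=0$ for $g\notin\langle s\rangle$.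
   Formalization: L_ρ is defined by a(ρ(ω)γ)=ω(a(γ)) instead of a(γρ(ω))=ω(a(γ)): for non-abelian G the latter is not stable under (g·a)(γ)=a(γg) and the claim fails (e.g. t=1, ⟨s⟩ not normal); for abelian G the two conditions coincide. *)

theory Defs
  imports
    "HOL-Algebra.Algebra"
    "HOL-Algebra.Algebraic_Closure_Type"
    "HOL-Analysis.Analysis"
begin

section \<open>\<open>p\<close>-adic fields\<close>

text \<open>
  All fields are subfields of one field type \<open>'k\<close>, which plays the role of the algebraic closure
  \<open>L\<^sup>c\<close>. Its library ring record serves for field theory (subfields, finite dimension, algebraic
  closure).
\<close>

abbreviation ambient :: "'k::field ring" where
  "ambient \<equiv> ring_of_type_algebra"

definition finite_field_ext :: "'k::field set \<Rightarrow> 'k set \<Rightarrow> bool" where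
  "finite_field_ext K E \<longleftrightarrow>
     subfield K ambient \<and> subfield E ambient \<and> K \<subseteq> E \<and> ring.finite_dimension ambient K E"

definition padic_abs :: "nat \<Rightarrow> rat \<Rightarrow> real" where
  "padic_abs p r =
     (if r = 0 then 0
      else real p powi (int (multiplicity (int p) (snd (quotient_of r)))
                        - int (multiplicity (int p) (fst (quotient_of r)))))"

text \<open>
  \<open>K\<close> together with the absolute value \<open>v\<close> is a completion of the rationals with respect to the
  \<open>p\<close>-adic absolute value, i.e. a copy of the field of \<open>p\<close>-adic numbers. The values of \<open>v\<close> outside
  \<open>K\<close> are irrelevant.
\<close>

definition padic_numbers :: "nat \<Rightarrow> ('k::field_char_0 \<Rightarrow> real) \<Rightarrow> 'k set \<Rightarrow> bool" where
  "padic_numbers p v K \<longleftrightarrow>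
     subfield K ambient \<and>
     (\<forall>x\<in>K. 0 \<le> v x \<and> (v x = 0 \<longleftrightarrow> x = 0)) \<and>
     (\<forall>x\<in>K. \<forall>y\<in>K. v (x * y) = v x * v y \<and> v (x + y) \<le> v x + v y) \<and>
     (\<forall>r. v (of_rat r) = padic_abs p r) \<and>
     (\<forall>x\<in>K. \<forall>e>0. \<exists>r. v (x - of_rat r) < e) \<and>
     (\<forall>xs :: nat \<Rightarrow> 'k. range xs \<subseteq> K \<and> (\<forall>e>0. \<exists>N. \<forall>m\<ge>N. \<forall>n\<ge>N. v (xs m - xs n) < e) \<longrightarrow>
        (\<exists>x\<in>K. \<forall>e>0. \<exists>N. \<forall>n\<ge>N. v (xs n - x) < e))"

definition valuation_ring :: "('k \<Rightarrow> real) \<Rightarrow> 'k set \<Rightarrow> 'k set" where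
  "valuation_ring v K = {x \<in> K. v x \<le> 1}"

definition monic_over :: "'k::field set \<Rightarrow> 'k poly \<Rightarrow> bool" where
  "monic_over A f \<longleftrightarrow> Polynomial.lead_coeff f = 1 \<and> (\<forall>i. Polynomial.coeff f i \<in> A)"

definition integral_closure :: "'k::field set \<Rightarrow> 'k set \<Rightarrow> 'k set" where
  "integral_closure A F = {x \<in> F. \<exists>f. monic_over A f \<and> poly f x = 0}"

text \<open>The maximal ideal of a local subring of a field consists of its non-units.\<close>

definition max_ideal :: "'k::field set \<Rightarrow> 'k set" where
  "max_ideal A = {x \<in> A. \<not> (x \<noteq> 0 \<and> inverse x \<in> A)}"

definition residue_field :: "'k::field set \<Rightarrow> 'k set set" where
  "residue_field A = A // {(x, y). x \<in> A \<and> y \<in> A \<and> x - y \<in> max_ideal A}"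

definition uniformiser :: "'k::field set \<Rightarrow> 'k \<Rightarrow> bool" where
  "uniformiser A u \<longleftrightarrow> u \<in> A \<and> max_ideal A = {u * y | y. y \<in> A}"

text \<open>
  For discrete valuation rings \<open>A \<subseteq> B\<close>, the exponent \<open>e\<close> such that the maximal ideal of \<open>A\<close>
  generates the \<open>e\<close>-th power of the maximal ideal of \<open>B\<close>.
\<close>

definition ramification_index :: "'k::field set \<Rightarrow> 'k set \<Rightarrow> nat" where
  "ramification_index A B =
     (THE e. \<exists>u w. uniformiser A u \<and> uniformiser B w \<and>
        {u * y | y. y \<in> B} = {w ^ e * y | y. y \<in> B})"

text \<open>
  Residue fields are finite here, so residue field extensions are automatically separable and only
  the ramification index matters. Below, \<open>A\<close> is the ring of integers of \<open>L\<close> and \<open>p\<close> is the residue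
  characteristic.
\<close>

definition unramified :: "'k::field set \<Rightarrow> 'k set \<Rightarrow> 'k set \<Rightarrow> bool" where
  "unramified A L F \<longleftrightarrow>
     finite_field_ext L F \<and> ramification_index A (integral_closure A F) = 1"

definition tamely_ramified :: "nat \<Rightarrow> 'k::field set \<Rightarrow> 'k set \<Rightarrow> 'k set \<Rightarrow> bool" where
  "tamely_ramified p A L F \<longleftrightarrow>
     finite_field_ext L F \<and> coprime (ramification_index A (integral_closure A F)) p"

definition max_unramified :: "'k::field set \<Rightarrow> 'k set \<Rightarrow> 'k set" where
  "max_unramified A L = \<Union> {F. unramified A L F}"

definition max_tame :: "nat \<Rightarrow> 'k::field set \<Rightarrow> 'k set \<Rightarrow> 'k set" where
  "max_tame p A L = \<Union> {F. tamely_ramified p A L F}"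

section \<open>Galois groups\<close>

text \<open>
  Automorphisms of \<open>F\<close> are extensional functions, as in \<^const>\<open>BijGroup\<close>; multiplication is
  composition (the right factor is applied first). For \<open>F = UNIV\<close> this is the absolute Galois group.
\<close>

definition Gal :: "'k::field set \<Rightarrow> 'k set \<Rightarrow> ('k \<Rightarrow> 'k) monoid" where
  "Gal L F = (BijGroup F) \<lparr> carrier :=
     {\<tau> \<in> Bij F. (\<forall>x\<in>L. \<tau> x = x) \<and>
        (\<forall>x\<in>F. \<forall>y\<in>F. \<tau> (x + y) = \<tau> x + \<tau> y \<and> \<tau> (x * y) = \<tau> x * \<tau> y)} \<rparr>"

abbreviation abs_Gal :: "'k::field set \<Rightarrow> ('k \<Rightarrow> 'k) monoid" where
  "abs_Gal L \<equiv> Gal L UNIV"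

text \<open>A base of the Krull topology consists of the cosets of the subgroups fixing a finite extension.\<close>

definition krull_topology :: "'k::field set \<Rightarrow> ('k \<Rightarrow> 'k) topology" where
  "krull_topology L = topology_generated_by
     {{\<tau> \<in> carrier (abs_Gal L). \<forall>x\<in>F. \<tau> x = \<omega> x} | \<omega> F.
        \<omega> \<in> carrier (abs_Gal L) \<and> finite_field_ext L F}"

definition continuous_hom ::
    "'k::field set \<Rightarrow> ('g, 'm) monoid_scheme \<Rightarrow> (('k \<Rightarrow> 'k) \<Rightarrow> 'g) \<Rightarrow> bool" where
  "continuous_hom L G \<rho> \<longleftrightarrow> \<rho> \<in> hom (abs_Gal L) G \<and>
     continuous_map (krull_topology L) (discrete_topology (carrier G)) \<rho>"

definition factors_through ::
    "'k::field set \<Rightarrow> 'k set \<Rightarrow> ('g, 'm) monoid_scheme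
     \<Rightarrow> (('k \<Rightarrow> 'k) \<Rightarrow> 'g) \<Rightarrow> (('k \<Rightarrow> 'k) \<Rightarrow> 'g) \<Rightarrow> bool" where
  "factors_through L F G \<rho> \<rho>' \<longleftrightarrow>
     \<rho>' \<in> hom (Gal L F) G \<and> (\<forall>\<omega>\<in>carrier (abs_Gal L). \<rho> \<omega> = \<rho>' (restrict \<omega> F))"

section \<open>Galois algebras and resolvends\<close>

text \<open>
  \<open>Map(G, L\<^sup>c)\<close> is the set of extensional functions on the carrier of \<open>G\<close>. The Galois action on
  \<open>G\<close> defining \<open>L\<^sub>\<rho>\<close> is left multiplication by \<open>\<rho>(\<omega>)\<close>. This is what makes \<open>L\<^sub>\<rho>\<close> stable under
  the action \<open>(g \<cdot> a)(\<gamma>) = a(\<gamma> g)\<close> of \<open>G\<close>; for non-abelian \<open>G\<close> the condition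
  \<open>a(\<gamma> \<rho>(\<omega>)) = \<omega>(a(\<gamma>))\<close> would be incompatible with that action and with \<open>\<rho>\<close> being a homomorphism.
\<close>

definition galois_algebra ::
    "'k::field set \<Rightarrow> ('g, 'm) monoid_scheme \<Rightarrow> (('k \<Rightarrow> 'k) \<Rightarrow> 'g) \<Rightarrow> ('g \<Rightarrow> 'k) set" where
  "galois_algebra L G \<rho> =
     {a \<in> carrier G \<rightarrow>\<^sub>E UNIV.
        \<forall>\<gamma>\<in>carrier G. \<forall>\<omega>\<in>carrier (abs_Gal L). a (\<rho> \<omega> \<otimes>\<^bsub>G\<^esub> \<gamma>) = \<omega> (a \<gamma>)}"

text \<open>
  The integral closure of \<open>A\<close> in the algebra \<open>L\<^sub>\<rho>\<close>. Its operations are pointwise, so \<open>f(a) = 0\<close>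
  means that \<open>f\<close> vanishes at every value of \<open>a\<close>.
\<close>

definition algebra_integers ::
    "'k::field set \<Rightarrow> 'k set \<Rightarrow> ('g, 'm) monoid_scheme \<Rightarrow> (('k \<Rightarrow> 'k) \<Rightarrow> 'g) \<Rightarrow> ('g \<Rightarrow> 'k) set" where
  "algebra_integers A L G \<rho> =
     {a \<in> galois_algebra L G \<rho>. \<exists>f. monic_over A f \<and> (\<forall>\<gamma>\<in>carrier G. poly f (a \<gamma>) = 0)}"

text \<open>The orbit \<open>AG \<cdot> a\<close>; here \<open>c\<close> is the element \<open>\<Sum>\<^sub>g c(g) g\<close> of the group ring \<open>AG\<close>.\<close>

definition group_ring_orbit ::
    "'k::field set \<Rightarrow> ('g, 'm) monoid_scheme \<Rightarrow> ('g \<Rightarrow> 'k) \<Rightarrow> ('g \<Rightarrow> 'k) set" where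
  "group_ring_orbit A G a =
     {(\<lambda>\<gamma>\<in>carrier G. \<Sum>g\<in>carrier G. c g * a (\<gamma> \<otimes>\<^bsub>G\<^esub> g)) | c. c \<in> carrier G \<rightarrow> A}"

definition nib_generator ::
    "'k::field set \<Rightarrow> 'k set \<Rightarrow> ('g, 'm) monoid_scheme
     \<Rightarrow> (('k \<Rightarrow> 'k) \<Rightarrow> 'g) \<Rightarrow> ('g \<Rightarrow> 'k) \<Rightarrow> bool" where
  "nib_generator A L G \<rho> a \<longleftrightarrow>
     a \<in> galois_algebra L G \<rho> \<and> algebra_integers A L G \<rho> = group_ring_orbit A G a"

text \<open>
  Elements \<open>\<Sum>\<^sub>h x(h) h\<close> of the group algebra \<open>L\<^sup>cG\<close> are given by their coefficient functions. The
  resolvend \<open>\<Sum>\<^sub>g a(g) g\<^sup>-\<^sup>1\<close> has coefficient \<open>a(h\<^sup>-\<^sup>1)\<close> at \<open>h\<close>.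
\<close>

definition resolvend :: "('g, 'm) monoid_scheme \<Rightarrow> ('g \<Rightarrow> 'k::field) \<Rightarrow> 'g \<Rightarrow> 'k" where
  "resolvend G a = (\<lambda>h\<in>carrier G. a (inv\<^bsub>G\<^esub> h))"

definition group_algebra_mult ::
    "('g, 'm) monoid_scheme \<Rightarrow> ('g \<Rightarrow> 'k::field) \<Rightarrow> ('g \<Rightarrow> 'k) \<Rightarrow> 'g \<Rightarrow> 'k" where
  "group_algebra_mult G x y =
     (\<lambda>h\<in>carrier G. \<Sum>g\<in>carrier G. x g * y (inv\<^bsub>G\<^esub> g \<otimes>\<^bsub>G\<^esub> h))"

definition primitive_root_of_unity :: "nat \<Rightarrow> 'k::field \<Rightarrow> bool" where
  "primitive_root_of_unity m z \<longleftrightarrow> z ^ m = 1 \<and> (\<forall>k. 0 < k \<and> k < m \<longrightarrow> z ^ k \<noteq> 1)"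

text \<open>\<open>rt m\<close> is the chosen \<open>m\<close>-th root of the uniformiser, and \<open>n\<close> is the order of \<open>s\<close>.\<close>

definition kummer_element :: "(nat \<Rightarrow> 'k::field) \<Rightarrow> nat \<Rightarrow> 'k" where
  "kummer_element rt n = (\<Sum>i<n. rt n ^ i) / of_nat n"

text \<open>
  The map sending \<open>s\<^sup>i\<close> to \<open>\<sigma>\<^sup>i(\<beta>)\<close> and everything outside the subgroup generated by \<open>s\<close> to \<open>0\<close>;
  for \<open>\<beta>\<close> with \<open>\<sigma>\<^bsup>|s|\<^esup>(\<beta>) = \<beta>\<close> the choice of the exponent \<open>i\<close> is immaterial.
\<close>

definition orbit_map ::
    "('g, 'm) monoid_scheme \<Rightarrow> 'g \<Rightarrow> ('k \<Rightarrow> 'k) \<Rightarrow> 'k::field \<Rightarrow> 'g \<Rightarrow> 'k" where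
  "orbit_map G s \<sigma> \<beta> =
     (\<lambda>g\<in>carrier G. if \<exists>i::nat. g = s [^]\<^bsub>G\<^esub> i
        then (\<sigma> ^^ (LEAST i::nat. g = s [^]\<^bsub>G\<^esub> i)) \<beta> else 0)"

end

(*
  The integral closure of the p-adic integers in the algebraic closure is a valuation ring V which is
  stable under the Galois group. A finite tame extension F of L with ramification index e therefore
  contains its Teichmueller representatives and a uniformiser w that is a root of unity times the
  e-th root of the uniformiser of L. Every element of F is a w-adic limit of polynomials in these, so the
  action of an automorphism on F is determined by what it does to the zeta_N and the N-th roots of the
  uniformiser, and sigma and phi topologically generate the tame Galois group.

  The resolvend identity says a(g) = sum_i sigma^i(beta_s) a_nr(s^-i g). This operation and the one
  with the inverses of the roots of the uniformiser are mutually inverse and exchange the equivariance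
  conditions for pi_nr and pi, which need only be checked on lifts of sigma and phi. Both preserve
  integrality: a sigma-invariant element has the value of an integral power of the uniformiser, so it
  becomes integral as soon as it does so after multiplication by a k/n-th power with k < n.
  Hence O_pi is the image of O_{pi_nr} = O_L G a_nr.
*)

theory Submission
  imports Defs "HOL-Real_Asymp.Real_Asymp" "HOL-Number_Theory.Cong"
begin

section \<open>Homomorphisms of subfields and their extension\<close>

text \<open>The element \<beta>_s is a Fourier sum: with n = |s| and r the chosen n-th root of the
  uniformiser, convolution with \<varphi>_s multiplies the k-th eigencomponent of a function along
  the group generated by s by r^k, for 0 <= k < n. The inverse operation is therefore the same sum
  with 1/r in place of r, and no discriminant or index has to be computed. The obstacle lies in the
  algebraic closure, which comes without an absolute value. Sizes are expressed by membership of
  quotients in a valuation ring produced by Zorn's lemma, and completeness of \<open>Qp\<close>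
  enters only in the proof that automorphisms preserve this ring. After that, uniqueness modulo the
  maximal ideal does the work of Hensel's lemma. Equivariance passes from lifts of the two
  generators to the whole Galois group by Dedekind independence at a finite level, not by a density
  argument in the Krull topology.\<close>

locale subring_of =
  fixes A :: "'k::field set"
  assumes zero [simp, intro]: "0 \<in> A" and one [simp, intro]: "1 \<in> A"
    and add [intro]: "x \<in> A \<Longrightarrow> y \<in> A \<Longrightarrow> x + y \<in> A"
    and mult [intro]: "x \<in> A \<Longrightarrow> y \<in> A \<Longrightarrow> x * y \<in> A"
    and uminus [intro]: "x \<in> A \<Longrightarrow> - x \<in> A"
begin

lemma diff [intro]: "x \<in> A \<Longrightarrow> y \<in> A \<Longrightarrow> x - y \<in> A"
  using add[of x "- y"] uminus[of y] by simp

lemma power [intro]: "x \<in> A \<Longrightarrow> x ^ n \<in> A"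
  by (induction n) auto

lemma sum [intro]: "(\<And>i. i \<in> I \<Longrightarrow> f i \<in> A) \<Longrightarrow> sum f I \<in> A"
  by (induction I rule: infinite_finite_induct) auto

lemma prod [intro]: "(\<And>i. i \<in> I \<Longrightarrow> f i \<in> A) \<Longrightarrow> prod f I \<in> A"
  by (induction I rule: infinite_finite_induct) auto

lemma of_nat [simp, intro]: "of_nat n \<in> A"
  by (induction n) auto

end

locale subfield_of = subring_of E for E :: "'k::field set" +
  assumes inverse [intro]: "x \<in> E \<Longrightarrow> inverse x \<in> E"
begin

lemma divide [intro]: "x \<in> E \<Longrightarrow> y \<in> E \<Longrightarrow> x / y \<in> E"
  by (simp add: divide_inverse mult inverse)

end

section \<open>Polynomials with coefficients in a subring, and algebraic elements\<close>

definition polys_over :: "'k::field set \<Rightarrow> 'k poly set" where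
  "polys_over A = {h. \<forall>i. Polynomial.coeff h i \<in> A}"

lemma polys_overD: "h \<in> polys_over A \<Longrightarrow> Polynomial.coeff h i \<in> A"
  by (simp add: polys_over_def)

lemma polys_over_mono: "A \<subseteq> B \<Longrightarrow> polys_over A \<subseteq> polys_over B"
  by (auto simp: polys_over_def)

lemma monic_over_iff: "monic_over A f \<longleftrightarrow> Polynomial.lead_coeff f = 1 \<and> f \<in> polys_over A"
  by (simp add: monic_over_def polys_over_def)

context subring_of
begin

lemma polys_over_0 [simp, intro]: "0 \<in> polys_over A"
  and polys_over_1 [simp, intro]: "1 \<in> polys_over A"
  by (auto simp: polys_over_def coeff_1)

lemma polys_over_add [intro]: "g \<in> polys_over A \<Longrightarrow> h \<in> polys_over A \<Longrightarrow> g + h \<in> polys_over A"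
  and polys_over_diff [intro]: "g \<in> polys_over A \<Longrightarrow> h \<in> polys_over A \<Longrightarrow> g - h \<in> polys_over A"
  and polys_over_uminus [intro]: "g \<in> polys_over A \<Longrightarrow> - g \<in> polys_over A"
  and polys_over_smult [intro]: "c \<in> A \<Longrightarrow> g \<in> polys_over A \<Longrightarrow> Polynomial.smult c g \<in> polys_over A"
  and polys_over_monom [intro]: "c \<in> A \<Longrightarrow> Polynomial.monom c n \<in> polys_over A"
  by (auto simp: polys_over_def coeff_monom)

lemma polys_over_mult [intro]:
  "g \<in> polys_over A \<Longrightarrow> h \<in> polys_over A \<Longrightarrow> g * h \<in> polys_over A"
  by (auto simp: polys_over_def coeff_mult)

lemma polys_over_pCons [intro]: "c \<in> A \<Longrightarrow> g \<in> polys_over A \<Longrightarrow> pCons c g \<in> polys_over A"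
  by (auto simp: polys_over_def coeff_pCons split: nat.splits)

lemma polys_over_prod [intro]: "(\<And>i. i \<in> I \<Longrightarrow> f i \<in> polys_over A) \<Longrightarrow> prod f I \<in> polys_over A"
  by (induction I rule: infinite_finite_induct) auto

lemma poly_in: "h \<in> polys_over A \<Longrightarrow> x \<in> A \<Longrightarrow> poly h x \<in> A"
  by (auto simp: poly_altdef polys_over_def)

end

definition alg_over :: "'k::field set \<Rightarrow> 'k \<Rightarrow> bool" where
  "alg_over E x \<longleftrightarrow> (\<exists>h \<in> polys_over E. h \<noteq> 0 \<and> poly h x = 0)"

lemma alg_over_mono: "E \<subseteq> F \<Longrightarrow> alg_over E x \<Longrightarrow> alg_over F x"
  using polys_over_mono unfolding alg_over_def by blast

context subfield_of
begin

lemma polys_over_division: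
  assumes g: "g \<in> polys_over E" "Polynomial.lead_coeff g = 1" and h: "h \<in> polys_over E"
  shows "\<exists>q \<in> polys_over E. \<exists>r \<in> polys_over E. h = q * g + r \<and>
    (r = 0 \<or> Polynomial.degree r < Polynomial.degree g)"
  using h
proof (induction "Polynomial.degree h" arbitrary: h rule: less_induct)
  case (less h)
  show ?case
  proof (cases "h = 0 \<or> Polynomial.degree h < Polynomial.degree g")
    case True
    then show ?thesis using less.prems by (intro bexI[of _ 0] bexI[of _ h]) auto
  next
    case False
    define n where "n = Polynomial.degree h - Polynomial.degree g"
    define c where "c = Polynomial.lead_coeff h"
    define k where "k = Polynomial.monom c n * g"
    have [simp]: "g \<noteq> 0" using g by auto
    have c: "c \<in> E" "c \<noteq> 0" using less.prems False by (auto simp: c_def polys_over_def)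
    have k: "k \<in> polys_over E" using g c by (auto simp: k_def)
    have degk: "Polynomial.degree k = Polynomial.degree h"
      using False c by (auto simp: k_def n_def degree_mult_eq degree_monom_eq monom_eq_0_iff)
    have lck: "Polynomial.coeff k (Polynomial.degree h) = Polynomial.lead_coeff h"
      using lead_coeff_mult[of "Polynomial.monom c n" g] g(2) lead_coeff_monom[of c n]
      unfolding k_def[symmetric] degk by (simp add: c_def)
    show ?thesis
    proof (cases "h = k")
      case True
      then show ?thesis using c by (intro bexI[of _ "Polynomial.monom c n"] bexI[of _ 0]) (auto simp: k_def)
    next
      case False
      have "Polynomial.degree (h - k) < Polynomial.degree h"
      proof -
        have "Polynomial.degree (h - k) \<le> Polynomial.degree h" using degk by (intro degree_diff_le) auto
        moreover have "Polynomial.degree (h - k) \<noteq> Polynomial.degree h"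
          using lck False by (metis coeff_diff eq_iff_diff_eq_0 leading_coeff_0_iff)
        ultimately show ?thesis by simp
      qed
      from less.hyps[OF this] less.prems k obtain q r where
        qr: "q \<in> polys_over E" "r \<in> polys_over E" "h - k = q * g + r"
          "r = 0 \<or> Polynomial.degree r < Polynomial.degree g" by blast
      show ?thesis
        using qr c by (intro bexI[of _ "q + Polynomial.monom c n"] bexI[of _ r])
          (auto simp: k_def algebra_simps)
    qed
  qed
qed

text \<open>A polynomial of least degree is made monic, and remainders on division by it vanish.
  Divisibility over \<open>E\<close> is recorded instead of irreducibility, because it is what makes
  evaluation at another root of \<mu> well defined.\<close>

lemma minimal_polynomial:
  assumes "alg_over E x"
  obtains \<mu> where "\<mu> \<in> polys_over E" "Polynomial.lead_coeff \<mu> = 1" "poly \<mu> x = 0"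
    "\<forall>h \<in> polys_over E. poly h x = 0 \<longrightarrow> (\<exists>q \<in> polys_over E. h = q * \<mu>)"
proof -
  obtain h0 where h0: "h0 \<in> polys_over E \<and> h0 \<noteq> 0 \<and> poly h0 x = 0"
    using assms unfolding alg_over_def by blast
  obtain h where h: "h \<in> polys_over E" "h \<noteq> 0" "poly h x = 0"
    and min: "\<And>h'. h' \<in> polys_over E \<Longrightarrow> h' \<noteq> 0 \<Longrightarrow> poly h' x = 0 \<Longrightarrow> Polynomial.degree h \<le> Polynomial.degree h'"
    using ex_has_least_nat[of "\<lambda>h. h \<in> polys_over E \<and> h \<noteq> 0 \<and> poly h x = 0" h0 Polynomial.degree, OF h0]
    by (elim exE conjE) simp
  define \<mu> where "\<mu> = Polynomial.smult (inverse (Polynomial.lead_coeff h)) h"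
  have \<mu>: "\<mu> \<in> polys_over E" "Polynomial.lead_coeff \<mu> = 1" "poly \<mu> x = 0"
    "Polynomial.degree \<mu> = Polynomial.degree h"
    using h by (auto simp: \<mu>_def polys_over_def)
  show thesis
  proof (rule that[OF \<mu>(1-3)], intro ballI impI)
    fix g assume g: "g \<in> polys_over E" "poly g x = 0"
    from polys_over_division[OF \<mu>(1,2) g(1)] obtain q r where
      qr: "q \<in> polys_over E" "r \<in> polys_over E" "g = q * \<mu> + r"
        "r = 0 \<or> Polynomial.degree r < Polynomial.degree \<mu>" by blast
    have "poly r x = 0" using qr(3) g \<mu> by simp
    hence "r = 0" using min[of r] qr \<mu>(4) by fastforce
    then show "\<exists>q \<in> polys_over E. g = q * \<mu>" using qr by auto
  qed
qed

text \<open>The constant term of the minimal polynomial of a nonzero x cannot vanish, so the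
  equation can be solved for the inverse of x. This upgrades rings obtained from Zorn's lemma or
  from bounds to fields.\<close>

lemma subring_is_subfield:
  assumes "subring_of B" "E \<subseteq> B" and alg: "\<And>x. x \<in> B \<Longrightarrow> alg_over E x"
  shows "subfield_of B"
proof -
  interpret B: subring_of B by fact
  show ?thesis
  proof unfold_locales
    fix x assume x: "x \<in> B"
    show "inverse x \<in> B"
    proof (cases "x = 0")
      case False
      obtain \<mu> where \<mu>: "\<mu> \<in> polys_over E" "Polynomial.lead_coeff \<mu> = 1" "poly \<mu> x = 0"
        "\<forall>h \<in> polys_over E. poly h x = 0 \<longrightarrow> (\<exists>q \<in> polys_over E. h = q * \<mu>)"
        using minimal_polynomial[OF alg[OF x]] by blast
      obtain c \<nu> where c: "\<mu> = pCons c \<nu>" by (cases \<mu>)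
      have \<nu>: "\<nu> \<in> polys_over E" unfolding polys_over_def
        using polys_overD[OF \<mu>(1), of "Suc i" for i] c by auto
      have "c \<noteq> 0"
      proof
        assume "c = 0"
        hence "poly \<nu> x = 0" using \<mu>(3) c False by simp
        then obtain q where "\<nu> = q * \<mu>" using \<mu>(4) \<nu> by blast
        moreover have "\<nu> \<noteq> 0" using \<mu>(2) c \<open>c = 0\<close> by auto
        ultimately have "Polynomial.degree \<mu> \<le> Polynomial.degree \<nu>"
          using degree_mult_right_le[of q \<mu>] by (auto simp: mult.commute)
        then show False using c \<open>\<nu> \<noteq> 0\<close> by simp
      qed
      moreover have "c \<in> E" using polys_overD[OF \<mu>(1), of 0] c by simp
      moreover have "c = - (x * poly \<nu> x)" using \<mu>(3) c by (simp add: eq_neg_iff_add_eq_0)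
      ultimately have "inverse x = - (inverse c * poly \<nu> x)"
        using False by (auto simp: field_simps)
      moreover have "poly \<nu> x \<in> B" using \<nu> polys_over_mono[OF assms(2)] x by (auto intro: B.poly_in)
      moreover have "inverse c \<in> B" using \<open>c \<in> E\<close> assms(2) by auto
      ultimately show ?thesis by auto
    qed simp
  qed
qed

end

definition hom_on :: "'k::field set \<Rightarrow> ('k \<Rightarrow> 'k) \<Rightarrow> bool" where
  "hom_on E f \<longleftrightarrow> f 1 = 1 \<and> (\<forall>x\<in>E. \<forall>y\<in>E. f (x + y) = f x + f y \<and> f (x * y) = f x * f y)"

context subring_of
begin

lemma hom_on_simps:
  assumes "hom_on A f"
  shows "f 0 = 0" "f 1 = 1" "x \<in> A \<Longrightarrow> y \<in> A \<Longrightarrow> f (x + y) = f x + f y"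
    "x \<in> A \<Longrightarrow> y \<in> A \<Longrightarrow> f (x * y) = f x * f y" "x \<in> A \<Longrightarrow> f (- x) = - f x"
    "x \<in> A \<Longrightarrow> y \<in> A \<Longrightarrow> f (x - y) = f x - f y"
proof -
  show 0: "f 0 = 0" using assms zero unfolding hom_on_def by (metis add_cancel_right_left)
  show "f 1 = 1" and add: "\<And>x y. x \<in> A \<Longrightarrow> y \<in> A \<Longrightarrow> f (x + y) = f x + f y"
    and "x \<in> A \<Longrightarrow> y \<in> A \<Longrightarrow> f (x * y) = f x * f y"
    using assms by (auto simp: hom_on_def)
  show neg: "\<And>x. x \<in> A \<Longrightarrow> f (- x) = - f x"
    using add[of _ "- _"] 0 uminus by (metis add.right_inverse neg_eq_iff_add_eq_0)
  show "x \<in> A \<Longrightarrow> y \<in> A \<Longrightarrow> f (x - y) = f x - f y"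
    using add[of x "- y"] neg[of y] uminus[of y] by simp
qed

lemma hom_on_sum:
  "hom_on A f \<Longrightarrow> (\<And>i. i \<in> I \<Longrightarrow> g i \<in> A) \<Longrightarrow> f (sum g I) = (\<Sum>i\<in>I. f (g i))"
  by (induction I rule: infinite_finite_induct)
    (auto simp: hom_on_simps(1) hom_on_simps(3)[OF _ _ sum])

lemma map_poly_hom_on:
  assumes f: "hom_on A f" and g: "g \<in> polys_over A" and h: "h \<in> polys_over A"
  shows "map_poly f (g + h) = map_poly f g + map_poly f h"
    "map_poly f (g * h) = map_poly f g * map_poly f h"
    "map_poly f (- g) = - map_poly f g"
    "map_poly f (g - h) = map_poly f g - map_poly f h"
  proof -
  have c: "Polynomial.coeff g i \<in> A" "Polynomial.coeff h i \<in> A" for i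
    using g h by (auto simp: polys_over_def)
  note s = hom_on_simps[OF f]
  show "map_poly f (g + h) = map_poly f g + map_poly f h" "map_poly f (- g) = - map_poly f g"
    "map_poly f (g - h) = map_poly f g - map_poly f h"
    using c s by (simp_all add: poly_eq_iff coeff_map_poly)
  have "f (\<Sum>i\<le>n. Polynomial.coeff g i * Polynomial.coeff h (n - i)) =
      (\<Sum>i\<le>n. f (Polynomial.coeff g i) * f (Polynomial.coeff h (n - i)))" for n
    using c s(4) by (subst hom_on_sum[OF f]) auto
  then show "map_poly f (g * h) = map_poly f g * map_poly f h"
    using s(1) by (simp add: poly_eq_iff coeff_map_poly coeff_mult)
qed

end

text \<open>Two polynomials over \<open>E\<close> with the same value at \<open>x\<close> differ by
  a multiple of \<mu>, and the image of \<mu> vanishes at \<open>y\<close>. So sending h(x) to the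
  image of h, evaluated at \<open>y\<close>, does not depend on the chosen h.\<close>

lemma (in subfield_of) hom_on_adjoin:
  assumes f: "hom_on E f"
    and \<mu>: "\<mu> \<in> polys_over E"
      "\<forall>h \<in> polys_over E. poly h x = 0 \<longrightarrow> (\<exists>q \<in> polys_over E. h = q * \<mu>)"
    and y: "poly (map_poly f \<mu>) y = 0"
  obtains B g where "subring_of B" "E \<subseteq> B" "x \<in> B" "hom_on B g" "\<And>z. z \<in> E \<Longrightarrow> g z = f z" "g x = y"
proof -
  define B where "B = (\<lambda>h. poly h x) ` polys_over E"
  define g where "g = (\<lambda>z. poly (map_poly f (SOME h. h \<in> polys_over E \<and> poly h x = z)) y)"
  have g: "g (poly h x) = poly (map_poly f h) y" if h: "h \<in> polys_over E" for h
  proof -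
    define h' where "h' = (SOME h'. h' \<in> polys_over E \<and> poly h' x = poly h x)"
    have h': "h' \<in> polys_over E" "poly h' x = poly h x"
      unfolding h'_def using someI[of "\<lambda>h'. h' \<in> polys_over E \<and> poly h' x = poly h x" h] h by auto
    have "h' - h \<in> polys_over E" "poly (h' - h) x = 0" using h h' by auto
    then obtain q where q: "q \<in> polys_over E" "h' - h = q * \<mu>" using \<mu>(2) by blast
    have "map_poly f h' - map_poly f h = map_poly f q * map_poly f \<mu>"
      using map_poly_hom_on[OF f] h h' q \<mu> by metis
    hence "poly (map_poly f h') y - poly (map_poly f h) y = 0" using y by (metis mult_zero_right poly_diff poly_mult)
    then show ?thesis by (simp add: g_def h'_def)
  qed
  have mem: "poly h x \<in> B" if "h \<in> polys_over E" for h using that by (auto simp: B_def)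
  have gE: "g z = f z" if "z \<in> E" for z
    using g[of "[:z:]"] that hom_on_simps[OF f] by (auto simp: map_poly_pCons)
  show thesis
  proof (rule that)
    show "subring_of B"
    proof
      show "0 \<in> B" "1 \<in> B" using mem[of 0] mem[of 1] by auto
      fix a b assume "a \<in> B" "b \<in> B"
      then obtain h k where hk: "h \<in> polys_over E" "k \<in> polys_over E" "a = poly h x" "b = poly k x"
        by (auto simp: B_def)
      show "a + b \<in> B" "a * b \<in> B" using mem[of "h + k"] mem[of "h * k"] hk by auto
    next
      fix a assume "a \<in> B"
      then obtain h where hk: "h \<in> polys_over E" "a = poly h x"
        by (auto simp: B_def)
      show "- a \<in> B" using mem[of "- h"] hk by auto
    qed
    show "E \<subseteq> B" using mem[of "[:z:]" for z] by auto
    show "x \<in> B" using mem[of "[:0, 1:]"] by auto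
    show "g x = y" using g[of "[:0, 1:]"] hom_on_simps[OF f] by (auto simp: map_poly_pCons)
    show "hom_on B g"
      unfolding hom_on_def
    proof (intro conjI ballI)
      show "g 1 = 1" using gE[of 1] hom_on_simps[OF f] by simp
      fix a b assume "a \<in> B" "b \<in> B"
      then obtain h k where hk: "h \<in> polys_over E" "k \<in> polys_over E" "a = poly h x" "b = poly k x"
        by (auto simp: B_def)
      show "g (a + b) = g a + g b" "g (a * b) = g a * g b"
        using g[of "h + k"] g[of "h * k"] g hk map_poly_hom_on[OF f hk(1,2)] by auto
    qed
  qed (rule gE)
qed

text \<open>Partial homomorphisms are handled as graphs, so that inclusion is the order for Zorn's
  lemma and unions of chains are again graphs. The last clause, with closure under negation and
  addition, makes the relation single-valued.\<close>

definition partial_hom :: "('k::field \<times> 'k) set \<Rightarrow> bool" where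
  "partial_hom \<Gamma> \<longleftrightarrow> (1, 1) \<in> \<Gamma> \<and>
     (\<forall>a b c d. (a, b) \<in> \<Gamma> \<longrightarrow> (c, d) \<in> \<Gamma> \<longrightarrow> (a + c, b + d) \<in> \<Gamma> \<and> (a * c, b * d) \<in> \<Gamma>) \<and>
     (\<forall>a b. (a, b) \<in> \<Gamma> \<longrightarrow> (- a, - b) \<in> \<Gamma>) \<and> (\<forall>y. (0, y) \<in> \<Gamma> \<longrightarrow> y = 0)"

lemma partial_hom_graph:
  assumes "subring_of B" "hom_on B g"
  shows "partial_hom ((\<lambda>z. (z, g z)) ` B)"
proof -
  interpret subring_of B by fact
  show ?thesis unfolding partial_hom_def using hom_on_simps[OF assms(2)] by (auto simp: image_iff)
qed

lemma partial_hom_function: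
  assumes "partial_hom \<Gamma>"
  obtains B g where "subring_of B" "hom_on B g" "\<Gamma> = (\<lambda>z. (z, g z)) ` B"
proof -
  define g where "g x = (THE y. (x, y) \<in> \<Gamma>)" for x
  have uniq: "y = z" if "(x, y) \<in> \<Gamma>" "(x, z) \<in> \<Gamma>" for x y z
  proof -
    have "(- x, - z) \<in> \<Gamma>" using assms that unfolding partial_hom_def by blast
    hence "(x + - x, y + - z) \<in> \<Gamma>" using assms that unfolding partial_hom_def by blast
    then show ?thesis using assms unfolding partial_hom_def by auto
  qed
  have g: "g x = y" if "(x, y) \<in> \<Gamma>" for x y
    unfolding g_def using that uniq by blast
  have G: "\<Gamma> = (\<lambda>z. (z, g z)) ` Domain \<Gamma>" using g by force
  have *: "(a, g a) \<in> \<Gamma>" if "a \<in> Domain \<Gamma>" for a using that g by auto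
  have ops: "(a + b, g a + g b) \<in> \<Gamma>" "(a * b, g a * g b) \<in> \<Gamma>" "(- a, - g a) \<in> \<Gamma>"
    if "a \<in> Domain \<Gamma>" "b \<in> Domain \<Gamma>" for a b
    using *[OF that(1)] *[OF that(2)] assms unfolding partial_hom_def by blast+
  have one: "(1, 1) \<in> \<Gamma>" using assms unfolding partial_hom_def by blast
  have zero: "(0, 0) \<in> \<Gamma>" using assms one unfolding partial_hom_def by (metis add.right_inverse)
  show thesis
  proof (rule that[OF _ _ G])
    show "subring_of (Domain \<Gamma>)"
    proof
      show "0 \<in> Domain \<Gamma>" "1 \<in> Domain \<Gamma>" using one zero by blast+
      fix x y assume "x \<in> Domain \<Gamma>" "y \<in> Domain \<Gamma>"
      then show "x + y \<in> Domain \<Gamma>" "x * y \<in> Domain \<Gamma>" "- x \<in> Domain \<Gamma>" using ops by blast+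
    qed
    show "hom_on (Domain \<Gamma>) g"
      unfolding hom_on_def using g one ops by auto
  qed
qed

section \<open>Field automorphisms and the absolute Galois group\<close>

locale field_auto =
  fixes \<tau> :: "'k::field \<Rightarrow> 'k"
  assumes bij: "bij \<tau>" and add [simp]: "\<tau> (x + y) = \<tau> x + \<tau> y" and mult [simp]: "\<tau> (x * y) = \<tau> x * \<tau> y"
begin

lemma zero [simp]: "\<tau> 0 = 0"
  using add[of 0 0] by (metis add_cancel_right_left)

lemma eq_iff [simp]: "\<tau> x = \<tau> y \<longleftrightarrow> x = y"
  using bij by (simp add: bij_def inj_eq)

lemma zero_iff [simp]: "\<tau> x = 0 \<longleftrightarrow> x = 0"
  using eq_iff[of x 0] unfolding zero .

lemma one [simp]: "\<tau> 1 = 1"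
  using mult[of 1 1] zero_iff[of 1] by auto

lemma uminus [simp]: "\<tau> (- x) = - \<tau> x"
  using add[of x "- x"] by (simp add: eq_neg_iff_add_eq_0 add.commute)

lemma diff [simp]: "\<tau> (x - y) = \<tau> x - \<tau> y"
  using add[of x "- y"] by simp

lemma inverse [simp]: "\<tau> (inverse x) = inverse (\<tau> x)"
proof (cases "x = 0")
  case False
  have "\<tau> x * \<tau> (inverse x) = 1" using False by (metis mult one right_inverse)
  then show ?thesis by (metis inverse_unique)
qed simp

lemma divide [simp]: "\<tau> (x / y) = \<tau> x / \<tau> y"
  by (simp add: divide_inverse)

lemma power [simp]: "\<tau> (x ^ n) = \<tau> x ^ n"
  by (induction n) auto

lemma power_int [simp]: "\<tau> (x powi n) = \<tau> x powi n"
  by (simp add: power_int_def)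

lemma sum [simp]: "\<tau> (sum f I) = (\<Sum>i\<in>I. \<tau> (f i))"
  by (induction I rule: infinite_finite_induct) auto

lemma prod [simp]: "\<tau> (prod f I) = (\<Prod>i\<in>I. \<tau> (f i))"
  by (induction I rule: infinite_finite_induct) auto

lemma of_nat [simp]: "\<tau> (of_nat n) = of_nat n"
  by (induction n) auto

lemma poly_fixed:
  assumes "\<And>i. \<tau> (Polynomial.coeff h i) = Polynomial.coeff h i"
  shows "\<tau> (poly h x) = poly h (\<tau> x)"
  by (simp add: poly_altdef assms)

lemma map_poly_prod: "map_poly \<tau> (\<Prod>i\<in>I. f i) = (\<Prod>i\<in>I. map_poly \<tau> (f i))"
proof (induction I rule: infinite_finite_induct)
  case (insert i I)
  have "map_poly \<tau> (g * h) = map_poly \<tau> g * map_poly \<tau> h" for g h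
    by (auto simp: poly_eq_iff coeff_map_poly coeff_mult)
  then show ?case using insert by simp
qed auto

end

lemma abs_Gal_iff:
  "\<tau> \<in> carrier (abs_Gal E) \<longleftrightarrow> field_auto \<tau> \<and> (\<forall>x\<in>E. \<tau> x = x)"
  by (auto simp: Gal_def Bij_def field_auto_def)

lemma abs_Gal_auto: "\<tau> \<in> carrier (abs_Gal E) \<Longrightarrow> field_auto \<tau>"
  and abs_Gal_fix: "\<tau> \<in> carrier (abs_Gal E) \<Longrightarrow> x \<in> E \<Longrightarrow> \<tau> x = x"
  by (auto simp: abs_Gal_iff)

lemma field_auto_comp: "field_auto \<tau> \<Longrightarrow> field_auto \<omega> \<Longrightarrow> field_auto (\<tau> \<circ> \<omega>)"
  unfolding field_auto_def by (auto simp: bij_comp)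

lemma field_auto_inv:
  assumes "field_auto \<tau>" shows "field_auto (Hilbert_Choice.inv \<tau>)"
proof -
  interpret field_auto \<tau> by fact
  have *: "\<tau> (Hilbert_Choice.inv \<tau> x) = x" for x using bij by (simp add: bij_is_surj surj_f_inv_f)
  show ?thesis
  proof
    show "bij (Hilbert_Choice.inv \<tau>)" using bij by (rule bij_imp_bij_inv)
    fix x y
    have "\<tau> (Hilbert_Choice.inv \<tau> (x + y)) = \<tau> (Hilbert_Choice.inv \<tau> x + Hilbert_Choice.inv \<tau> y)" "\<tau> (Hilbert_Choice.inv \<tau> (x * y)) = \<tau> (Hilbert_Choice.inv \<tau> x * Hilbert_Choice.inv \<tau> y)"
      by (simp_all add: *)
    then show "Hilbert_Choice.inv \<tau> (x + y) = Hilbert_Choice.inv \<tau> x + Hilbert_Choice.inv \<tau> y" "Hilbert_Choice.inv \<tau> (x * y) = Hilbert_Choice.inv \<tau> x * Hilbert_Choice.inv \<tau> y"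
      unfolding eq_iff .
  qed
qed

lemma abs_Gal_comp:
  "\<tau> \<in> carrier (abs_Gal E) \<Longrightarrow> \<omega> \<in> carrier (abs_Gal E) \<Longrightarrow> \<tau> \<circ> \<omega> \<in> carrier (abs_Gal E)"
  by (auto simp: abs_Gal_iff field_auto_comp)

lemma abs_Gal_id: "id \<in> carrier (abs_Gal E)"
  by (auto simp: abs_Gal_iff field_auto_def)

lemma abs_Gal_inv: "\<tau> \<in> carrier (abs_Gal E) \<Longrightarrow> Hilbert_Choice.inv \<tau> \<in> carrier (abs_Gal E)"
  unfolding abs_Gal_iff using field_auto.eq_iff field_auto.bij
  by (metis bij_is_surj field_auto_inv surj_f_inv_f)

lemma abs_Gal_inv_apply:
  assumes "\<tau> \<in> carrier (abs_Gal E)"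
  shows "\<tau> (Hilbert_Choice.inv \<tau> x) = x" "Hilbert_Choice.inv \<tau> (\<tau> x) = x"
  using field_auto.bij[OF abs_Gal_auto[OF assms]]
  by (simp_all add: bij_is_surj surj_f_inv_f bij_is_inj)

lemma abs_Gal_mult:
  "\<tau> \<in> carrier (abs_Gal E) \<Longrightarrow> \<omega> \<in> carrier (abs_Gal E) \<Longrightarrow> \<tau> \<otimes>\<^bsub>abs_Gal E\<^esub> \<omega> = \<tau> \<circ> \<omega>"
  by (auto simp: Gal_def BijGroup_def compose_def Bij_def o_def)

lemma abs_Gal_mono: "E \<subseteq> F \<Longrightarrow> carrier (abs_Gal F) \<subseteq> carrier (abs_Gal E)"
  by (fastforce simp: abs_Gal_iff)

lemma abs_Gal_funpow: "\<tau> \<in> carrier (abs_Gal E) \<Longrightarrow> \<tau> ^^ n \<in> carrier (abs_Gal E)"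
  by (induction n) (auto simp: abs_Gal_id[unfolded id_def] abs_Gal_id intro: abs_Gal_comp)

lemma abs_Gal_root:
  assumes "\<tau> \<in> carrier (abs_Gal E)" "h \<in> polys_over E" "poly h x = 0"
  shows "poly h (\<tau> x) = 0"
  using field_auto.poly_fixed[OF abs_Gal_auto[OF assms(1)], of h x] assms abs_Gal_fix[OF assms(1)]
    field_auto.zero[OF abs_Gal_auto[OF assms(1)]] by (auto simp: polys_over_def)

text \<open>Surjectivity is automatic, because the endomorphism permutes the finitely many roots of each polynomial over \<open>E\<close>.\<close>

lemma endo_is_abs_Gal:
  assumes alg: "\<And>x. alg_over E x" and f: "hom_on UNIV f" and fixed: "\<And>x. x \<in> E \<Longrightarrow> f x = x"
  shows "f \<in> carrier (abs_Gal E)"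
proof -
  interpret subring_of "UNIV :: 'a set" by standard auto
  note s = hom_on_simps[OF f]
  have inj: "inj f"
  proof (rule injI)
    fix x y assume "f x = f y"
    hence "f (x - y) = 0" using s by simp
    moreover have "f (x - y) * f (inverse (x - y)) = 1" if "x \<noteq> y"
      using s that by (metis UNIV_I right_inverse right_minus_eq)
    ultimately show "x = y" by force
  qed
  have "surj f"
    unfolding surj_def
  proof
    fix z
    obtain h where h: "h \<in> polys_over E" "h \<noteq> 0" "poly h z = 0" using alg[of z] unfolding alg_over_def by blast
    have fp: "f (x ^ n) = f x ^ n" for x n by (induction n) (auto simp: s)
    have "f ` {x. poly h x = 0} \<subseteq> {x. poly h x = 0}"
    proof clarsimp
      fix x assume "poly h x = 0"
      hence "f (poly h x) = 0" using s by simp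
      moreover have "f (poly h x) = poly h (f x)"
        unfolding poly_altdef hom_on_sum[OF f UNIV_I]
        by (intro sum.cong refl) (simp add: s(4) fp fixed polys_overD[OF h(1)])
      ultimately show "poly h (f x) = 0" by simp
    qed
    moreover have "finite {x. poly h x = 0}" using h poly_roots_finite by blast
    ultimately have "f ` {x. poly h x = 0} = {x. poly h x = 0}"
      using inj by (metis endo_inj_surj inj_on_subset subset_UNIV)
    then show "\<exists>x. z = f x" using h by blast
  qed
  then show ?thesis using inj fixed s by (auto simp: abs_Gal_iff field_auto_def bij_def)
qed

text \<open>A graph maximal among those extending \<open>f\<close> has a field as its domain, since
  everything is algebraic over \<open>E\<close>. If that field were proper, the image of a minimal
  polynomial would have a root and \<open>hom_on_adjoin\<close> would enlarge the graph. Conjugating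
  automorphisms and, later, the lifts of \<sigma> and \<phi> come from here.\<close>

theorem hom_on_extend:
  fixes f :: "'k::alg_closed_field \<Rightarrow> 'k"
  assumes E: "subfield_of E" and alg: "\<And>x. alg_over E x"
    and B: "subring_of B" "E \<subseteq> B" and f: "hom_on B f" "\<And>x. x \<in> E \<Longrightarrow> f x = x"
  obtains \<tau> where "\<tau> \<in> carrier (abs_Gal E)" "\<And>x. x \<in> B \<Longrightarrow> \<tau> x = f x"
proof -
  interpret E: subfield_of E by fact
  define \<G> where "\<G> = {\<Gamma>. partial_hom \<Gamma> \<and> (\<lambda>z. (z, f z)) ` B \<subseteq> \<Gamma>}"
  have graph: "(\<lambda>z. (z, f z)) ` B \<in> \<G>" using partial_hom_graph[OF B(1) f(1)] by (auto simp: \<G>_def)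
  have "\<exists>M\<in>\<G>. \<forall>N\<in>\<G>. M \<subseteq> N \<longrightarrow> N = M"
  proof (rule subset_Zorn_nonempty)
    show "\<G> \<noteq> {}" using graph by blast
    fix \<C> assume C: "\<C> \<noteq> {}" "subset.chain \<G> \<C>"
    have sub: "\<And>\<Gamma>. \<Gamma> \<in> \<C> \<Longrightarrow> \<Gamma> \<in> \<G>" and chain: "\<And>\<Gamma> \<Delta>. \<Gamma> \<in> \<C> \<Longrightarrow> \<Delta> \<in> \<C> \<Longrightarrow> \<Gamma> \<subseteq> \<Delta> \<or> \<Delta> \<subseteq> \<Gamma>"
      using C(2) unfolding subset_chain_def by blast+
    have common: "\<exists>\<Gamma>\<in>\<C>. u \<in> \<Gamma> \<and> w \<in> \<Gamma>" if "u \<in> \<Union>\<C>" "w \<in> \<Union>\<C>" for u w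
      using that chain by blast
    have "partial_hom (\<Union>\<C>)"
      unfolding partial_hom_def
    proof (intro conjI allI impI)
      show "(1, 1) \<in> \<Union>\<C>" using C(1) sub unfolding \<G>_def partial_hom_def by blast
    next
      fix a b c d assume "(a, b) \<in> \<Union>\<C>" "(c, d) \<in> \<Union>\<C>"
      then obtain \<Gamma> where "\<Gamma> \<in> \<C>" "(a, b) \<in> \<Gamma>" "(c, d) \<in> \<Gamma>" using common by blast
      then show "(a + c, b + d) \<in> \<Union>\<C>" "(a * c, b * d) \<in> \<Union>\<C>"
        using sub[of \<Gamma>] unfolding \<G>_def partial_hom_def by blast+
    next
      fix a b assume "(a, b) \<in> \<Union>\<C>"
      then show "(- a, - b) \<in> \<Union>\<C>" using sub unfolding \<G>_def partial_hom_def by blast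
    next
      fix y assume "(0, y) \<in> \<Union>\<C>"
      then show "y = 0" using sub unfolding \<G>_def partial_hom_def by blast
    qed
    then show "\<Union>\<C> \<in> \<G>" using C(1) sub unfolding \<G>_def by blast
  qed
  then obtain M where M: "M \<in> \<G>" and max: "\<And>N. N \<in> \<G> \<Longrightarrow> M \<subseteq> N \<Longrightarrow> N = M" by blast
  have "partial_hom M" using M by (simp add: \<G>_def)
  from partial_hom_function[OF this]
  obtain D g where D: "subring_of D" "hom_on D g" "M = (\<lambda>z. (z, g z)) ` D" .
  have BD: "B \<subseteq> D" and gf: "\<And>x. x \<in> B \<Longrightarrow> g x = f x" using M D(3) unfolding \<G>_def by auto
  have "subfield_of D" using E.subring_is_subfield[OF D(1)] B(2) BD alg by blast
  then interpret D: subfield_of D .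
  have "D = UNIV"
  proof (rule ccontr)
    assume "D \<noteq> UNIV"
    then obtain x where x: "x \<notin> D" by blast
    obtain \<mu> where \<mu>: "\<mu> \<in> polys_over D" "Polynomial.lead_coeff \<mu> = 1" "poly \<mu> x = 0"
      "\<forall>h \<in> polys_over D. poly h x = 0 \<longrightarrow> (\<exists>q \<in> polys_over D. h = q * \<mu>)"
      using D.minimal_polynomial[OF alg_over_mono[OF _ alg[of x]]] B(2) BD by blast
    have g: "g 0 = 0" "g 1 = 1" using D.hom_on_simps[OF D(2)] by auto
    have "Polynomial.degree \<mu> > 0" using \<mu>(2,3) by (metis degree_eq_zeroE gr_zeroI degree_pCons_0 coeff_pCons_0 one_neq_zero poly_pCons poly_0 mult_zero_right add_0_right)
    moreover have "Polynomial.degree (map_poly g \<mu>) = Polynomial.degree \<mu>"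
      using \<mu>(2) g by (intro map_poly_degree_eq) auto
    ultimately obtain y where y: "poly (map_poly g \<mu>) y = 0"
      using alg_closed_imp_poly_has_root[of "map_poly g \<mu>"] by auto
    obtain D' g' where D': "subring_of D'" "D \<subseteq> D'" "x \<in> D'" "hom_on D' g'" "\<And>z. z \<in> D \<Longrightarrow> g' z = g z" "g' x = y"
      by (rule D.hom_on_adjoin[OF D(2) \<mu>(1,4) y]) (rule that)
    have ext: "g' z = g z \<and> z \<in> D'" if "z \<in> D" for z using that D'(2,5) by blast
    have "g' z = f z \<and> z \<in> D'" if "z \<in> B" for z using ext[of z] that BD gf[of z] by auto
    hence "(\<lambda>z. (z, g' z)) ` D' \<in> \<G>"
      unfolding \<G>_def using partial_hom_graph[OF D'(1,4)] by (auto simp: image_iff)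
    moreover have "M \<subseteq> (\<lambda>z. (z, g' z)) ` D'" using D(3) ext by (auto simp: image_iff)
    ultimately have "(\<lambda>z. (z, g' z)) ` D' = M" by (rule max)
    hence "(x, g' x) \<in> M" using D'(3) by blast
    then show False using x D(3) by auto
  qed
  with D have "hom_on UNIV g" by simp
  then have "g \<in> carrier (abs_Gal E)" using gf BD B(2) f(2) alg by (intro endo_is_abs_Gal) auto
  then show thesis using that gf by blast
qed

text \<open>Any root of the minimal polynomial is the image of \<open>x\<close> under an
  automorphism over \<open>E\<close>, so \<open>x\<close> is the only root and the polynomial is a
  power of X - x. In characteristic zero its second coefficient determines \<open>x\<close>.\<close>

theorem abs_Gal_fixed:
  fixes E :: "'k::{alg_closed_field, field_char_0} set"
  assumes E: "subfield_of E" and alg: "\<And>x. alg_over E x"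
    and fixed: "\<And>\<tau>. \<tau> \<in> carrier (abs_Gal E) \<Longrightarrow> \<tau> x = x"
  shows "x \<in> E"
proof -
  interpret E: subfield_of E by fact
  obtain \<mu> where \<mu>: "\<mu> \<in> polys_over E" "Polynomial.lead_coeff \<mu> = 1" "poly \<mu> x = 0"
    "\<forall>h \<in> polys_over E. poly h x = 0 \<longrightarrow> (\<exists>q \<in> polys_over E. h = q * \<mu>)"
    using E.minimal_polynomial[OF alg] by blast
  have id: "hom_on E id" by (simp add: hom_on_def)
  have only: "y = x" if "poly \<mu> y = 0" for y
  proof -
    have "poly (map_poly id \<mu>) y = 0" using that by (simp add: map_poly_id)
    then obtain B g where B: "subring_of B" "E \<subseteq> B" "x \<in> B" "hom_on B g" "\<And>z. z \<in> E \<Longrightarrow> g z = id z" "g x = y"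
      by (rule E.hom_on_adjoin[OF id \<mu>(1,4)]) (rule that)
    obtain \<tau> where "\<tau> \<in> carrier (abs_Gal E)" "\<And>x. x \<in> B \<Longrightarrow> \<tau> x = g x"
      using hom_on_extend[OF E alg B(1,2,4)] B(5) by (metis id_apply)
    then show ?thesis using fixed B by metis
  qed
  have [simp]: "\<mu> \<noteq> 0" using \<mu> by auto
  obtain r where r: "\<mu> = [:- x, 1:] ^ Polynomial.order x \<mu> * r" "\<not> [:- x, 1:] dvd r"
    using order_decomp[of \<mu> x] by auto
  define m where "m = Polynomial.order x \<mu>"
  have "m > 0" using \<mu>(3) by (simp add: m_def order_gt_0_iff)
  have "Polynomial.degree r = 0"
  proof (rule ccontr)
    assume "Polynomial.degree r \<noteq> 0"
    then obtain y where y: "poly r y = 0" using alg_closed_imp_poly_has_root[of r] by auto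
    hence "poly \<mu> y = 0" using r(1) by (metis mult_zero_right poly_mult)
    hence "y = x" by (rule only)
    then show False using y r(2) by (simp add: dvd_iff_poly_eq_0)
  qed
  then obtain c where c: "r = [:c:]" by (meson degree_eq_zeroE)
  have "Polynomial.lead_coeff ([:- x, 1:] ^ m) = 1" by (simp add: lead_coeff_power)
  hence "c = 1" using \<mu>(2) r(1) c unfolding m_def[symmetric] by (metis lead_coeff_mult lead_coeff_pCons(2) mult_1 pCons_0_0 one_neq_zero)
  hence "\<mu> = [:- x, 1:] ^ m" using r c m_def by (simp add: one_pCons)
  hence "Polynomial.coeff \<mu> (m - 1) = of_nat (m choose (m - 1)) * (- x)"
    using \<open>m > 0\<close> by (simp add: coeff_linear_poly_power)
  moreover have "m choose (m - 1) = m" using \<open>m > 0\<close> by (metis binomial_1 binomial_symmetric One_nat_def Suc_leI diff_diff_cancel diff_le_self)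
  ultimately have "x = - (Polynomial.coeff \<mu> (m - 1) / of_nat m)" using \<open>m > 0\<close> by (auto simp: field_simps)
  then show ?thesis using polys_overD[OF \<mu>(1)] by (metis E.divide E.of_nat E.uminus)
qed

section \<open>Finite extensions and Dedekind independence\<close>

lemma ambient_simps [simp]:
  "carrier (ambient :: 'k::field ring) = UNIV" "\<zero>\<^bsub>(ambient :: 'k ring)\<^esub> = 0"
  "\<one>\<^bsub>(ambient :: 'k ring)\<^esub> = 1" "x \<oplus>\<^bsub>(ambient :: 'k ring)\<^esub> y = x + y"
  "x \<otimes>\<^bsub>(ambient :: 'k ring)\<^esub> y = x * y"
  by (auto simp: ring_of_type_algebra_def)

lemma ambient_pow: "x [^]\<^bsub>(ambient :: 'k::field ring)\<^esub> (n::nat) = x ^ n"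
  by (induction n) (auto simp: nat_pow_def mult.commute)

lemma ambient_uminus: "\<ominus>\<^bsub>(ambient :: 'k::field ring)\<^esub> x = - x"
proof -
  interpret R: field "ambient :: 'k ring" by rule
  show ?thesis using R.minus_equality[of "- x" x] by simp
qed

lemma subfield_of_ambient:
  assumes "subfield E (ambient :: 'k::field ring)"
  shows "subfield_of E"
proof -
  interpret R: field "ambient :: 'k ring" by rule
  note s = subringE[OF subfieldE(1)[OF assms]]
  show ?thesis
  proof
    show "0 \<in> E" "1 \<in> E" using s(2,3) by auto
    fix x y assume "x \<in> E" "y \<in> E"
    then show "x + y \<in> E" "x * y \<in> E" using s(6,7)[of x y] by auto
  next
    fix x assume x: "x \<in> E"
    show "- x \<in> E" using s(5)[OF x] ambient_uminus by metis
    show "inverse x \<in> E"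
    proof (cases "x = 0")
      case False
      have "x \<in> E - {\<zero>\<^bsub>(ambient :: 'k ring)\<^esub>}" using x False by simp
      from R.subfield_m_inv[OF assms this]
      have "inv\<^bsub>(ambient :: 'k ring)\<^esub> x \<in> E" "x * inv\<^bsub>(ambient :: 'k ring)\<^esub> x = 1" by auto
      then show ?thesis by (metis inverse_unique)
    qed (use x in simp)
  qed
qed

lemma combine_ambient:
  fixes Ks Us :: "'k::field list"
  shows "length Ks = length Us \<Longrightarrow>
     ring.combine (ambient :: 'k ring) Ks Us = (\<Sum>i<length Us. Ks ! i * Us ! i)"
proof (induction Ks Us rule: list_induct2)
  case (Cons k Ks u Us)
  interpret R: field "ambient :: 'k ring" by rule
  show ?case using Cons by (simp add: R.combine.simps sum.lessThan_Suc_shift del: sum.lessThan_Suc)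
next
  case Nil
  interpret R: field "ambient :: 'k ring" by rule
  show ?case by simp
qed

text \<open>In dimension d the powers 1, x, ..., x^d are dependent. The bound has to be uniform in
  x, because the existence of a uniformiser and the finiteness of the residue field are both deduced
  from it.\<close>

lemma finite_ext_bounded_degree:
  assumes "finite_field_ext E (F :: 'k::field set)"
  obtains d where "\<And>x. x \<in> F \<Longrightarrow> \<exists>h \<in> polys_over E. h \<noteq> 0 \<and> Polynomial.degree h \<le> d \<and> poly h x = 0"
proof -
  interpret R: field "ambient :: 'k ring" by rule
  have E: "subfield E (ambient :: 'k ring)" and F: "subfield F (ambient :: 'k ring)"
    using assms by (auto simp: finite_field_ext_def)
  obtain d where d: "R.dimension d E F" using assms by (auto simp: finite_field_ext_def R.finite_dimension_def)
  interpret FF: subfield_of F by (rule subfield_of_ambient[OF F])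
  interpret EE: subfield_of E by (rule subfield_of_ambient[OF E])
  have "\<exists>h \<in> polys_over E. h \<noteq> 0 \<and> Polynomial.degree h \<le> d \<and> poly h x = 0" if x: "x \<in> F" for x
  proof -
    define Us where "Us = map (\<lambda>i. x ^ i) [0..<Suc d]"
    have "set Us \<subseteq> F" using x by (auto simp: Us_def)
    hence "\<not> R.independent E Us"
      using R.independent_length_le_dimension[OF E d, of Us] by (auto simp: Us_def)
    then obtain Ks where "length Ks = length Us" "R.combine Ks Us = \<zero>\<^bsub>(ambient :: 'k ring)\<^esub>"
        "set Ks \<subseteq> E" "set Ks \<noteq> {\<zero>\<^bsub>(ambient :: 'k ring)\<^esub>}"
      using R.dependent_imp_non_trivial_combine[OF E, of Us] unfolding ambient_simps(1) by blast
    then have Ks: "length Ks = length Us" "R.combine Ks Us = 0" "set Ks \<subseteq> E" "set Ks \<noteq> {0}"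
      by simp_all
    define h where "h = (\<Sum>i<Suc d. Polynomial.monom (Ks ! i) i)"
    have coeff: "Polynomial.coeff h i = (if i < Suc d then Ks ! i else 0)" for i
      by (auto simp: h_def coeff_sum coeff_monom if_distrib cong: if_cong)
    have len: "length Ks = Suc d" using Ks(1) by (simp add: Us_def)
    have "h \<in> polys_over E" using Ks(3) len by (auto simp: polys_over_def coeff)
    moreover have "h \<noteq> 0"
    proof
      assume "h = 0"
      hence "Ks ! i = 0" if "i < Suc d" for i using coeff[of i] that by simp
      hence "set Ks \<subseteq> {0}" using len by (auto simp: in_set_conv_nth)
      moreover have "Ks \<noteq> []" using len by auto
      ultimately show False using Ks(4) by (metis set_empty subset_singletonD)
    qed
    moreover have "Polynomial.degree h \<le> d" by (rule degree_le) (auto simp: coeff)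
    moreover have "poly h x = R.combine Ks Us"
      unfolding combine_ambient[OF Ks(1)] by (simp add: h_def poly_sum poly_monom Us_def del: upt_Suc sum.lessThan_Suc)
    ultimately show ?thesis using Ks(2) by auto
  qed
  then show thesis by (rule that)
qed

text \<open>A basis detects whether an automorphism is trivial on \<open>F\<close>; this replaces
  Krull neighbourhoods by stabilisers of finite sets.\<close>

lemma finite_ext_generators:
  assumes "finite_field_ext E (F :: 'k::field set)"
  obtains Z where "finite Z" "Z \<subseteq> F"
    "\<And>\<tau>. \<tau> \<in> carrier (abs_Gal E) \<Longrightarrow> \<forall>x\<in>Z. \<tau> x = x \<Longrightarrow> \<forall>x\<in>F. \<tau> x = x"
proof -
  interpret R: field "ambient :: 'k ring" by rule
  have E: "subfield E (ambient :: 'k ring)"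
    using assms by (auto simp: finite_field_ext_def)
  obtain d where d: "R.dimension d E F" using assms by (auto simp: finite_field_ext_def R.finite_dimension_def)
  obtain Us where Us: "R.independent E Us" "R.Span E Us = F"
    using R.exists_base[OF E d] by blast
  have span: "\<tau> x = x" if "\<tau> \<in> carrier (abs_Gal E)" "\<forall>x\<in>set Vs. \<tau> x = x" "x \<in> R.Span E Vs" for \<tau> x Vs
  proof -
    interpret field_auto \<tau> using that(1) by (rule abs_Gal_auto)
    show ?thesis using that(2,3)
    proof (induction Vs arbitrary: x)
      case (Cons v Vs)
      then obtain k e where "k \<in> E" "e \<in> R.Span E Vs" "x = k * v + e"
        using R.line_extension_mem_iff[of x E v "R.Span E Vs"] by auto
      then show ?case using Cons abs_Gal_fix[OF that(1)] by auto
    qed simp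
  qed
  have "set Us \<subseteq> F" using R.Span_base_incl[OF E, of Us] Us(2) by auto
  then show thesis by (rule that[rotated]) (use span Us(2) in auto)
qed

text \<open>Polynomials over ring records are coefficient lists that start with the leading
  coefficient, hence the reversal.\<close>

lemma eval_ambient: "ring.eval (ambient :: 'k::field ring) p x = poly (Poly (rev p)) x"
proof (induction p)
  case (Cons c p)
  interpret R: field "ambient :: 'k ring" by rule
  show ?case using Cons
    by (simp add: R.eval.simps ambient_pow Poly_append poly_monom)
next
  case Nil
  interpret R: field "ambient :: 'k ring" by rule
  show ?case by simp
qed

lemma algebraic_imp_alg_over:
  assumes E: "subfield E (ambient :: 'k::field ring)" and alg: "(ring.algebraic ambient over E) (x :: 'k)"
  shows "alg_over E x"
proof -
  interpret R: field "ambient :: 'k ring" by rule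
  interpret EE: subfield_of E by (rule subfield_of_ambient[OF E])
  obtain p where p: "p \<in> carrier (univ_poly ambient E)" "p \<noteq> []" "R.eval p x = 0"
    using R.algebraicE[OF subfieldE(1)[OF E] _ alg] by auto
  have pp: "set p \<subseteq> E" "hd p \<noteq> 0" using p(1,2) by (auto simp: univ_poly_def polynomial_def)
  have "Poly (rev p) \<noteq> 0"
  proof
    assume "Poly (rev p) = 0"
    then obtain n where "rev p = replicate n 0" by (auto simp: Poly_eq_0)
    hence "hd p \<in> {0}" using p(2) by (metis hd_in_set in_set_replicate set_rev singletonI)
    then show False using pp by auto
  qed
  moreover have "Poly (rev p) \<in> polys_over E"
    using pp(1) by (auto simp: polys_over_def nth_default_def intro!: subsetD[OF pp(1)]) (metis length_rev nth_mem set_rev)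
  ultimately show ?thesis using p(3) eval_ambient unfolding alg_over_def by metis
qed

text \<open>The simple extension L(x) is finite over \<open>L\<close>, hence over \<open>E\<close>
  by the tower formula, so x is algebraic over \<open>E\<close>.\<close>

lemma algebraic_closure_alg_over:
  assumes ext: "finite_field_ext E L" and cl: "algebraic_closure (ambient :: 'k::field ring) L"
  shows "alg_over E x"
proof -
  interpret R: field "ambient :: 'k ring" by rule
  have E: "subfield E (ambient :: 'k ring)" and L: "subfield L (ambient :: 'k ring)"
    and EL: "E \<subseteq> L" and fd: "R.finite_dimension E L"
    using ext by (auto simp: finite_field_ext_def)
  have alg: "(R.algebraic over L) x" using algebraic_closure.algebraic_extension[OF cl] by simp
  have "R.finite_dimension L (R.simple_extension L x)"
    using R.finite_dimension_simple_extension[OF L, of x] alg by (simp add: over_def)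
  hence "R.finite_dimension E (R.simple_extension L x)"
    using fd R.telescopic_base[OF E L] unfolding R.finite_dimension_def by blast
  hence "(R.algebraic over E) x"
    using R.finite_dimension_imp_algebraic[OF E R.simple_extension_is_subring[OF subfieldE(1)[OF L]]]
      R.simple_extension_mem[OF subfieldE(1)[OF L]] by simp
  then show ?thesis using algebraic_imp_alg_over[OF E] by blast
qed

section \<open>Conjugates and invariant polynomials\<close>

definition conjugates :: "'k::field set \<Rightarrow> 'k \<Rightarrow> 'k set" where
  "conjugates E x = (\<lambda>\<tau>. \<tau> x) ` carrier (abs_Gal E)"

lemma conjugates_self [simp]: "x \<in> conjugates E x"
  unfolding conjugates_def using abs_Gal_id by (metis id_apply image_eqI)

lemma finite_conjugates:
  assumes "alg_over E x" shows "finite (conjugates E x)"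
proof -
  obtain h where h: "h \<in> polys_over E" "h \<noteq> 0" "poly h x = 0" using assms unfolding alg_over_def by blast
  have "conjugates E x \<subseteq> {y. poly h y = 0}"
    using abs_Gal_root[OF _ h(1,3)] by (auto simp: conjugates_def)
  then show ?thesis using poly_roots_finite[OF h(2)] finite_subset by blast
qed

lemma abs_Gal_image_eqI:
  assumes "\<And>\<tau>. \<tau> \<in> carrier (abs_Gal E) \<Longrightarrow> \<tau> ` Z \<subseteq> Z" "\<tau> \<in> carrier (abs_Gal E)"
  shows "\<tau> ` Z = Z"
proof
  show "Z \<subseteq> \<tau> ` Z"
  proof
    fix x assume "x \<in> Z"
    then have "Hilbert_Choice.inv \<tau> x \<in> Z" using assms(1)[OF abs_Gal_inv[OF assms(2)]] by blast
    then show "x \<in> \<tau> ` Z" using abs_Gal_inv_apply(1)[OF assms(2), of x] by (metis image_eqI)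
  qed
qed (use assms in blast)

lemma abs_Gal_image_conjugates:
  assumes "\<tau> \<in> carrier (abs_Gal E)" shows "\<tau> ` conjugates E x = conjugates E x"
proof (rule abs_Gal_image_eqI[OF _ assms], rule image_subsetI)
  fix \<omega> y assume w: "\<omega> \<in> carrier (abs_Gal E)" and "y \<in> conjugates E x"
  then obtain \<tau> where t: "\<tau> \<in> carrier (abs_Gal E)" "y = \<tau> x" by (auto simp: conjugates_def)
  have "\<omega> y = (\<omega> \<circ> \<tau>) x" using t by simp
  then show "\<omega> y \<in> conjugates E x" unfolding conjugates_def using abs_Gal_comp[OF w t(1)] by (rule image_eqI)
qed

text \<open>Automorphisms permute the linear factors, so the coefficients are fixed and lie in
  \<open>E\<close>. A set of integral conjugates thereby yields an integral equation.\<close>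

lemma stable_prod_polys_over:
  fixes E :: "'k::{alg_closed_field, field_char_0} set"
  assumes E: "subfield_of E" and alg: "\<And>x. alg_over E x"
    and stable: "\<And>\<tau>. \<tau> \<in> carrier (abs_Gal E) \<Longrightarrow> \<tau> ` Z = Z"
  shows "(\<Prod>x\<in>Z. [:- x, 1:]) \<in> polys_over E"
  unfolding polys_over_def mem_Collect_eq
proof
  fix i
  show "Polynomial.coeff (\<Prod>x\<in>Z. [:- x, 1:]) i \<in> E"
  proof (rule abs_Gal_fixed[OF E alg])
    fix \<tau> assume t: "\<tau> \<in> carrier (abs_Gal E)"
    interpret field_auto \<tau> using t by (rule abs_Gal_auto)
    have inj: "inj_on \<tau> Z" by (simp add: inj_on_def)
    have "map_poly \<tau> (\<Prod>x\<in>Z. [:- x, 1:]) = (\<Prod>x\<in>Z. [:- \<tau> x, 1:])"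
      by (simp add: map_poly_prod map_poly_pCons)
    also have "\<dots> = (\<Prod>x\<in>\<tau> ` Z. [:- x, 1:])" by (simp add: prod.reindex[OF inj])
    finally have "map_poly \<tau> (\<Prod>x\<in>Z. [:- x, 1:]) = (\<Prod>x\<in>Z. [:- x, 1:])" using stable[OF t] by simp
    then show "\<tau> (Polynomial.coeff (\<Prod>x\<in>Z. [:- x, 1:]) i) = Polynomial.coeff (\<Prod>x\<in>Z. [:- x, 1:]) i"
      by (metis coeff_map_poly zero)
  qed
qed

text \<open>If y separates two of the maps, the relation at y x minus f_j(y) times the relation at x
  is a shorter relation. Only a multiplicative monoid \<open>N\<close> is asked for, so independence
  can be applied on the fixed elements of a stabiliser.\<close>

lemma dedekind_independence:
  fixes f :: "'i \<Rightarrow> 'k::field \<Rightarrow> 'k"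
  assumes "finite I" and one: "1 \<in> N" and N: "\<And>x y. x \<in> N \<Longrightarrow> y \<in> N \<Longrightarrow> x * y \<in> N"
    and "\<And>i x y. i \<in> I \<Longrightarrow> x \<in> N \<Longrightarrow> y \<in> N \<Longrightarrow> f i (x * y) = f i x * f i y"
    and "\<And>i. i \<in> I \<Longrightarrow> f i 1 = 1"
    and "\<And>i j. i \<in> I \<Longrightarrow> j \<in> I \<Longrightarrow> i \<noteq> j \<Longrightarrow> \<exists>x\<in>N. f i x \<noteq> f j x"
    and "\<And>x. x \<in> N \<Longrightarrow> (\<Sum>i\<in>I. c i * f i x) = 0"
  shows "\<forall>i\<in>I. c i = 0"
  using assms(1,4-)
proof (induction I arbitrary: c rule: finite_induct)
  case (insert j I)
  have sum0: "(\<Sum>i\<in>I. c i * f i x) = - (c j * f j x)" if "x \<in> N" for x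
    using insert.prems(4)[OF that] insert.hyps by (simp add: eq_neg_iff_add_eq_0 add.commute)
  have "c i = 0" if i: "i \<in> I" for i
  proof -
    obtain y where y: "y \<in> N" "f i y \<noteq> f j y" using insert.prems(3)[of i j] i insert.hyps by auto
    have "\<forall>i\<in>I. c i * (f i y - f j y) = 0"
    proof (rule insert.IH)
      fix x assume x: "x \<in> N"
      have "(\<Sum>i\<in>I. c i * (f i y - f j y) * f i x) = (\<Sum>i\<in>I. c i * f i (y * x)) - f j y * (\<Sum>i\<in>I. c i * f i x)"
        using x y(1) insert.prems(1) by (simp add: sum_distrib_left sum_subtractf[symmetric] algebra_simps)
      also have "\<dots> = 0"
        using sum0[OF x] sum0[OF N[OF y(1) x]] insert.prems(1)[of j y x] x y(1) by simp
      finally show "(\<Sum>i\<in>I. c i * (f i y - f j y) * f i x) = 0" .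
    qed (use insert.prems in auto)
    then show ?thesis using i y(2) by auto
  qed
  moreover from this have "c j = 0" using sum0[OF one] insert.prems(2)[of j] by simp
  ultimately show ?case by blast
qed simp

text \<open>
  A subgroup containing the pointwise stabiliser of a finite set is everything once it has no more
  fixed points than the whole group: otherwise the trace from the finite quotient of the subgroup
  would violate Dedekind's independence of automorphisms.
\<close>

theorem abs_Gal_subgroup_eq:
  fixes E :: "'k::field set"
  assumes alg: "\<And>x. alg_over E x"
    and S: "S \<subseteq> carrier (abs_Gal E)" "\<And>\<tau> \<omega>. \<tau> \<in> S \<Longrightarrow> \<omega> \<in> S \<Longrightarrow> \<tau> \<circ> \<omega> \<in> S"
      "\<And>\<tau>. \<tau> \<in> S \<Longrightarrow> Hilbert_Choice.inv \<tau> \<in> S"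
    and Z: "finite Z" "\<And>\<tau>. \<tau> \<in> carrier (abs_Gal E) \<Longrightarrow> \<forall>x\<in>Z. \<tau> x = x \<Longrightarrow> \<tau> \<in> S"
    and fixed: "\<And>x \<omega>. \<forall>\<tau>\<in>S. \<tau> x = x \<Longrightarrow> \<omega> \<in> carrier (abs_Gal E) \<Longrightarrow> \<omega> x = x"
    and \<omega>: "\<omega> \<in> carrier (abs_Gal E)"
  shows "\<omega> \<in> S"
proof (rule ccontr)
  assume \<omega>S: "\<omega> \<notin> S"
  define Y where "Y = (\<Union>x\<in>Z. conjugates E x)"
  have Yfin: "finite Y" using Z(1) finite_conjugates[OF alg] by (simp add: Y_def)
  have XY: "Z \<subseteq> Y" by (auto simp: Y_def)
  have Ystab: "\<tau> ` Y = Y" if "\<tau> \<in> carrier (abs_Gal E)" for \<tau>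
    using abs_Gal_image_conjugates[OF that] by (simp add: Y_def image_UN)
  define U where "U = {\<tau> \<in> carrier (abs_Gal E). \<forall>y\<in>Y. \<tau> y = y}"
  \<comment> \<open>The fixed elements of the stabiliser of the finite Galois-stable set
    \<open>Y\<close>. On them an automorphism is determined by its values on \<open>Y\<close>, so
    \<open>S\<close> acts through a finite group.\<close>
  define N where "N = {x. \<forall>\<tau>\<in>U. \<tau> x = x}"
  have US: "U \<subseteq> S" using Z(2) XY by (auto simp: U_def)
  have YN: "Y \<subseteq> N" by (auto simp: U_def N_def)
  have agree: "\<tau> x = \<omega>' x" if t: "\<tau> \<in> carrier (abs_Gal E)" "\<omega>' \<in> carrier (abs_Gal E)"
    "\<forall>y\<in>Y. \<tau> y = \<omega>' y" "x \<in> N" for \<tau> \<omega>' x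
  proof -
    have "Hilbert_Choice.inv \<omega>' \<circ> \<tau> \<in> U"
      using t abs_Gal_comp[OF abs_Gal_inv[OF t(2)] t(1)] abs_Gal_inv_apply[OF t(2)] by (auto simp: U_def)
    hence "Hilbert_Choice.inv \<omega>' (\<tau> x) = x" using t(4) by (auto simp: N_def)
    then show ?thesis using abs_Gal_inv_apply(1)[OF t(2)] by metis
  qed
  have Nstab: "\<tau> x \<in> N" if t: "\<tau> \<in> carrier (abs_Gal E)" and x: "x \<in> N" for \<tau> x
    unfolding N_def
  proof (intro CollectI ballI)
    fix u assume u: "u \<in> U"
    hence uG: "u \<in> carrier (abs_Gal E)" by (simp add: U_def)
    have "u (\<tau> y) = \<tau> y" if "y \<in> Y" for y using Ystab[OF t] that u by (auto simp: U_def)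
    then show "u (\<tau> x) = \<tau> x" using agree[OF abs_Gal_comp[OF uG t] t _ x] by simp
  qed
  have N1: "1 \<in> N" by (auto simp: N_def U_def dest!: abs_Gal_auto field_auto.one)
  have Nmult: "x * y \<in> N" if "x \<in> N" "y \<in> N" for x y
    using that by (auto simp: N_def U_def field_auto.mult[OF abs_Gal_auto])
  have idS: "id \<in> S" using Z(2)[OF abs_Gal_id] by simp
  define R where "R = (\<lambda>\<tau>. restrict \<tau> Y) ` S"
  \<comment> \<open>One representative in \<open>S\<close> for each restriction to \<open>Y\<close>;
    the sum of their actions on \<open>N\<close> is the trace of the finite quotient.\<close>
  define h where "h = inv_into S (\<lambda>\<tau>. restrict \<tau> Y)"
  have "\<tau> y \<in> Y" if "\<tau> \<in> S" "y \<in> Y" for \<tau> y using Ystab[of \<tau>] S(1) that by blast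
  hence "R \<subseteq> Y \<rightarrow>\<^sub>E Y" by (auto simp: R_def)
  hence Rfin: "finite R" by (rule finite_subset) (simp add: Yfin finite_PiE)
  have h: "h r \<in> S" "restrict (h r) Y = r" if "r \<in> R" for r
    using that inv_into_into[of r "\<lambda>\<tau>. restrict \<tau> Y" S] f_inv_into_f[of r "\<lambda>\<tau>. restrict \<tau> Y" S]
    by (auto simp: R_def h_def)
  have hG: "h r \<in> carrier (abs_Gal E)" if "r \<in> R" for r using h(1)[OF that] S(1) by blast
  have T: "\<tau> (\<Sum>r\<in>R. h r x) = (\<Sum>r\<in>R. h r x)" if t: "\<tau> \<in> S" and x: "x \<in> N" for \<tau> x
  proof -
    have tG: "\<tau> \<in> carrier (abs_Gal E)" using t S(1) by blast
    interpret field_auto \<tau> using tG by (rule abs_Gal_auto)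
    define m where "m r = restrict (\<tau> \<circ> h r) Y" for r
    have mR: "m r \<in> R" if "r \<in> R" for r using S(2)[OF t h(1)[OF that]] by (auto simp: m_def R_def)
    have inj: "inj_on m R"
    proof
      fix r r' assume r: "r \<in> R" "r' \<in> R" and "m r = m r'"
      have "h r y = h r' y" if "y \<in> Y" for y
        using fun_cong[OF \<open>m r = m r'\<close>, of y] that by (simp add: m_def)
      hence "restrict (h r) Y = restrict (h r') Y" by auto
      then show "r = r'" using h(2) r by simp
    qed
    hence img: "m ` R = R" using mR Rfin by (intro endo_inj_surj) auto
    have "\<tau> (h r x) = h (m r) x" if "r \<in> R" for r
    proof -
      have "\<forall>y\<in>Y. (\<tau> \<circ> h r) y = h (m r) y"
        using h(2)[OF mR[OF that]] by (metis m_def restrict_apply')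
      then show ?thesis using agree[OF abs_Gal_comp[OF tG hG[OF that]] hG[OF mR[OF that]] _ x] by simp
    qed
    hence "\<tau> (\<Sum>r\<in>R. h r x) = (\<Sum>r\<in>R. h (m r) x)" by simp
    also have "\<dots> = (\<Sum>r\<in>m ` R. h r x)" by (simp add: sum.reindex[OF inj])
    finally show ?thesis using img by simp
  qed
  \<comment> \<open>The trace has values fixed by \<open>S\<close>, hence by \<omega>. With
    coefficients 1 and -1 this becomes a linear relation between the maps h r and \<omega> \<circ> h
    r, which are distinct on \<open>N\<close> because \<omega> lies outside
    \<open>S\<close>.\<close>
  define f where "f = case_sum h (\<lambda>r. \<omega> \<circ> h r)"
  define c :: "('k \<Rightarrow> 'k) + ('k \<Rightarrow> 'k) \<Rightarrow> 'k" where "c = case_sum (\<lambda>_. 1) (\<lambda>_. - 1)"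
  have fG: "f i \<in> carrier (abs_Gal E)" if "i \<in> R <+> R" for i
    using that hG abs_Gal_comp[OF \<omega>] by (auto simp: f_def)
  have sep: "\<exists>x\<in>N. f i x \<noteq> f j x" if "\<not> (\<forall>y\<in>Y. f i y = f j y)" for i j
    using that YN by blast
  have hsep: "r = r'" if "r \<in> R" "r' \<in> R" "\<forall>y\<in>Y. h r y = h r' y" for r r'
  proof -
    have "restrict (h r) Y = restrict (h r') Y" using that(3) by auto
    then show ?thesis using h(2) that by simp
  qed
  have cross: False if "r \<in> R" "r' \<in> R" and eq: "\<forall>y\<in>Y. \<omega> (h r y) = h r' y" for r r'
  proof -
    have "\<omega> z = (h r' \<circ> Hilbert_Choice.inv (h r)) z" if z: "z \<in> Y" for z
    proof -
      have "Hilbert_Choice.inv (h r) z \<in> Y" using Ystab[OF abs_Gal_inv[OF hG[OF \<open>r \<in> R\<close>]]] z by blast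
      then show ?thesis using eq abs_Gal_inv_apply(1)[OF hG[OF \<open>r \<in> R\<close>], of z] by auto
    qed
    define k where "k = h r' \<circ> Hilbert_Choice.inv (h r)"
    have kS: "k \<in> S" unfolding k_def using S(2,3) h(1) that by blast
    hence kG: "k \<in> carrier (abs_Gal E)" using S(1) by blast
    have "Hilbert_Choice.inv k \<circ> \<omega> \<in> U"
      using \<open>\<And>z. z \<in> Y \<Longrightarrow> \<omega> z = _ z\<close> abs_Gal_comp[OF abs_Gal_inv[OF kG] \<omega>] abs_Gal_inv_apply(2)[OF kG]
      by (auto simp: U_def k_def[symmetric])
    hence "k \<circ> (Hilbert_Choice.inv k \<circ> \<omega>) \<in> S" using S(2) kS US by blast
    moreover have "k \<circ> (Hilbert_Choice.inv k \<circ> \<omega>) = \<omega>" using abs_Gal_inv_apply(1)[OF kG] by auto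
    ultimately show False using \<omega>S by simp
  qed
  have "\<forall>i\<in>R <+> R. c i = 0"
  proof (rule dedekind_independence[where N = N and f = f])
    show "finite (R <+> R)" using Rfin by simp
    show "1 \<in> N" "\<And>x y. x \<in> N \<Longrightarrow> y \<in> N \<Longrightarrow> x * y \<in> N" by (fact N1, fact Nmult)
    show "f i (x * y) = f i x * f i y" "f i 1 = 1" if "i \<in> R <+> R" for i x y
      using field_auto.mult[OF abs_Gal_auto[OF fG[OF that]]] field_auto.one[OF abs_Gal_auto[OF fG[OF that]]]
      by auto
    show "\<exists>x\<in>N. f i x \<noteq> f j x" if "i \<in> R <+> R" "j \<in> R <+> R" "i \<noteq> j" for i j
    proof (rule sep, rule notI)
      assume "\<forall>y\<in>Y. f i y = f j y"
      then show False using that hsep cross field_auto.eq_iff[OF abs_Gal_auto[OF \<omega>]]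
        by (auto simp: f_def) metis+
    qed
    show "(\<Sum>i\<in>R <+> R. c i * f i x) = 0" if "x \<in> N" for x
    proof -
      have "\<omega> (\<Sum>r\<in>R. h r x) = (\<Sum>r\<in>R. h r x)" using fixed[OF _ \<omega>] T that by blast
      then show ?thesis using Rfin
        by (simp add: sum.Plus f_def c_def sum_negf field_auto.sum[OF abs_Gal_auto[OF \<omega>]])
    qed
  qed
  moreover have "Inl (restrict id Y) \<in> R <+> R" using idS by (auto simp: R_def)
  ultimately have "c (Inl (restrict id Y)) = 0" by blast
  then show False by (simp add: c_def)
qed

text \<open>Induction over the generation of the topology, with unions of the finite sets at
  intersections. Continuity is used later only in this form.\<close>

lemma krull_open_stabiliser:
  assumes "openin (krull_topology (L :: 'k::field set)) V" "id \<in> V"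
  obtains Z where "finite Z" "\<And>\<tau>. \<tau> \<in> carrier (abs_Gal L) \<Longrightarrow> \<forall>x\<in>Z. \<tau> x = x \<Longrightarrow> \<tau> \<in> V"
proof -
  have "\<exists>Z. finite Z \<and> (\<forall>\<tau> \<in> carrier (abs_Gal L). (\<forall>x\<in>Z. \<tau> x = x) \<longrightarrow> \<tau> \<in> V)"
    using assms unfolding krull_topology_def openin_topology_generated_by_iff
  proof (induction rule: generate_topology_on.induct)
    case (Int a b)
    then obtain Z Y where "finite Z" "finite Y"
      "\<forall>\<tau> \<in> carrier (abs_Gal L). (\<forall>x\<in>Z. \<tau> x = x) \<longrightarrow> \<tau> \<in> a"
      "\<forall>\<tau> \<in> carrier (abs_Gal L). (\<forall>x\<in>Y. \<tau> x = x) \<longrightarrow> \<tau> \<in> b" by auto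
    then show ?case by (intro exI[of _ "Z \<union> Y"]) auto
  next
    case (UN K)
    then obtain k where k: "k \<in> K" "id \<in> k" by blast
    then show ?case using UN.IH[OF k] by blast
  next
    case (Basis s)
    then obtain \<omega> F where s: "s = {\<tau> \<in> carrier (abs_Gal L). \<forall>x\<in>F. \<tau> x = \<omega> x}" "finite_field_ext L F"
      by auto
    obtain Z where Z: "finite Z" "Z \<subseteq> F"
      "\<And>\<tau>. \<tau> \<in> carrier (abs_Gal L) \<Longrightarrow> \<forall>x\<in>Z. \<tau> x = x \<Longrightarrow> \<forall>x\<in>F. \<tau> x = x"
      by (rule finite_ext_generators[OF s(2)]) (rule that)
    have "\<forall>x\<in>F. \<omega> x = x" using Basis(2) s(1) by simp
    then have "\<tau> \<in> s" if "\<tau> \<in> carrier (abs_Gal L)" "\<forall>x\<in>Z. \<tau> x = x" for \<tau>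
      using Z(3)[OF that] that(1) s(1) by simp
    then show ?case using Z(1) by (intro exI[of _ Z]) simp
  qed auto
  then obtain Z where "finite Z \<and> (\<forall>\<tau> \<in> carrier (abs_Gal L). (\<forall>x\<in>Z. \<tau> x = x) \<longrightarrow> \<tau> \<in> V)" ..
  then show thesis by (intro that[of Z]) auto
qed

lemma continuous_hom_kernel:
  assumes "continuous_hom L G \<rho>" "group G" and L: "subfield L (ambient :: 'k::field ring)"
  obtains Z where "finite Z"
    "\<And>\<tau>. \<tau> \<in> carrier (abs_Gal L) \<Longrightarrow> \<forall>x\<in>Z. \<tau> x = x \<Longrightarrow> \<rho> \<tau> = \<one>\<^bsub>G\<^esub>"
proof -
  interpret group G by fact
  have hom: "\<rho> \<in> hom (abs_Gal L) G" and cont: "continuous_map (krull_topology L) (discrete_topology (carrier G)) \<rho>"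
    using assms(1) by (auto simp: continuous_hom_def)
  have "\<rho> id \<otimes>\<^bsub>G\<^esub> \<rho> id = \<rho> id"
    using hom_mult[OF hom abs_Gal_id abs_Gal_id] abs_Gal_mult[OF abs_Gal_id abs_Gal_id, of L] by simp
  moreover have "\<rho> id \<in> carrier G" using hom abs_Gal_id by (auto simp: hom_def)
  ultimately have id: "\<rho> id = \<one>\<^bsub>G\<^esub>" by (metis l_cancel_one)
  define V where "V = {\<tau> \<in> topspace (krull_topology L). \<rho> \<tau> \<in> {\<one>\<^bsub>G\<^esub>}}"
  have "openin (krull_topology L) V"
    unfolding V_def by (rule openin_continuous_map_preimage[OF cont]) simp
  \<comment> \<open>The space consists of what the generating sets cover; that the identity belongs
    to it follows from the extension \<open>L\<close> of itself.\<close>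
  moreover have "id \<in> topspace (krull_topology L)"
  proof -
    interpret R: field "ambient :: 'k ring" by rule
    have "finite_field_ext L L"
      using L R.dimension_one[OF L] by (auto simp: finite_field_ext_def R.finite_dimension_def)
    then show ?thesis
      unfolding krull_topology_def topology_generated_by_topspace using abs_Gal_id[of L] by blast
  qed
  ultimately have "openin (krull_topology L) V" "id \<in> V" using id by (auto simp: V_def)
  then obtain Z where Z: "finite Z"
    "\<And>\<tau>. \<tau> \<in> carrier (abs_Gal L) \<Longrightarrow> \<forall>x\<in>Z. \<tau> x = x \<Longrightarrow> \<tau> \<in> V"
    by (rule krull_open_stabiliser) (rule that)
  show thesis by (rule that[OF Z(1)]) (use Z(2) in \<open>simp add: V_def\<close>)
qed

section \<open>The valuation ring of the algebraic closure\<close>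

text \<open>No value group is introduced: \<open>x / y \<in> V\<close> expresses that x is at most
  as large as y.\<close>

locale valuation_subring = subring_of V for V :: "'k::field set" +
  assumes val: "x \<in> V \<or> inverse x \<in> V"
begin

text \<open>The maximal ideal; zero is listed separately because \<open>inverse 0 = 0\<close>
  belongs to \<open>V\<close>.\<close>

definition nonunits :: "'k set" where
  "nonunits = {x \<in> V. x = 0 \<or> inverse x \<notin> V}"

lemma nonunits_V: "x \<in> nonunits \<Longrightarrow> x \<in> V"
  and zero_nonunit [simp]: "0 \<in> nonunits"
  and one_not_nonunit [simp]: "1 \<notin> nonunits"
  by (auto simp: nonunits_def)

lemma nonunits_iff: "x \<noteq> 0 \<Longrightarrow> x \<in> nonunits \<longleftrightarrow> inverse x \<notin> V"
  using val[of x] by (auto simp: nonunits_def)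

lemma nonunits_mult: "x \<in> V \<Longrightarrow> y \<in> nonunits \<Longrightarrow> x * y \<in> nonunits"
proof -
  assume x: "x \<in> V" and y: "y \<in> nonunits"
  have "inverse y \<in> V" if "inverse (x * y) \<in> V" "x \<noteq> 0" "y \<noteq> 0"
    using mult[OF x that(1)] that(2,3) by (simp add: mult.assoc[symmetric])
  then show ?thesis using x y by (cases "x = 0 \<or> y = 0") (auto simp: nonunits_def)
qed

lemma nonunits_mult': "y \<in> nonunits \<Longrightarrow> x \<in> V \<Longrightarrow> y * x \<in> nonunits"
  using nonunits_mult[of x y] by (simp add: mult.commute)

lemma nonunits_uminus: "x \<in> nonunits \<Longrightarrow> - x \<in> nonunits"
  using nonunits_mult[of "- 1" x] by (simp add: uminus)

lemma nonunits_add: "x \<in> nonunits \<Longrightarrow> y \<in> nonunits \<Longrightarrow> x + y \<in> nonunits"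
proof (cases "x = 0 \<or> y = 0")
  case False
  assume xy: "x \<in> nonunits" "y \<in> nonunits"
  have *: "a + b \<in> nonunits" if "b / a \<in> V" "a \<in> nonunits" "a \<noteq> 0" for a b
    using nonunits_mult'[OF that(2) add[OF one that(1)]] that(3) by (simp add: distrib_left)
  have "y / x \<in> V \<or> x / y \<in> V" using val[of "y / x"] by simp
  then show ?thesis using *[of y x] *[of x y] xy False by (auto simp: add.commute)
qed auto

lemma nonunits_diff: "x \<in> nonunits \<Longrightarrow> y \<in> nonunits \<Longrightarrow> x - y \<in> nonunits"
  using nonunits_add[OF _ nonunits_uminus, of x y] by simp

lemma nonunits_sum: "(\<And>i. i \<in> I \<Longrightarrow> f i \<in> nonunits) \<Longrightarrow> sum f I \<in> nonunits"
  by (induction I rule: infinite_finite_induct) (auto intro: nonunits_add)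

lemma nonunits_prime: "x * y \<in> nonunits \<Longrightarrow> x \<in> V \<Longrightarrow> y \<in> V \<Longrightarrow> x \<in> nonunits \<or> y \<in> nonunits"
  by (cases "x = 0 \<or> y = 0") (auto simp: nonunits_iff mult)

lemma nonunits_prod:
  "finite I \<Longrightarrow> prod f I \<in> nonunits \<Longrightarrow> (\<And>i. i \<in> I \<Longrightarrow> f i \<in> V) \<Longrightarrow> \<exists>i\<in>I. f i \<in> nonunits"
proof (induction I rule: finite_induct)
  case (insert i I)
  then show ?case using nonunits_prime[of "f i" "prod f I"] prod[of I f] by auto
qed auto

lemma nonunits_power: "x ^ n \<in> nonunits \<Longrightarrow> x \<in> V \<Longrightarrow> x \<in> nonunits"
  by (induction n) (auto dest: nonunits_prime)

lemma power_nonunits: "x \<in> nonunits \<Longrightarrow> n > 0 \<Longrightarrow> x ^ n \<in> nonunits"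
  by (cases n) (auto intro: nonunits_mult' nonunits_V)

lemma unit_inverse: "x \<in> V \<Longrightarrow> x \<notin> nonunits \<Longrightarrow> inverse x \<in> V"
  by (auto simp: nonunits_def)

lemma unit_nonzero: "x \<notin> nonunits \<Longrightarrow> x \<noteq> 0"
  by auto

lemma unit_divide: "x \<in> V \<Longrightarrow> y \<in> V \<Longrightarrow> y \<notin> nonunits \<Longrightarrow> x / y \<in> V"
  using unit_inverse[of y] by (auto simp: divide_inverse)

lemma unit_add_nonunit: "x \<notin> nonunits \<Longrightarrow> y \<in> nonunits \<Longrightarrow> x + y \<notin> nonunits"
  using nonunits_diff[of "x + y" y] by auto

text \<open>If x were outside \<open>V\<close>, its inverse would be inside, and dividing the
  equation by x^(n-1) would express x through the coefficients and powers of the inverse.\<close>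

lemma integrally_closed:
  assumes "monic_over V f" "poly f x = 0"
  shows "x \<in> V"
proof (rule ccontr)
  assume x: "x \<notin> V"
  hence [simp]: "x \<noteq> 0" and y: "inverse x \<in> V" using val[of x] by auto
  define n where "n = Polynomial.degree f"
  have "f \<noteq> 0" "Polynomial.coeff f n = 1" and c: "\<And>i. Polynomial.coeff f i \<in> V"
    using assms(1) by (auto simp: monic_over_def n_def)
  have "n > 0"
  proof (rule ccontr)
    assume "\<not> n > 0"
    then obtain c where "f = [:c:]" unfolding n_def by (metis degree_eq_zeroE gr0I)
    then show False using assms(2) \<open>f \<noteq> 0\<close> by simp
  qed
  then obtain k where k: "n = Suc k" using gr0_implies_Suc by blast
  have "poly f x = (\<Sum>i\<le>k. Polynomial.coeff f i * x ^ i) + x ^ n"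
    using \<open>Polynomial.coeff f n = 1\<close> by (simp add: poly_altdef n_def[symmetric] k)
  hence "x ^ n = - (\<Sum>i\<le>k. Polynomial.coeff f i * x ^ i)" using assms(2) by (simp add: eq_neg_iff_add_eq_0 add.commute)
  hence "x = - (\<Sum>i\<le>k. Polynomial.coeff f i * x ^ i) * inverse x ^ k"
    by (simp add: k field_simps)
  also have "\<dots> = - (\<Sum>i\<le>k. Polynomial.coeff f i * inverse x ^ (k - i))"
    unfolding minus_mult_left[symmetric] sum_distrib_right neg_equal_iff_equal
    by (intro sum.cong refl) (simp add: power_diff field_simps)
  also have "\<dots> \<in> V" using c y by (intro uminus sum mult power)
  finally show False using x by simp
qed

lemma finite_max:
  assumes "finite Z" "Z \<noteq> {}" "0 \<notin> Z"
  obtains y where "y \<in> Z" "\<And>z. z \<in> Z \<Longrightarrow> z / y \<in> V"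
proof -
  have "\<exists>y\<in>Z. \<forall>z\<in>Z. z / y \<in> V"
    using assms
  proof (induction Z rule: finite_ne_induct)
    case (insert x Z)
    then obtain y where y: "y \<in> Z" "\<forall>z\<in>Z. z / y \<in> V" by auto
    show ?case
    proof (cases "x / y \<in> V")
      case False
      hence "y / x \<in> V" using val[of "x / y"] by simp
      hence "z / x \<in> V" if "z \<in> Z" for z
        using mult[of "z / y" "y / x"] y that insert.prems by (auto split: if_splits)
      then show ?thesis using insert.prems by auto
    qed (use y in auto)
  qed auto
  then show thesis using that by blast
qed

end

definition adjoin :: "'k::field set \<Rightarrow> 'k \<Rightarrow> 'k set" where
  "adjoin A x = (\<lambda>h. poly h x) ` polys_over A"

lemma (in subring_of) adjoin:
  "subring_of (adjoin A x)" "A \<subseteq> adjoin A x" "x \<in> adjoin A x"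
proof -
  have mem: "poly h x \<in> adjoin A x" if "h \<in> polys_over A" for h using that by (auto simp: adjoin_def)
  show "subring_of (adjoin A x)"
  proof
    show "0 \<in> adjoin A x" "1 \<in> adjoin A x" using mem[of 0] mem[of 1] by auto
    fix a b assume "a \<in> adjoin A x" "b \<in> adjoin A x"
    then obtain h k where hk: "h \<in> polys_over A" "k \<in> polys_over A" "a = poly h x" "b = poly k x"
      by (auto simp: adjoin_def)
    show "a + b \<in> adjoin A x" "a * b \<in> adjoin A x" using mem[of "h + k"] mem[of "h * k"] hk by auto
  next
    fix a assume "a \<in> adjoin A x"
    then obtain h where hk: "h \<in> polys_over A" "a = poly h x"
      by (auto simp: adjoin_def)
    show "- a \<in> adjoin A x" using mem[of "- h"] hk by auto
  qed
  show "A \<subseteq> adjoin A x" using mem[of "[:z:]" for z] by auto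
  show "x \<in> adjoin A x" using mem[of "[:0, 1:]"] by auto
qed

text \<open>Clearing denominators: a relation in powers of 1/u is moved back into
  \<open>A\<close>.\<close>

lemma (in subring_of) reverse_poly:
  assumes "h \<in> polys_over A" "u \<in> A" "u \<noteq> 0"
  shows "u ^ Polynomial.degree h * poly h (inverse u) \<in> A"
proof -
  define n where "n = Polynomial.degree h"
  have "u ^ n * poly h (inverse u) = (\<Sum>i\<le>n. Polynomial.coeff h i * u ^ (n - i))"
    unfolding poly_altdef n_def[symmetric] sum_distrib_left
    using assms(3) by (intro sum.cong refl) (simp add: power_diff field_simps)
  also have "\<dots> \<in> A" using assms by (intro sum mult power) (auto simp: polys_over_def)
  finally show ?thesis by (simp add: n_def)
qed

text \<open>
  A subring maximal among those in which \<open>\<pi>\<close> is not invertible is a valuation ring.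
\<close>

lemma (in subring_of) exists_valuation_subring:
  assumes pi: "\<pi> \<in> A" "inverse \<pi> \<notin> A"
  obtains V where "valuation_subring V" "A \<subseteq> V" "inverse \<pi> \<notin> V"
    "\<And>x. x \<noteq> 0 \<Longrightarrow> inverse x \<notin> V \<Longrightarrow> \<exists>r. x ^ r / \<pi> \<in> V"
proof -
  have [simp]: "\<pi> \<noteq> 0" using pi by auto
  define \<G> where "\<G> = {B. subring_of B \<and> A \<subseteq> B \<and> inverse \<pi> \<notin> B}"
  have "\<exists>M\<in>\<G>. \<forall>N\<in>\<G>. M \<subseteq> N \<longrightarrow> N = M"
  proof (rule subset_Zorn_nonempty)
    show "\<G> \<noteq> {}" using pi subring_of_axioms by (auto simp: \<G>_def)
    fix \<C> assume C: "\<C> \<noteq> {}" "subset.chain \<G> \<C>"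
    have sub: "\<And>\<Gamma>. \<Gamma> \<in> \<C> \<Longrightarrow> \<Gamma> \<in> \<G>" and chain: "\<And>\<Gamma> \<Delta>. \<Gamma> \<in> \<C> \<Longrightarrow> \<Delta> \<in> \<C> \<Longrightarrow> \<Gamma> \<subseteq> \<Delta> \<or> \<Delta> \<subseteq> \<Gamma>"
      using C(2) unfolding subset_chain_def by blast+
    have common: "\<exists>\<Gamma>\<in>\<C>. u \<in> \<Gamma> \<and> w \<in> \<Gamma>" if "u \<in> \<Union>\<C>" "w \<in> \<Union>\<C>" for u w
      using that chain by blast
    have ring: "subring_of \<Gamma>" if "\<Gamma> \<in> \<C>" for \<Gamma> using sub[OF that] by (simp add: \<G>_def)
    have "subring_of (\<Union>\<C>)"
    proof
      show "0 \<in> \<Union>\<C>" "1 \<in> \<Union>\<C>" using C(1) subring_of.zero[OF ring] subring_of.one[OF ring] by blast+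
      fix x y assume "x \<in> \<Union>\<C>" "y \<in> \<Union>\<C>"
      then obtain \<Gamma> where "\<Gamma> \<in> \<C>" "x \<in> \<Gamma>" "y \<in> \<Gamma>" using common by blast
      then show "x + y \<in> \<Union>\<C>" "x * y \<in> \<Union>\<C>"
        using subring_of.add[OF ring] subring_of.mult[OF ring] by blast+
    next
      fix x assume "x \<in> \<Union>\<C>"
      then show "- x \<in> \<Union>\<C>" using subring_of.uminus[OF ring] by blast
    qed
    then show "\<Union>\<C> \<in> \<G>" using C(1) sub unfolding \<G>_def by blast
  qed
  then obtain V where V: "V \<in> \<G>" and max: "\<And>N. N \<in> \<G> \<Longrightarrow> V \<subseteq> N \<Longrightarrow> N = V" by blast
  interpret V: subring_of V using V by (simp add: \<G>_def)
  have AV: "A \<subseteq> V" and piV: "inverse \<pi> \<notin> V" using V by (auto simp: \<G>_def)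
  have pi_in: "\<pi> \<in> V" using AV pi by blast
  \<comment> \<open>Maximality: adjoining any further element makes 1/\<pi> expressible as a
    polynomial in it.\<close>
  have rep: "\<exists>h \<in> polys_over V. inverse \<pi> = poly h x" if "x \<notin> V" for x
  proof -
    have "adjoin V x \<notin> \<G>" using max[of "adjoin V x"] V.adjoin[of x] that by blast
    then have "inverse \<pi> \<in> adjoin V x" using V.adjoin[of x] AV by (auto simp: \<G>_def)
    then show ?thesis by (auto simp: adjoin_def)
  qed
  \<comment> \<open>Otherwise 1/\<pi> is a polynomial in 1/u. Multiplying by a power of u, which is
    congruent to 1 modulo \<pi>, would put 1/\<pi> into \<open>V\<close>.\<close>
  have unit: "inverse (1 - \<pi> * a) \<in> V" if a: "a \<in> V" for a
  proof (rule ccontr)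
    define u where "u = 1 - \<pi> * a"
    assume "inverse (1 - \<pi> * a) \<notin> V"
    then obtain h where h: "h \<in> polys_over V" "inverse \<pi> = poly h (inverse u)"
      using rep by (auto simp: u_def)
    have u: "u \<in> V" using a pi_in by (auto simp: u_def)
    have "u \<noteq> 0"
    proof
      assume "u = 0"
      hence "inverse \<pi> = a" by (simp add: u_def field_simps)
      then show False using piV a by simp
    qed
    have "\<exists>b\<in>V. u ^ n = 1 - \<pi> * b" for n
    proof (induction n)
      case (Suc n)
      then obtain b where b: "b \<in> V" "u ^ n = 1 - \<pi> * b" by blast
      have "u ^ Suc n = (1 - \<pi> * a) * (1 - \<pi> * b)" using b(2) by (simp add: u_def)
      also have "\<dots> = 1 - \<pi> * (a + b - \<pi> * a * b)" by (simp add: algebra_simps)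
      finally have "u ^ Suc n = 1 - \<pi> * (a + b - \<pi> * a * b)" .
      moreover have "a + b - \<pi> * a * b \<in> V" using a b pi_in by (intro V.diff V.add V.mult)
      ultimately show ?case by blast
    qed (auto intro!: bexI[of _ 0])
    then obtain b where b: "b \<in> V" "u ^ Polynomial.degree h = 1 - \<pi> * b" by blast
    have "u ^ Polynomial.degree h * inverse \<pi> \<in> V"
      using V.reverse_poly[OF h(1) u \<open>u \<noteq> 0\<close>] h(2) by simp
    hence "u ^ Polynomial.degree h * inverse \<pi> + b \<in> V" using b by blast
    moreover have "u ^ Polynomial.degree h * inverse \<pi> + b = inverse \<pi>" unfolding b(2) by (simp add: field_simps)
    ultimately show False using piV by simp
  qed
  define P where "P x n \<longleftrightarrow> (\<exists>h \<in> polys_over V. inverse \<pi> = poly h x \<and> Polynomial.degree h \<le> n)" for x n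
  \<comment> \<open>The relation for 1/x, multiplied by x^m, writes x^m as a polynomial of smaller
    degree in x, because 1 - \<pi> g(0) is a unit. Substituting it into the relation for x lowers
    the degree, so x and 1/x cannot both have relations of minimal degree.\<close>
  have reduce: "\<exists>n'<m. P x n'" if xmn: "P x m" "P (inverse x) n" "n \<le> m" "x \<noteq> 0" for x m n
  proof -
    obtain h where h: "h \<in> polys_over V" "inverse \<pi> = poly h x" "Polynomial.degree h \<le> m" using xmn(1) by (auto simp: P_def)
    obtain g where g: "g \<in> polys_over V" "inverse \<pi> = poly g (inverse x)" "Polynomial.degree g \<le> n" using xmn(2) by (auto simp: P_def)
    have "m > 0"
    proof (rule ccontr)
      assume "\<not> m > 0"
      then obtain c where "h = [:c:]" using h(3) by (metis degree_eq_zeroE gr0I le_zero_eq)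
      then show False using h piV by (auto simp: polys_over_def) (metis coeff_pCons_0)
    qed
    define e where "e = inverse (1 - \<pi> * Polynomial.coeff g 0)"
    have gV: "Polynomial.coeff g i \<in> V" and hV: "Polynomial.coeff h i \<in> V" for i using g h by (auto simp: polys_over_def)
    have e: "e \<in> V" unfolding e_def using gV by (rule unit)
    have e0: "1 - \<pi> * Polynomial.coeff g 0 \<noteq> 0"
    proof
      assume "1 - \<pi> * Polynomial.coeff g 0 = 0"
      hence "inverse \<pi> = Polynomial.coeff g 0" by (simp add: field_simps)
      then show False using piV gV by simp
    qed
    define k where "k = (\<Sum>j\<in>{1..n}. Polynomial.monom (\<pi> * e * Polynomial.coeff g j) (m - j))"
    have "Polynomial.coeff k i \<in> V" for i unfolding k_def coeff_sum coeff_monom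
      using gV e pi_in by (intro V.sum) auto
    hence k: "k \<in> polys_over V" by (simp add: polys_over_def)
    have kdeg: "Polynomial.coeff k i = 0" if "i \<ge> m" for i
      unfolding k_def coeff_sum coeff_monom using that \<open>m > 0\<close> by (intro sum.neutral) auto
    have "poly g (inverse x) = (\<Sum>j\<le>n. Polynomial.coeff g j * inverse x ^ j)"
      unfolding poly_altdef using g(3) by (intro sum.mono_neutral_left) (auto simp: coeff_eq_0)
    also have "\<dots> = Polynomial.coeff g 0 + (\<Sum>j\<in>{1..n}. Polynomial.coeff g j * inverse x ^ j)"
      by (simp add: atMost_atLeast0 sum.atLeast_Suc_atMost)
    finally have "1 - \<pi> * Polynomial.coeff g 0 = \<pi> * (\<Sum>j\<in>{1..n}. Polynomial.coeff g j * inverse x ^ j)"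
      using g(2) by (simp add: field_simps)
    hence "1 = \<pi> * e * (\<Sum>j\<in>{1..n}. Polynomial.coeff g j * inverse x ^ j)"
      using e0 by (simp add: e_def field_simps)
    hence "x ^ m = x ^ m * (\<pi> * e * (\<Sum>j\<in>{1..n}. Polynomial.coeff g j * inverse x ^ j))" by simp
    also have "\<dots> = poly k x"
      unfolding k_def poly_sum poly_monom sum_distrib_left
      using xmn(3,4) by (intro sum.cong refl) (auto simp: power_diff field_simps)
    finally have kx: "poly k x = x ^ m" by simp
    define h' where "h' = h - Polynomial.monom (Polynomial.coeff h m) m + Polynomial.smult (Polynomial.coeff h m) k"
    have "h' \<in> polys_over V" unfolding h'_def using h k hV by (intro V.polys_over_add V.polys_over_diff V.polys_over_monom V.polys_over_smult)
    moreover have "poly h' x = inverse \<pi>" using h(2) kx by (simp add: h'_def poly_monom)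
    moreover have "Polynomial.degree h' \<le> m - 1"
    proof (rule degree_le, intro allI impI)
      fix i assume i: "m - 1 < i"
      have "Polynomial.coeff h i = 0" if "i > m" using h(3) that by (simp add: coeff_eq_0)
      then show "Polynomial.coeff h' i = 0" using i kdeg[of i] by (auto simp: h'_def coeff_monom)
    qed
    ultimately have "P x (m - 1)" unfolding P_def by (metis (no_types))
    then show ?thesis using \<open>m > 0\<close> by (intro exI[of _ "m - 1"]) simp
  qed
  have "valuation_subring V"
  proof
    fix x
    show "x \<in> V \<or> inverse x \<in> V"
    proof (rule ccontr)
      assume "\<not> (x \<in> V \<or> inverse x \<in> V)"
      hence x: "x \<notin> V" "inverse x \<notin> V" "x \<noteq> 0" by auto
      define m where "m = (LEAST n. P x n)"
      define n where "n = (LEAST n. P (inverse x) n)"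
      have "\<exists>n. P x n" "\<exists>n. P (inverse x) n" using rep[OF x(1)] rep[OF x(2)] unfolding P_def by blast+
      hence P: "P x m" "P (inverse x) n" unfolding m_def n_def by (auto intro: LeastI_ex)
      have "\<not> (\<exists>n'<m. P x n')" "\<not> (\<exists>n'<n. P (inverse x) n')"
        unfolding m_def n_def using not_less_Least by blast+
      then show False using reduce[of x m n] reduce[of "inverse x" n m] P x(3) by (cases "n \<le> m") auto
    qed
  qed
  \<comment> \<open>Maximality among all rings avoiding 1/\<pi> forces rank one: every nonunit has a
    power divisible by \<pi>.\<close>
  then have pows: "\<exists>r. x ^ r / \<pi> \<in> V" if x: "x \<noteq> 0" "inverse x \<notin> V" for x
  proof -
    interpret valuation_subring V by fact
    obtain h where h: "h \<in> polys_over V" "inverse \<pi> = poly h (inverse x)" using rep x by blast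
    have "x ^ Polynomial.degree h * poly h (inverse x) \<in> V"
      using val[of x] x by (intro V.reverse_poly h) auto
    then show ?thesis using h(2) by (metis divide_inverse)
  qed
  show thesis by (rule that[OF \<open>valuation_subring V\<close> AV piV]) (rule pows)
qed

section \<open>The absolute value on the p-adic numbers\<close>

locale padic_closure =
  fixes p :: nat and v :: "'k::{alg_closed_field, field_char_0} \<Rightarrow> real" and Qp :: "'k set"
  assumes prime: "Factorial_Ring.prime p" and Qp: "padic_numbers p v Qp" and alg: "\<And>x. alg_over Qp x"
begin

sublocale Qp: subfield_of Qp
  using Qp subfield_of_ambient by (auto simp: padic_numbers_def)

abbreviation Zp :: "'k set" where "Zp \<equiv> valuation_ring v Qp"

lemma p_gt_1: "p > 1"
  using prime by (rule prime_gt_1_nat)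

lemma v_nonneg: "x \<in> Qp \<Longrightarrow> 0 \<le> v x" and v_zero_iff: "x \<in> Qp \<Longrightarrow> v x = 0 \<longleftrightarrow> x = 0"
  and v_mult: "x \<in> Qp \<Longrightarrow> y \<in> Qp \<Longrightarrow> v (x * y) = v x * v y"
  and v_triangle: "x \<in> Qp \<Longrightarrow> y \<in> Qp \<Longrightarrow> v (x + y) \<le> v x + v y"
  and v_rat: "v (of_rat r) = padic_abs p r"
  and v_dense: "x \<in> Qp \<Longrightarrow> e > 0 \<Longrightarrow> \<exists>r. v (x - of_rat r) < e"
  using Qp unfolding padic_numbers_def by blast+

lemma v_complete:
  fixes xs :: "nat \<Rightarrow> 'k"
  assumes "\<And>n. xs n \<in> Qp" "\<And>e. e > 0 \<Longrightarrow> \<exists>N. \<forall>m\<ge>N. \<forall>n\<ge>N. v (xs m - xs n) < e"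
  obtains x where "x \<in> Qp" "\<And>e. e > 0 \<Longrightarrow> \<exists>N. \<forall>n\<ge>N. v (xs n - x) < e"
proof -
  have "\<forall>xs :: nat \<Rightarrow> 'k. range xs \<subseteq> Qp \<and> (\<forall>e>0. \<exists>N. \<forall>m\<ge>N. \<forall>n\<ge>N. v (xs m - xs n) < e) \<longrightarrow>
        (\<exists>x\<in>Qp. \<forall>e>0. \<exists>N. \<forall>n\<ge>N. v (xs n - x) < e)"
    using Qp unfolding padic_numbers_def by (elim conjE) assumption
  then have "range xs \<subseteq> Qp \<and> (\<forall>e>0. \<exists>N. \<forall>m\<ge>N. \<forall>n\<ge>N. v (xs m - xs n) < e) \<longrightarrow>
        (\<exists>x\<in>Qp. \<forall>e>0. \<exists>N. \<forall>n\<ge>N. v (xs n - x) < e)" by (rule spec)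
  moreover have "range xs \<subseteq> Qp" using assms(1) by blast
  ultimately obtain x where "x \<in> Qp" "\<forall>e>0. \<exists>N. \<forall>n\<ge>N. v (xs n - x) < e" using assms(2) by auto
  then show thesis by (intro that) auto
qed

lemma of_int_Qp [simp]: "of_int a \<in> Qp"
  by (cases a) auto

lemma of_rat_Qp [simp]: "of_rat r \<in> Qp"
  by (cases r) (auto simp: of_rat_rat)

lemma v_of_int: "v (of_int a) = (if a = 0 then 0 else real p powi - int (multiplicity (int p) a))"
  using v_rat[of "of_int a"] by (simp add: padic_abs_def)

lemma v_one: "v 1 = 1"
  using v_of_int[of 1] by simp

lemma v_of_int_le: "v (of_int a) \<le> 1"
  using p_gt_1 by (auto simp: v_of_int power_int_minus field_simps)

lemma v_of_int_unit: "\<not> int p dvd a \<Longrightarrow> v (of_int a) = 1"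
  by (auto simp: v_of_int not_dvd_imp_multiplicity_0)

lemma v_p: "v (of_nat p) = 1 / p"
  using v_of_int[of "int p"] p_gt_1 multiplicity_self[of "int p"] by (simp add: power_int_minus field_simps)

lemma v_power: "x \<in> Qp \<Longrightarrow> v (x ^ n) = v x ^ n"
  by (induction n) (auto simp: v_one v_mult Qp.power)

lemma v_inverse: "x \<in> Qp \<Longrightarrow> v (inverse x) = inverse (v x)"
proof (cases "x = 0")
  case False
  assume x: "x \<in> Qp"
  have "v x * v (inverse x) = 1" using v_mult[OF x Qp.inverse[OF x]] False v_one by simp
  then show ?thesis by (metis inverse_unique)
qed (use v_zero_iff[of 0] in simp)

lemma v_divide: "x \<in> Qp \<Longrightarrow> y \<in> Qp \<Longrightarrow> v (x / y) = v x / v y"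
  by (simp add: divide_inverse v_mult v_inverse Qp.inverse)

lemma v_uminus: "x \<in> Qp \<Longrightarrow> v (- x) = v x"
proof -
  assume x: "x \<in> Qp"
  have "\<not> int p dvd -1" using p_gt_1 by simp
  then have "v (of_int (-1)) = 1" by (rule v_of_int_unit)
  then show ?thesis using v_mult[of "-1" x] x Qp.uminus[of 1] by simp
qed

text \<open>The definition grants only the ordinary triangle inequality. Integers have value at most
  1, so the binomial theorem bounds the n-th power of v (x + y) by n + 1 for every n, which excludes
  a value above 1.\<close>

lemma v_add_le_1:
  assumes "x \<in> Qp" "y \<in> Qp" "v x \<le> 1" "v y \<le> 1"
  shows "v (x + y) \<le> 1"
proof (rule ccontr)
  assume "\<not> v (x + y) \<le> 1"
  define t where "t = v (x + y)"
  have t: "t > 1" using \<open>\<not> _\<close> by (simp add: t_def)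
  have "t ^ n \<le> real (n + 1)" for n
  proof -
    have tri: "v (sum f I) \<le> (\<Sum>i\<in>I. v (f i))" if "\<And>i. i \<in> I \<Longrightarrow> f i \<in> Qp" for f and I :: "nat set"
      using that
    proof (induction I rule: infinite_finite_induct)
      case (insert i I)
      then show ?case using v_triangle[of "f i" "sum f I"] Qp.sum[of I f] by force
    qed (use v_zero_iff[of 0] in auto)
    have "t ^ n = v (\<Sum>k\<le>n. of_nat (n choose k) * x ^ k * y ^ (n - k))"
      unfolding t_def using assms v_power[of "x + y" n] by (simp add: Qp.add binomial_ring)
    also have "\<dots> \<le> (\<Sum>k\<le>n. v (of_nat (n choose k) * x ^ k * y ^ (n - k)))"
      using assms by (intro tri Qp.mult Qp.power) auto
    also have "\<dots> \<le> (\<Sum>k\<le>n. 1)"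
    proof (rule sum_mono)
      fix k
      have "v (of_nat (n choose k)) \<le> 1" using v_of_int_le[of "int (n choose k)"] by simp
      then show "v (of_nat (n choose k) * x ^ k * y ^ (n - k)) \<le> 1"
        using assms v_nonneg by (simp add: v_mult v_power Qp.mult Qp.power mult_le_one power_le_one)
    qed
    finally show ?thesis by simp
  qed
  moreover have "\<exists>n. real (n + 1) < t ^ n"
  proof -
    have "(\<lambda>n. real (n + 1) / t ^ n) \<longlonglongrightarrow> 0" using t by real_asymp
    hence "\<forall>\<^sub>F n in sequentially. real (n + 1) / t ^ n < 1" by (rule order_tendstoD) simp
    then obtain n where "real (n + 1) / t ^ n < 1" by (auto simp: eventually_sequentially)
    then show ?thesis using t by (auto simp: field_simps)
  qed
  ultimately show False by (meson not_le)
qed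

text \<open>The bound is taken to be a value of \<open>v\<close>, so that division by
  \<open>z\<close> reduces to the unit ball.\<close>

lemma v_ultrametric:
  assumes "x \<in> Qp" "y \<in> Qp" "v x \<le> c" "v y \<le> c" and c: "c = v z" "z \<in> Qp"
  shows "v (x + y) \<le> c"
proof (cases "z = 0")
  case True
  then have "v x = 0" "v y = 0" using assms v_nonneg[of x] v_nonneg[of y] v_zero_iff[of 0] by auto
  then have "x = 0" "y = 0" using v_zero_iff assms by auto
  then show ?thesis using assms by simp
next
  case False
  then have cp: "c > 0" using c v_nonneg[of z] v_zero_iff[of z] by linarith
  have "v (x / z + y / z) \<le> 1" using assms cp
    by (intro v_add_le_1) (auto simp: v_divide Qp.divide field_simps)
  moreover have "x / z + y / z = (x + y) / z" by (simp add: add_divide_distrib)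
  ultimately show ?thesis using assms cp by (simp add: v_divide Qp.add field_simps)
qed

lemma Zp_iff: "x \<in> Zp \<longleftrightarrow> x \<in> Qp \<and> v x \<le> 1"
  by (simp add: valuation_ring_def)

sublocale Zp: subring_of Zp
  using v_zero_iff[of 0]
  by unfold_locales (auto simp: Zp_iff v_one v_mult v_uminus v_add_le_1 mult_le_one v_nonneg)

lemma of_int_Zp [simp]: "of_int a \<in> Zp"
  by (simp add: Zp_iff v_of_int_le)

lemma v_rat_discrete:
  assumes "v (of_rat r) < 1" shows "v (of_rat r) \<le> 1 / p"
proof -
  obtain a b where ab: "r = Rat.Fract a b" "b > 0" "coprime a b" by (cases r) auto
  have v: "v (of_rat r) = v (of_int a) / v (of_int b)"
    using ab by (simp add: of_rat_rat v_divide)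
  have "v (of_int b) > 0" using v_nonneg[of "of_int b"] v_zero_iff[of "of_int b"] ab by force
  have "\<not> int p dvd b"
  proof
    assume "int p dvd b"
    hence "\<not> int p dvd a" using ab(3) prime by (meson coprime_common_divisor dvd_refl not_prime_unit prime_nat_int_transfer)
    hence "v (of_int a) = 1" by (rule v_of_int_unit)
    then show False using assms v v_of_int_le[of b] \<open>v (of_int b) > 0\<close> by (simp add: field_simps)
  qed
  hence b1: "v (of_int b) = 1" by (rule v_of_int_unit)
  have "int p dvd a"
    using assms v b1 v_of_int_unit[of a] by fastforce
  then obtain a' where a': "a = int p * a'" by blast
  have "v (of_int a) = 1 / p * v (of_int a')"
    using v_mult[of "of_nat p" "of_int a'"] v_p by (simp add: a')
  also have "\<dots> \<le> 1 / p" using v_of_int_le[of a'] p_gt_1 by (simp add: field_simps)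
  finally show ?thesis using v b1 by simp
qed

lemma v_discrete:
  assumes "x \<in> Qp" "v x < 1" shows "v x \<le> 1 / p"
proof -
  obtain r where r: "v (x - of_rat r) < 1 / p" using v_dense[OF assms(1), of "1 / p"] p_gt_1 by auto
  have xr: "x - of_rat r \<in> Qp" using assms by auto
  have "v (of_rat r) \<le> 1 / p"
  proof (rule v_rat_discrete, rule ccontr)
    assume *: "\<not> v (of_rat r) < 1"
    \<comment> \<open>\<open>z\<close> is the larger of \<open>x\<close> and p: it bounds both terms
      by a value of \<open>v\<close>, as \<open>v_ultrametric\<close> demands, and is still smaller
      than 1.\<close>
    obtain z where z: "z \<in> Qp" "v z < 1" "v x \<le> v z" "v (x - of_rat r) \<le> v z"
      using assms r v_p p_gt_1 by (cases "v x \<le> 1 / p") (auto intro: that[of x] that[of "of_nat p"])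
    have "v (x + - (x - of_rat r)) \<le> v z"
      using z assms xr v_uminus[OF xr] by (intro v_ultrametric[where z = z]) (auto simp del: minus_diff_eq)
    then show False using * z by simp
  qed
  then have "v ((x - of_rat r) + of_rat r) \<le> 1 / p"
    using r xr v_p by (intro v_ultrametric[where z = "of_nat p"]) auto
  then show ?thesis by simp
qed

text \<open>A rational number close to x has a denominator prime to p, and c is its numerator times
  the inverse of the denominator modulo p.\<close>

lemma Zp_residue:
  assumes "x \<in> Zp" obtains c where "c < p" "(x - of_nat c) / of_nat p \<in> Zp"
proof -
  have x: "x \<in> Qp" "v x \<le> 1" using assms by (auto simp: Zp_iff)
  obtain r where r: "v (x - of_rat r) < 1 / p" using v_dense[OF x(1), of "1 / p"] p_gt_1 by auto
  have xr: "x - of_rat r \<in> Qp" using x by auto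
  have p0: "(of_nat p :: 'k) \<noteq> 0" using p_gt_1 by simp
  have rV: "v (of_rat r) \<le> 1"
  proof -
    have "v (x + - (x - of_rat r)) \<le> 1"
    proof (rule v_add_le_1)
      have "v (x - of_rat r) \<le> 1" using r p_gt_1 by (auto intro!: order.trans[OF less_imp_le[OF r]] simp: field_simps)
      then show "v (- (x - of_rat r)) \<le> 1" using v_uminus[OF xr] by simp
    qed (use x xr in \<open>auto simp del: minus_diff_eq\<close>)
    then show ?thesis by simp
  qed
  obtain a b where ab: "r = Rat.Fract a b" "b > 0" "coprime a b" by (cases r) auto
  have vr: "v (of_rat r) = v (of_int a) / v (of_int b)"
    using ab by (simp add: of_rat_rat v_divide)
  have bpos: "v (of_int b) > 0" using v_nonneg[of "of_int b"] v_zero_iff[of "of_int b"] ab by force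
  have pb: "\<not> int p dvd b"
  proof
    assume pb: "int p dvd b"
    hence "\<not> int p dvd a" using ab(3) prime by (meson coprime_common_divisor dvd_refl not_prime_unit prime_nat_int_transfer)
    hence "v (of_int a) = 1" by (rule v_of_int_unit)
    moreover obtain b' where "b = int p * b'" using pb by blast
    hence "v (of_int b) \<le> 1 / p"
      using v_mult[of "of_nat p" "of_int b'"] v_p v_of_int_le[of b'] p_gt_1 by (simp add: field_simps)
    hence "v (of_int b) < 1" using p_gt_1 by (auto intro: order.strict_trans1)
    ultimately show False using rV vr bpos by (simp add: field_simps)
  qed
  have "coprime b (int p)" using pb prime by (metis coprime_commute prime_imp_coprime_int prime_nat_int_transfer)
  then obtain d where d: "[b * d = 1] (mod int p)" using cong_solve_coprime_int by blast
  define c where "c = nat ((a * d) mod int p)"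
  have c: "int c = (a * d) mod int p" using p_gt_1 by (simp add: c_def)
  have "c < p" using c p_gt_1 by (metis of_nat_0_less_iff of_nat_less_iff pos_mod_bound less_trans zero_less_one)
  have "[int c * b = a] (mod int p)"
  proof -
    have "[int c * b = a * d * b] (mod int p)" unfolding c by (simp add: cong_def mod_mult_left_eq)
    also have "a * d * b = a * (b * d)" by simp
    also have "[a * (b * d) = a * 1] (mod int p)" using d by (intro cong_mult) auto
    finally show ?thesis by simp
  qed
  then obtain e where e: "a - int c * b = int p * e" by (metis cong_iff_dvd_diff cong_sym dvdE)
  have "of_rat r - of_nat c = of_int (a - int c * b) / (of_int b :: 'k)"
    using ab by (simp add: of_rat_rat field_simps)
  also have "\<dots> = of_nat p * (of_int e / of_int b)" by (simp add: e)
  finally have rc: "(of_rat r - of_nat c) / of_nat p = (of_int e / of_int b :: 'k)" using p0 by simp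
  have "(of_rat r - of_nat c) / of_nat p \<in> Zp"
    unfolding rc Zp_iff using v_of_int_unit[OF pb] v_of_int_le[of e] by (auto simp: v_divide)
  moreover have "(x - of_rat r) / of_nat p \<in> Zp"
    unfolding Zp_iff using xr r p_gt_1 by (auto simp: v_divide v_p field_simps)
  ultimately have "(x - of_rat r) / of_nat p + (of_rat r - of_nat c) / of_nat p \<in> Zp" by (rule Zp.add[rotated])
  moreover have "(x - of_rat r) / of_nat p + (of_rat r - of_nat c) / of_nat p = (x - of_nat c) / of_nat p"
    by (simp add: add_divide_distrib[symmetric])
  ultimately show thesis using that \<open>c < p\<close> by simp
qed


text \<open>
  Let \<open>V\<close> be any valuation ring of the algebraic closure that dominates \<open>Zp\<close>. If the conjugates of
  \<open>x\<close> did not all have the same value, the product \<open>N\<close> of the \<open>m\<close> conjugates of largest value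
  would be the limit of the quotients \<open>P (k + 1) / P k\<close>, where \<open>P k\<close> is the sum of the \<open>k\<close>-th powers
  of all products of \<open>m\<close> conjugates. By completeness \<open>N\<close> would lie in \<open>Qp\<close> although
  some automorphism moves it to an element of smaller value.
\<close>

lemma valuation_subring_stable:
  assumes V: "valuation_subring V" "Zp \<subseteq> V" "inverse (of_nat p) \<notin> V"
    and arch: "\<And>x. x \<noteq> 0 \<Longrightarrow> inverse x \<notin> V \<Longrightarrow> \<exists>r. x ^ r / of_nat p \<in> V"
  shows V_Qp: "V \<inter> Qp = Zp"
    and bounded: "\<exists>j. of_nat p ^ j * x \<in> V"
    and stable: "\<tau> \<in> carrier (abs_Gal Qp) \<Longrightarrow> x \<in> V \<Longrightarrow> \<tau> x \<in> V"
proof -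
  interpret V: valuation_subring V by fact
  have [simp]: "p \<noteq> 0" using p_gt_1 by simp
  have p0: "(of_nat p :: 'k) \<noteq> 0" by simp
  have pV: "(of_nat p :: 'k) \<in> V" by simp
  have p_non: "of_nat p \<in> V.nonunits" using V(3) V.nonunits_iff[OF p0] by simp
  have div_p: "z / of_nat p \<in> Zp" if "z \<in> Qp" "v z < 1" for z
    using v_discrete[OF that] that p_gt_1 by (auto simp: Zp_iff v_divide v_p field_simps)
  \<comment> \<open>By discreteness the inverse of an element outside \<open>Zp\<close> is divisible
    by p in \<open>Zp\<close>, so such an element in \<open>V\<close> would put 1/p into
    \<open>V\<close>.\<close>
  show Q: "V \<inter> Qp = Zp"
  proof (intro equalityI subsetI)
    fix y assume y: "y \<in> V \<inter> Qp"
    show "y \<in> Zp"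
    proof (rule ccontr)
      assume "y \<notin> Zp"
      hence vy: "v y > 1" using y by (simp add: Zp_iff)
      hence [simp]: "y \<noteq> 0" using v_zero_iff[of 0] by auto
      have "inverse y / of_nat p \<in> Zp" using vy y v_inverse[of y]
        by (intro div_p) (auto simp: inverse_less_1_iff)
      hence "y * (inverse y / of_nat p) \<in> V" using V(2) y by blast
      then show False using V(3) by (simp add: field_simps)
    qed
  qed (use V(2) Zp_iff in blast)
  have Qdiv: "v y \<le> (1 / p) ^ j" if "y \<in> Qp" "y / of_nat p ^ j \<in> V" for y j
  proof -
    have "y / of_nat p ^ j \<in> Zp" using that Q by (metis IntI Qp.divide Qp.of_nat Qp.power)
    then show ?thesis using that p_gt_1 by (simp add: Zp_iff v_divide v_power v_p Qp.power field_simps)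
  qed
  have bounded: "\<exists>j. of_nat p ^ j * x \<in> V" for x
  proof -
    \<comment> \<open>The elements with a power of p as denominator form a ring over
      \<open>Qp\<close>, hence a field. It contains \<open>V\<close>, and one of x and 1/x is in
      \<open>V\<close>.\<close>
    define B where "B = {x. \<exists>j. of_nat p ^ j * x \<in> V}"
    have up: "of_nat p ^ (i + j) * x \<in> V" if "of_nat p ^ j * x \<in> V" for i j x
      using V.mult[OF V.power[OF pV, of i] that] by (simp add: power_add mult.assoc)
    have "subring_of B"
    proof
      show "0 \<in> B" "1 \<in> B" by (auto simp: B_def intro: exI[of _ 0])
      fix x y assume "x \<in> B" "y \<in> B"
      then obtain i j where ij: "of_nat p ^ i * x \<in> V" "of_nat p ^ j * y \<in> V" by (auto simp: B_def)
      have "of_nat p ^ (i + j) * (x + y) \<in> V"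
        using V.add[OF up[OF ij(1), of j] up[OF ij(2), of i]] by (simp add: algebra_simps)
      moreover have "of_nat p ^ (i + j) * (x * y) \<in> V"
        using V.mult[OF ij] by (simp add: power_add mult_ac)
      ultimately show "x + y \<in> B" "x * y \<in> B" by (auto simp: B_def)
    next
      fix x assume "x \<in> B"
      then show "- x \<in> B" by (auto simp: B_def dest: V.uminus)
    qed
    moreover have "Qp \<subseteq> B"
    proof
      fix z assume z: "z \<in> Qp"
      have "(\<lambda>j. (1 / real p) ^ j * v z) \<longlonglongrightarrow> 0 * v z"
        using p_gt_1 by (intro tendsto_mult LIMSEQ_realpow_zero tendsto_const) auto
      hence "\<forall>\<^sub>F j in sequentially. (1 / real p) ^ j * v z < 1" by (intro order_tendstoD) auto
      then obtain j where "(1 / real p) ^ j * v z < 1" by (auto simp: eventually_sequentially)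
      hence "of_nat p ^ j * z \<in> Zp" using z by (auto simp: Zp_iff v_mult v_power v_p Qp.power Qp.mult)
      then show "z \<in> B" using V(2) by (auto simp: B_def)
    qed
    ultimately interpret B: subfield_of B using Qp.subring_is_subfield alg by blast
    have "V \<subseteq> B" by (auto simp: B_def intro: exI[of _ 0])
    hence "x \<in> B" using V.val[of x] B.inverse[of "inverse x"] by auto
    then show ?thesis by (simp add: B_def)
  qed
  show "\<exists>j. of_nat p ^ j * x \<in> V" by (rule bounded)
  have sep: "x = 0" if "\<And>j. x / of_nat p ^ j \<in> V" for x
  proof (rule ccontr)
    assume x: "x \<noteq> 0"
    obtain j where "of_nat p ^ j * inverse x \<in> V" using bounded by blast
    hence "(of_nat p ^ j * inverse x) * (x / of_nat p ^ Suc j) \<in> V" using that by blast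
    then show False using x V(3) by (simp add: field_simps)
  qed
  assume \<tau>: "\<tau> \<in> carrier (abs_Gal Qp)" and x: "x \<in> V"
  show "\<tau> x \<in> V"
  proof (cases "x = 0")
    case True
    then show ?thesis using field_auto.zero[OF abs_Gal_auto[OF \<tau>]] by simp
  next
    case False
    define Z where "Z = conjugates Qp x"
    have Zfin: "finite Z" unfolding Z_def by (rule finite_conjugates[OF alg])
    have xZ: "x \<in> Z" by (simp add: Z_def)
    have Zstab: "\<omega> ` Z = Z" if "\<omega> \<in> carrier (abs_Gal Qp)" for \<omega>
      unfolding Z_def by (rule abs_Gal_image_conjugates[OF that])
    have Z0: "0 \<notin> Z" using False field_auto.zero_iff[OF abs_Gal_auto] by (force simp: Z_def conjugates_def)
    obtain y0 where y0: "y0 \<in> Z" "\<And>z. z \<in> Z \<Longrightarrow> z / y0 \<in> V"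
      by (rule V.finite_max[OF Zfin _ Z0]) (use xZ that in auto)
    \<comment> \<open>The conjugates of largest value, so that \<open>N\<close> is strictly larger
      than any other product of m conjugates.\<close>
    define S where "S = {y \<in> Z. y / y0 \<notin> V.nonunits}"
    define m where "m = card S"
    define N where "N = \<Prod>S"
    have "y0 \<noteq> 0" using y0(1) Z0 by metis
    have S: "S \<subseteq> Z" "finite S" "y0 \<in> S" using y0 \<open>y0 \<noteq> 0\<close> Zfin by (auto simp: S_def)
    have N0: "N \<noteq> 0" using S Z0 by (auto simp: N_def)
    have "S = Z"
    proof (rule ccontr)
      assume "S \<noteq> Z"
      define \<S> where "\<S> = {T. T \<subseteq> Z \<and> card T = m}"
      have Sfin: "finite \<S>" using Zfin by (simp add: \<S>_def)
      have SS: "S \<in> \<S>" using S by (simp add: \<S>_def m_def)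
      have norm: "\<Prod>T / y0 ^ m = (\<Prod>z\<in>T. z / y0)" if "T \<in> \<S>" for T
        using that by (simp add: \<S>_def prod_dividef prod_constant)
      have small: "\<Prod>T / N \<in> V.nonunits" if T: "T \<in> \<S>" "T \<noteq> S" for T
      proof -
        have Tfin: "finite T" "T \<subseteq> Z" using T(1) Zfin finite_subset by (auto simp: \<S>_def)
        have "\<not> T \<subseteq> S" using T card_subset_eq[OF S(2), of T] by (auto simp: \<S>_def m_def)
        then obtain z1 where z1: "z1 \<in> T" "z1 \<notin> S" by blast
        have "(\<Prod>z\<in>T. z / y0) = z1 / y0 * (\<Prod>z\<in>T - {z1}. z / y0)"
          using Tfin z1 by (simp add: prod.remove)
        moreover have "z1 / y0 \<in> V.nonunits" using z1 Tfin by (auto simp: S_def)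
        moreover have "(\<Prod>z\<in>T - {z1}. z / y0) \<in> V" using y0(2) Tfin by (intro V.prod) auto
        ultimately have 1: "(\<Prod>z\<in>T. z / y0) \<in> V.nonunits" by (metis V.nonunits_mult')
        have 2: "(\<Prod>z\<in>S. z / y0) \<notin> V.nonunits"
          using V.nonunits_prod[OF S(2), of "\<lambda>z. z / y0"] y0(2) S(1) by (auto simp: S_def)
        have 3: "(\<Prod>z\<in>S. z / y0) \<in> V" using y0(2) S(1) by (intro V.prod) auto
        have "\<Prod>T / N = (\<Prod>z\<in>T. z / y0) * inverse (\<Prod>z\<in>S. z / y0)"
          using norm[OF T(1)] norm[OF SS] \<open>y0 \<noteq> 0\<close> by (simp add: N_def[symmetric] field_simps)
        then show ?thesis using V.nonunits_mult'[OF 1 V.unit_inverse[OF 3 2]] by simp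
      qed
      define P where "P k = (\<Sum>T\<in>\<S>. \<Prod>T ^ k)" for k :: nat
      have P: "P k \<in> Qp" for k
      proof (rule abs_Gal_fixed[OF Qp.subfield_of_axioms alg])
        fix \<omega> assume w: "\<omega> \<in> carrier (abs_Gal Qp)"
        interpret field_auto \<omega> using w by (rule abs_Gal_auto)
        have inj: "inj_on (image \<omega>) \<S>" using bij by (intro inj_on_image) (auto simp: bij_def intro: inj_on_subset)
        have inj': "inj_on \<omega> T" for T by (simp add: inj_on_def)
        have "image \<omega> ` \<S> \<subseteq> \<S>" using Zstab[OF w] by (auto simp: \<S>_def card_image[OF inj'])
        hence img: "image \<omega> ` \<S> = \<S>" using endo_inj_surj[OF Sfin _ inj] by blast
        have "\<omega> (P k) = (\<Sum>T\<in>\<S>. \<Prod>(\<omega> ` T) ^ k)" by (simp add: P_def prod.reindex[OF inj'])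
        also have "\<dots> = (\<Sum>T\<in>image \<omega> ` \<S>. \<Prod>T ^ k)" by (simp add: sum.reindex[OF inj])
        finally show "\<omega> (P k) = P k" by (simp add: img P_def)
      qed
      define \<epsilon> where "\<epsilon> k = (\<Sum>T\<in>\<S> - {S}. (\<Prod>T / N) ^ k)" for k :: nat
      have P_eq: "P k = N ^ k * (1 + \<epsilon> k)" for k
      proof -
        have "P k = N ^ k + (\<Sum>T\<in>\<S> - {S}. \<Prod>T ^ k)" using Sfin SS by (simp add: P_def N_def sum.remove)
        also have "(\<Sum>T\<in>\<S> - {S}. \<Prod>T ^ k) = N ^ k * \<epsilon> k"
          using N0 by (simp add: \<epsilon>_def sum_distrib_left power_divide)
        finally show ?thesis by (simp add: algebra_simps)
      qed
      \<comment> \<open>Rank one is used here: high powers of a nonunit become divisible by any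
        given power of p, which makes the quotients converge.\<close>
      have small_pow: "\<forall>\<^sub>F k in sequentially. \<mu> ^ k / of_nat p ^ j \<in> V" if \<mu>: "\<mu> \<in> V.nonunits" for \<mu> j
      proof (cases "\<mu> = 0")
        case True
        then show ?thesis by (auto simp: eventually_sequentially power_0_left intro!: exI[of _ 1])
      next
        case False
        then obtain r where r: "\<mu> ^ r / of_nat p \<in> V" using arch[of \<mu>] \<mu> by (auto simp: V.nonunits_iff)
        have "\<mu> ^ k / of_nat p ^ j \<in> V" if "k \<ge> r * j" for k
        proof -
          have "\<mu> ^ k = (\<mu> ^ r) ^ j * \<mu> ^ (k - r * j)"
            using that by (simp add: power_mult[symmetric] power_add[symmetric])
          hence "\<mu> ^ k / of_nat p ^ j = (\<mu> ^ r / of_nat p) ^ j * \<mu> ^ (k - r * j)" by (simp add: power_divide)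
          then show ?thesis using r V.nonunits_V[OF \<mu>] by (simp add: V.mult V.power)
        qed
        then show ?thesis unfolding eventually_sequentially by blast
      qed
      have eps: "\<forall>\<^sub>F k in sequentially. \<epsilon> k / of_nat p ^ j \<in> V" for j
      proof -
        have "\<forall>\<^sub>F k in sequentially. \<forall>T\<in>\<S> - {S}. (\<Prod>T / N) ^ k / of_nat p ^ j \<in> V"
          using Sfin small by (intro eventually_ball_finite) (auto intro: small_pow)
        then show ?thesis
        proof eventually_elim
          case (elim k)
          have "\<epsilon> k / of_nat p ^ j = (\<Sum>T\<in>\<S> - {S}. (\<Prod>T / N) ^ k / of_nat p ^ j)"
            by (simp add: \<epsilon>_def sum_divide_distrib)
          also have "\<dots> \<in> V" using elim by (intro V.sum) auto
          finally show ?case .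
        qed
      qed
      define r where "r k = P (Suc k) / P k" for k
      have rQ: "r k \<in> Qp" for k using P by (simp add: r_def Qp.divide)
      have r_lim: "\<forall>\<^sub>F k in sequentially. (r k - N) / N / of_nat p ^ j \<in> V" for j
      proof -
        have "\<forall>\<^sub>F k in sequentially. \<epsilon> (Suc k) / of_nat p ^ j \<in> V"
          using eps[of j] by (simp add: eventually_sequentially_Suc[of "\<lambda>k. \<epsilon> k / of_nat p ^ j \<in> V"])
        with eps[of j] eps[of 1] show ?thesis
        proof eventually_elim
          case (elim k)
          have "of_nat p * (\<epsilon> k / of_nat p ^ 1) \<in> V.nonunits" by (intro V.nonunits_mult' p_non elim)
          hence "1 + \<epsilon> k \<notin> V.nonunits" by (intro V.unit_add_nonunit) auto
          moreover have "1 + \<epsilon> k \<in> V"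
            using \<open>of_nat p * (\<epsilon> k / of_nat p ^ 1) \<in> V.nonunits\<close> by (auto dest: V.nonunits_V)
          ultimately have u: "inverse (1 + \<epsilon> k) \<in> V" "1 + \<epsilon> k \<noteq> 0" using V.unit_inverse V.unit_nonzero by auto
          have "(r k - N) / N / of_nat p ^ j = (\<epsilon> (Suc k) / of_nat p ^ j - \<epsilon> k / of_nat p ^ j) * inverse (1 + \<epsilon> k)"
          proof -
            have "r k = N * (1 + \<epsilon> (Suc k)) / (1 + \<epsilon> k)" using N0 by (simp add: r_def P_eq)
            hence "r k - N = N * (\<epsilon> (Suc k) - \<epsilon> k) / (1 + \<epsilon> k)" using u(2) by (simp add: field_simps)
            hence "(r k - N) / N = (\<epsilon> (Suc k) - \<epsilon> k) * inverse (1 + \<epsilon> k)" using N0 by (simp add: divide_inverse)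
            then show ?thesis by (simp only:) (simp add: divide_inverse algebra_simps)
          qed
          also have "\<dots> \<in> V" using elim u(1) by blast
          finally show ?case .
        qed
      qed
      \<comment> \<open>\<open>N\<close> may have a denominator; the shift by \<open>c\<close> turns
        closeness relative to \<open>N\<close> into absolute closeness.\<close>
      obtain c where c: "of_nat p ^ c * N \<in> V" using bounded by blast
      have close: "\<exists>K. \<forall>k\<ge>K. (r k - N) / of_nat p ^ j \<in> V" for j
      proof -
        obtain K where K: "\<And>k. k \<ge> K \<Longrightarrow> (r k - N) / N / of_nat p ^ (j + c) \<in> V"
          using r_lim[of "j + c"] by (auto simp: eventually_sequentially)
        have "(r k - N) / of_nat p ^ j \<in> V" if "k \<ge> K" for k
        proof -
          have "(r k - N) / of_nat p ^ j = ((r k - N) / N / of_nat p ^ (j + c)) * (of_nat p ^ c * N)"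
            using N0 by (simp add: power_add field_simps)
          then show ?thesis using V.mult[OF K[OF that] c] by simp
        qed
        then show ?thesis by blast
      qed
      have pow_small: "\<exists>j. (1 / real p) ^ j < e" if "e > 0" for e
        using p_gt_1 that by (intro real_arch_pow_inv) auto
      have cauchy: "\<exists>K. \<forall>m\<ge>K. \<forall>n\<ge>K. v (r m - r n) < e" if e: "e > 0" for e
      proof -
        obtain j where j: "(1 / real p) ^ j < e" using pow_small[OF e] by blast
        obtain K where K: "\<And>k. k \<ge> K \<Longrightarrow> (r k - N) / of_nat p ^ j \<in> V" using close by blast
        have "v (r m - r n) < e" if "m \<ge> K" "n \<ge> K" for m n
        proof -
          have "(r m - N) / of_nat p ^ j - (r n - N) / of_nat p ^ j \<in> V" using K that by blast
          hence "(r m - r n) / of_nat p ^ j \<in> V" by (simp add: diff_divide_distrib)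
          hence "v (r m - r n) \<le> (1 / p) ^ j" using rQ by (intro Qdiv) auto
          then show ?thesis using j by simp
        qed
        then show ?thesis by blast
      qed
      obtain l where l: "l \<in> Qp" "\<And>e. e > 0 \<Longrightarrow> \<exists>K. \<forall>n\<ge>K. v (r n - l) < e"
        using v_complete[OF rQ cauchy] by metis
      have "N - l = 0"
      proof (rule sep)
        fix j
        obtain K where K: "\<forall>k\<ge>K. (r k - N) / of_nat p ^ j \<in> V" using close by blast
        obtain K' where K': "\<forall>k\<ge>K'. v (r k - l) < (1 / p) ^ j" using l(2)[of "(1 / p) ^ j"] p_gt_1 by auto
        define k where "k = max K K'"
        have "(r k - l) / of_nat p ^ j \<in> Zp"
          using K'[rule_format, of k] rQ[of k] l(1) p_gt_1
          by (auto simp: k_def Zp_iff v_divide v_power v_p Qp.power Qp.diff Qp.divide field_simps)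
        hence "(r k - l) / of_nat p ^ j - (r k - N) / of_nat p ^ j \<in> V"
          using K[rule_format, of k] V(2) by (intro V.diff) (auto simp: k_def)
        then show "(N - l) / of_nat p ^ j \<in> V" by (simp add: diff_divide_distrib)
      qed
      hence NQ: "N \<in> Qp" using l(1) by simp
      \<comment> \<open>An automorphism taking \<open>y0\<close> to a smaller conjugate sends
        \<open>N\<close> to the product over another set, which is strictly smaller; yet it fixes
        \<open>N\<close>, now known to lie in \<open>Qp\<close>.\<close>
      obtain z where z: "z \<in> Z" "z \<notin> S" using \<open>S \<noteq> Z\<close> S(1) by blast
      obtain \<omega>1 \<omega>2 where w: "\<omega>1 \<in> carrier (abs_Gal Qp)" "y0 = \<omega>1 x" "\<omega>2 \<in> carrier (abs_Gal Qp)" "z = \<omega>2 x"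
        using y0(1) z(1) by (auto simp: Z_def conjugates_def)
      define \<omega> where "\<omega> = \<omega>2 \<circ> Hilbert_Choice.inv \<omega>1"
      have wG: "\<omega> \<in> carrier (abs_Gal Qp)" unfolding \<omega>_def by (intro abs_Gal_comp abs_Gal_inv w)
      have "\<omega> y0 = z" using abs_Gal_inv_apply(2)[OF w(1)] w by (simp add: \<omega>_def)
      interpret w: field_auto \<omega> using wG by (rule abs_Gal_auto)
      have injS: "inj_on \<omega> S" by (simp add: inj_on_def)
      have "\<omega> ` S \<noteq> S" using \<open>\<omega> y0 = z\<close> z S(3) by blast
      moreover have "\<omega> ` S \<in> \<S>" using Zstab[OF wG] S(1) by (auto simp: \<S>_def m_def card_image[OF injS])
      ultimately have "\<Prod>(\<omega> ` S) / N \<in> V.nonunits" by (rule small[rotated])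
      moreover have "\<Prod>(\<omega> ` S) = \<omega> N" by (simp add: N_def prod.reindex[OF injS])
      ultimately show False using abs_Gal_fix[OF wG NQ] N0 by simp
    qed
    \<comment> \<open>All conjugates now have the same value, so \<tau> x / x lies in
      \<open>V\<close>.\<close>
    have "\<tau> x \<in> Z" using \<tau> by (auto simp: Z_def conjugates_def)
    hence "\<tau> x / y0 \<in> V" using y0 by blast
    moreover have "inverse (x / y0) \<in> V" using xZ y0 \<open>S = Z\<close> by (intro V.unit_inverse) (auto simp: S_def)
    ultimately have "\<tau> x / y0 * inverse (x / y0) * x \<in> V" using x by blast
    then show ?thesis using False \<open>y0 \<noteq> 0\<close> by (simp add: field_simps)
  qed
qed


end

text \<open>The interface to the rest of the proof, in which stability of \<open>V\<close>
  summarises the absolute value and completeness. \<open>bounded\<close> clears denominators by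
  powers of p, and \<open>arch\<close> says that the valuation has rank one.\<close>

locale stable_valuation = valuation_subring V for V :: "'k::{alg_closed_field, field_char_0} set" +
  fixes p :: nat and E0 :: "'k set"
  assumes prime: "Factorial_Ring.prime p" and p_nonunit: "inverse (of_nat p) \<notin> V"
    and bounded: "\<exists>j. of_nat p ^ j * x \<in> V"
    and arch: "x \<noteq> 0 \<Longrightarrow> inverse x \<notin> V \<Longrightarrow> \<exists>r. x ^ r / of_nat p \<in> V"
    and E0: "subfield_of E0" and alg: "alg_over E0 x"
    and stable: "\<tau> \<in> carrier (abs_Gal E0) \<Longrightarrow> x \<in> V \<Longrightarrow> \<tau> x \<in> V"

text \<open>The product over the conjugates of an element of \<open>V\<close> has coefficients in
  \<open>V\<close> by stability and in \<open>Qp\<close> by invariance, hence in \<open>Zp\<close>.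
  So the ring provided by Zorn's lemma does not depend on any choice.\<close>

theorem (in padic_closure) integral_closure_valuation:
  shows "stable_valuation (integral_closure Zp UNIV) p Qp"
    and "integral_closure Zp UNIV \<inter> Qp = Zp"
proof -
  have p0: "(of_nat p :: 'k) \<noteq> 0" using p_gt_1 by simp
  have "of_nat p \<in> Zp" using of_int_Zp[of "int p"] by simp
  moreover have "inverse (of_nat p) \<notin> Zp"
    using p_gt_1 by (auto simp: Zp_iff v_inverse v_p)
  ultimately obtain V where V: "valuation_subring V" "Zp \<subseteq> V" "inverse (of_nat p) \<notin> V"
    "\<And>x. x \<noteq> 0 \<Longrightarrow> inverse x \<notin> V \<Longrightarrow> \<exists>r. x ^ r / of_nat p \<in> V"
    by (rule Zp.exists_valuation_subring) (rule that)
  interpret V: valuation_subring V by (rule V(1))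
  note S = valuation_subring_stable[OF V]
  have sv: "stable_valuation V p Qp"
    using prime V Qp.subfield_of_axioms alg S by unfold_locales auto
  have "integral_closure Zp UNIV = V"
  proof (intro equalityI subsetI)
    fix x assume "x \<in> integral_closure Zp UNIV"
    then obtain f where "monic_over Zp f" "poly f x = 0" by (auto simp: integral_closure_def)
    moreover have "monic_over V f" using \<open>monic_over Zp f\<close> V(2) by (auto simp: monic_over_def)
    ultimately show "x \<in> V" using V.integrally_closed by blast
  next
    fix x assume x: "x \<in> V"
    define Z where "Z = conjugates Qp x"
    define f where "f = (\<Prod>y\<in>Z. [:- y, 1:])"
    have Zfin: "finite Z" unfolding Z_def by (rule finite_conjugates[OF alg])
    have "f \<in> polys_over Qp" unfolding f_def
      by (rule stable_prod_polys_over[OF Qp.subfield_of_axioms alg])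
        (auto simp: Z_def abs_Gal_image_conjugates)
    moreover have "f \<in> polys_over V" unfolding f_def
      using S(3) x by (intro V.polys_over_prod V.polys_over_pCons) (auto simp: Z_def conjugates_def)
    ultimately have "f \<in> polys_over Zp" using S(1) by (auto simp: polys_over_def)
    moreover have "Polynomial.lead_coeff f = 1" by (simp add: f_def lead_coeff_prod)
    moreover have "poly f x = 0" using Zfin by (auto simp: f_def poly_prod Z_def)
    ultimately show "x \<in> integral_closure Zp UNIV"
      by (auto simp: integral_closure_def monic_over_iff)
  qed
  then show "stable_valuation (integral_closure Zp UNIV) p Qp" "integral_closure Zp UNIV \<inter> Qp = Zp"
    using sv S(1) by simp_all
qed

section \<open>Tame extensions\<close>

context valuation_subring
begin

lemma nonunits_cong_mult:
  "a - b \<in> nonunits \<Longrightarrow> c - d \<in> nonunits \<Longrightarrow> b \<in> V \<Longrightarrow> c \<in> V \<Longrightarrow> a * c - b * d \<in> nonunits"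
proof -
  assume *: "a - b \<in> nonunits" "c - d \<in> nonunits" "b \<in> V" "c \<in> V"
  have "a * c - b * d = (a - b) * c + b * (c - d)" by (simp add: algebra_simps)
  then show ?thesis using * by (simp add: nonunits_add nonunits_mult nonunits_mult')
qed

lemma nonunits_cong_power:
  "a - b \<in> nonunits \<Longrightarrow> a \<in> V \<Longrightarrow> b \<in> V \<Longrightarrow> a ^ n - b ^ n \<in> nonunits"
  by (induction n) (auto intro!: nonunits_cong_mult)

lemma nonunits_cong_trans: "a - b \<in> nonunits \<Longrightarrow> b - c \<in> nonunits \<Longrightarrow> a - c \<in> nonunits"
  using nonunits_add[of "a - b" "b - c"] by simp

lemma nonunits_cong_sym: "a - b \<in> nonunits \<Longrightarrow> b - a \<in> nonunits"
  using nonunits_uminus[of "a - b"] by simp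

lemma unit_mult: "x \<in> V \<Longrightarrow> y \<in> V \<Longrightarrow> x \<notin> nonunits \<Longrightarrow> y \<notin> nonunits \<Longrightarrow> x * y \<notin> nonunits"
  using nonunits_prime by blast

lemma unit_inverse_unit: "x \<in> V \<Longrightarrow> x \<notin> nonunits \<Longrightarrow> inverse x \<notin> nonunits"
  by (auto simp: nonunits_def)

text \<open>Were the largest value attained only once, dividing by that term would turn the sum into
  1 plus a nonunit, which cannot be zero.\<close>

lemma sum_zero_two_maximal:
  assumes "finite I" "(\<Sum>i\<in>I. t i) = 0" "i0 \<in> I" "t i0 \<noteq> 0"
  obtains i j where "i \<in> I" "j \<in> I" "i \<noteq> j" "t i \<noteq> 0" "t j / t i \<in> V" "t j / t i \<notin> nonunits"
proof -
  have "0 \<notin> t ` I - {0}" "t ` I - {0} \<noteq> {}" "finite (t ` I - {0})" using assms by auto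
  then obtain y where y: "y \<in> t ` I - {0}" "\<And>z. z \<in> t ` I - {0} \<Longrightarrow> z / y \<in> V"
    using finite_max[of "t ` I - {0}"] by metis
  then obtain i where i: "i \<in> I" "y = t i" "t i \<noteq> 0" by auto
  have le: "t j / t i \<in> V" if "j \<in> I" for j
    using y(2)[of "t j"] that i by (cases "t j = 0") auto
  have "\<exists>j\<in>I - {i}. t j / t i \<notin> nonunits"
  proof (rule ccontr)
    assume "\<not> ?thesis"
    hence "(\<Sum>j\<in>I - {i}. t j / t i) \<in> nonunits" by (intro nonunits_sum) auto
    moreover have "1 + (\<Sum>j\<in>I - {i}. t j / t i) = (\<Sum>j\<in>I. t j / t i)"
      using i assms(1) by (simp add: sum.remove)
    moreover have "(\<Sum>j\<in>I. t j / t i) = 0" using assms(2) by (simp add: sum_divide_distrib[symmetric])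
    ultimately show False by (metis one_not_nonunit unit_add_nonunit zero_nonunit)
  qed
  then obtain j where "j \<in> I - {i}" "t j / t i \<notin> nonunits" by blast
  then show thesis using that[of i j] i le by auto
qed

text \<open>A uniformiser of V \<inter> E, stated through quotients so that fields can be compared
  without naming their rings of integers.\<close>

definition unif :: "'k set \<Rightarrow> 'k \<Rightarrow> bool" where
  "unif E w \<longleftrightarrow> w \<in> E \<and> w \<noteq> 0 \<and> w \<in> nonunits \<and> (\<forall>x\<in>E. x \<in> nonunits \<longrightarrow> x / w \<in> V)"

text \<open>Finiteness of the residue field in a form that extends easily: representatives may be
  redundant and may lie outside \<open>E\<close>.\<close>

definition residues :: "'k set \<Rightarrow> 'k set \<Rightarrow> bool" where
  "residues E R \<longleftrightarrow> finite R \<and> R \<subseteq> V \<and> (\<forall>x\<in>E. x \<in> V \<longrightarrow> (\<exists>r\<in>R. x - r \<in> nonunits))"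

end

lemma alg_closed_split:
  fixes f :: "'k::alg_closed_field poly"
  assumes "Polynomial.lead_coeff f = 1"
  obtains A where "f = (\<Prod>x\<in>#A. [:- x, 1:])" "\<And>x. x \<in># A \<Longrightarrow> poly f x = 0"
    "\<And>y. poly f y = (\<Prod>x\<in>#A. y - x)"
proof -
  have "f \<noteq> 0" using assms by auto
  then obtain A where A: "f = (\<Prod>x\<in>#A. [:- x, 1:])"
    using alg_closed_imp_factorization[of f] assms by auto
  have ev: "poly f y = (\<Prod>x\<in>#A. y - x)" for y
    unfolding A by (induction A) (auto simp: algebra_simps)
  show thesis
  proof (rule that[OF A _ ev])
    fix x assume "x \<in># A"
    then show "poly f x = 0" by (auto simp: ev prod_mset_zero_iff)
  qed
qed

lemma (in valuation_subring) nonunits_prod_mset: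
  "(\<Prod>x\<in>#A. f x) \<in> nonunits \<Longrightarrow> (\<And>x. x \<in># A \<Longrightarrow> f x \<in> V) \<Longrightarrow> \<exists>x\<in>#A. f x \<in> nonunits"
proof (induction A)
  case (add a A)
  have "(\<Prod>x\<in>#A. f x) \<in> V" using add.prems(2) by (induction A) auto
  then show ?case using add nonunits_prime[of "f a" "\<Prod>x\<in>#A. f x"] by auto
qed auto

context stable_valuation
begin

lemma p_gt_1: "p > 1"
  using prime by (rule prime_gt_1_nat)

lemma p_nonunits: "of_nat p \<in> nonunits"
  using p_nonunit p_gt_1 nonunits_iff[of "of_nat p"] by simp

text \<open>For nonzero x some p^j / x is integral, and then 1/p would be integral too.\<close>

lemma separated:
  assumes "\<And>j. x / of_nat p ^ j \<in> V" shows "x = 0"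
proof (rule ccontr)
  assume x: "x \<noteq> 0"
  have p0: "(of_nat p :: 'k) \<noteq> 0" using p_gt_1 by simp
  obtain j where "of_nat p ^ j * inverse x \<in> V" using bounded by blast
  hence "(of_nat p ^ j * inverse x) * (x / of_nat p ^ Suc j) \<in> V" using assms by blast
  then show False using x p_nonunit p0 by (simp add: field_simps)
qed

lemma dvd_power_nonunit:
  assumes "w \<in> nonunits" "w \<noteq> 0" "x \<noteq> 0"
  shows "\<exists>n. w ^ n / x \<in> V"
proof -
  have p0: "(of_nat p :: 'k) \<noteq> 0" using p_gt_1 by simp
  obtain j where j: "of_nat p ^ j * inverse x \<in> V" using bounded by blast
  obtain r where r: "w ^ r / of_nat p \<in> V" using arch[OF assms(2)] assms nonunits_iff by blast
  have "w ^ (r * j) / x = (w ^ r / of_nat p) ^ j * (of_nat p ^ j * inverse x)"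
    unfolding power_mult power_divide using p0 by (simp add: divide_inverse)
  then show ?thesis using j r by (intro exI[of _ "r * j"]) (simp add: mult power)
qed

text \<open>The exponent is the largest k with x / w^k in \<open>V\<close>; it exists since some
  power of w is divisible by x. Elements outside \<open>V\<close> are treated through their
  inverses.\<close>

lemma unif_decomp:
  assumes E: "subfield_of E" and w: "unif E w" and x: "x \<in> E" "x \<noteq> 0"
  obtains k :: int where "x / w powi k \<in> V" "x / w powi k \<notin> nonunits"
proof -
  interpret E: subfield_of E by fact
  have w': "w \<in> E" "w \<noteq> 0" "w \<in> nonunits" and div: "\<And>x. x \<in> E \<Longrightarrow> x \<in> nonunits \<Longrightarrow> x / w \<in> V"
    using w by (auto simp: unif_def)
  have *: "\<exists>k. x / w ^ k \<in> V \<and> x / w ^ k \<notin> nonunits" if x: "x \<in> E" "x \<noteq> 0" "x \<in> V" for x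
  proof -
    obtain n where n: "w ^ n / x \<in> V" using dvd_power_nonunit[OF w'(3,2) x(2)] by blast
    have bound: "k \<le> n" if "x / w ^ k \<in> V" for k
    proof (rule ccontr)
      assume "\<not> k \<le> n"
      then obtain d where d: "k = n + Suc d" by (metis add_Suc_right less_imp_Suc_add not_le)
      have "(w ^ n / x) * (x / w ^ k) \<in> V" using n that by blast
      hence "inverse (w ^ Suc d) \<in> V" using x w'(2) by (simp add: d power_add field_simps)
      moreover have "w ^ Suc d \<in> nonunits" using w'(3) by (rule power_nonunits) simp
      ultimately show False using w'(2) nonunits_iff[of "w ^ Suc d"] by simp
    qed
    define k where "k = Max {k. x / w ^ k \<in> V}"
    have fin: "finite {k. x / w ^ k \<in> V}" by (rule finite_subset[of _ "{..n}"]) (use bound in auto)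
    have "0 \<in> {k. x / w ^ k \<in> V}" using x by simp
    hence "k \<in> {k. x / w ^ k \<in> V}" unfolding k_def by (intro Max_in[OF fin]) blast
    hence k: "x / w ^ k \<in> V" by simp
    have "x / w ^ k \<notin> nonunits"
    proof
      assume "x / w ^ k \<in> nonunits"
      hence "x / w ^ k / w \<in> V" using x w' by (intro div E.divide E.power)
      hence "Suc k \<in> {k. x / w ^ k \<in> V}" by (simp add: field_simps)
      hence "Suc k \<le> k" using Max_ge[OF fin] unfolding k_def by blast
      then show False by simp
    qed
    then show ?thesis using k by blast
  qed
  show thesis
  proof (cases "x \<in> V")
    case True
    then obtain k where "x / w ^ k \<in> V" "x / w ^ k \<notin> nonunits" using * x by blast
    then show thesis using that[of "int k"] by (simp add: power_int_def)
  next
    case False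
    then have "inverse x \<in> V" using val[of x] by blast
    then obtain k where k: "inverse x / w ^ k \<in> V" "inverse x / w ^ k \<notin> nonunits" using *[of "inverse x"] x by auto
    have "x / w powi (- int k) = inverse (inverse x / w ^ k)"
      by (simp add: power_int_minus divide_inverse)
    then show thesis using that[of "- int k"] k unit_inverse[OF k] unit_inverse_unit[OF k] by simp
  qed
qed

lemma power_int_nonunit:
  assumes "w \<in> nonunits" "w \<noteq> 0" "u \<in> V" "u \<notin> nonunits"
  shows "w powi k * u \<in> V \<longleftrightarrow> k \<ge> 0" and "w powi k * u \<in> nonunits \<longleftrightarrow> k > 0"
proof -
  have u0: "u \<noteq> 0" using assms(4) by auto
  have pos: "w powi k * u \<in> nonunits" if "k > 0" for k
    using that assms power_nonunits[OF assms(1), of "nat k"]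
    by (simp add: power_int_def nonunits_mult')
  have neg: "w powi k * u \<notin> V" if "k < 0" for k
  proof
    assume "w powi k * u \<in> V"
    hence "w powi (- k) * inverse u * (w powi k * u) \<in> nonunits"
      using pos[of "- k"] that assms unit_inverse[OF assms(3,4)] unit_inverse_unit[OF assms(3,4)]
        power_nonunits[OF assms(1), of "nat (- k)"]
      by (intro nonunits_mult') (auto simp: power_int_def nonunits_mult')
    then show False using u0 assms(2) by (simp add: power_int_minus field_simps)
  qed
  consider "k > 0" | "k = 0" | "k < 0" by linarith
  then show "w powi k * u \<in> V \<longleftrightarrow> k \<ge> 0"
    by cases (use pos[of k] neg[of k] assms(3) nonunits_V[of "w powi k * u"] in auto)
  consider "k > 0" | "k = 0" | "k < 0" by linarith
  then show "w powi k * u \<in> nonunits \<longleftrightarrow> k > 0"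
    by cases (use pos[of k] neg[of k] assms(4) nonunits_V[of "w powi k * u"] in auto)
qed

text \<open>Two terms of equal value in a relation of degree at most \<open>d\<close> show that \<open>x\<^bsup>d!\<^esup>\<close> has the value of a base element.\<close>

lemma power_fact_value:
  assumes E: "subfield_of E" and w: "unif E w" and x: "x \<noteq> 0"
    and h: "h \<in> polys_over E" "h \<noteq> 0" "Polynomial.degree h \<le> d" "poly h x = 0"
  obtains k :: int where "x ^ fact d / w powi k \<in> V" "x ^ fact d / w powi k \<notin> nonunits"
proof -
  interpret E: subfield_of E by fact
  define t where "t i = Polynomial.coeff h i * x ^ i" for i
  have "(\<Sum>i\<le>Polynomial.degree h. t i) = 0" using h(4) by (simp add: poly_altdef t_def)
  moreover have "t (Polynomial.degree h) \<noteq> 0" using h(2) x by (simp add: t_def)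
  ultimately obtain i j where ij: "i \<le> Polynomial.degree h" "j \<le> Polynomial.degree h" "i \<noteq> j" "t i \<noteq> 0"
    "t j / t i \<in> V" "t j / t i \<notin> nonunits"
    using sum_zero_two_maximal[of "{..Polynomial.degree h}" t "Polynomial.degree h"] by auto
  have tj: "t j \<noteq> 0" using ij(6) by auto
  \<comment> \<open>The two terms give x^n the value of a quotient of coefficients, with n the
    difference of their degrees. As n is at most \<open>d\<close> it divides \<open>fact d\<close>,
    which is thus one exponent for all x.\<close>
  have "\<exists>n c. 0 < n \<and> n \<le> d \<and> c \<in> E \<and> c \<noteq> 0 \<and> x ^ n / c \<in> V \<and> x ^ n / c \<notin> nonunits"
  proof (cases "i < j")
    case True
    define c where "c = Polynomial.coeff h i / Polynomial.coeff h j"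
    have "t j / t i = x ^ (j - i) / c" using x True tj ij(4) by (simp add: t_def c_def power_diff field_simps)
    moreover have "c \<in> E" "c \<noteq> 0" using h(1) tj ij(4) by (auto simp: c_def polys_over_def t_def)
    ultimately show ?thesis using True ij h(3) by (intro exI[of _ "j - i"] exI[of _ c]) auto
  next
    case False
    define c where "c = Polynomial.coeff h j / Polynomial.coeff h i"
    have "inverse (t j / t i) = x ^ (i - j) / c" using x False tj ij(4) by (simp add: t_def c_def power_diff field_simps)
    moreover have "c \<in> E" "c \<noteq> 0" using h(1) tj ij(4) by (auto simp: c_def polys_over_def t_def)
    ultimately show ?thesis using False ij h(3) unit_inverse[OF ij(5,6)] unit_inverse_unit[OF ij(5,6)]
      by (intro exI[of _ "i - j"] exI[of _ c]) auto
  qed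
  then obtain n c where n: "0 < n" "n \<le> d" "c \<in> E" "c \<noteq> 0" "x ^ n / c \<in> V" "x ^ n / c \<notin> nonunits" by blast
  obtain k :: int where k: "c / w powi k \<in> V" "c / w powi k \<notin> nonunits"
    using unif_decomp[OF E w n(3,4)] by blast
  obtain l where l: "fact d = n * l" using n(1,2) by (metis dvd_def dvd_fact Suc_leI One_nat_def)
  have unit: "u ^ m \<in> V \<and> u ^ m \<notin> nonunits" if "u \<in> V" "u \<notin> nonunits" for u m
    using that nonunits_power by blast
  have "x ^ fact d / w powi (k * int l) = (x ^ n / c) ^ l * (c / w powi k) ^ l"
    using n(4) by (simp add: l power_mult power_divide power_int_mult)
  then show thesis using that[of "k * int l"] unit[OF n(5,6), of l] unit[OF k, of l] unit_mult by (simp add: mult)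
qed

text \<open>By \<open>power_fact_value\<close> the order of every nonzero element of
  \<open>F\<close> is an integral multiple of 1/d! in terms of that of \<open>w\<close>. A nonunit
  with the least positive multiple is a uniformiser.\<close>

lemma unif_exists:
  assumes E: "subfield_of E" and F: "subfield_of F" "E \<subseteq> F" and w: "unif E w"
    and deg: "\<And>x. x \<in> F \<Longrightarrow> \<exists>h \<in> polys_over E. h \<noteq> 0 \<and> Polynomial.degree h \<le> d \<and> poly h x = 0"
  obtains w' where "unif F w'"
proof -
  interpret F: subfield_of F by fact
  have w': "w \<in> F" "w \<noteq> 0" "w \<in> nonunits" using w F(2) by (auto simp: unif_def)
  define P where "P x k \<longleftrightarrow> x ^ fact d / w powi k \<in> V \<and> x ^ fact d / w powi k \<notin> nonunits" for x and k :: int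
  have ex: "\<exists>k. P x k" if "x \<in> F" "x \<noteq> 0" for x
    using deg[OF that(1)] power_fact_value[OF E w that(2)] unfolding P_def by metis
  have pos: "k > 0" if "P x k" "x \<in> nonunits" for x k
  proof -
    have "x ^ fact d = w powi k * (x ^ fact d / w powi k)" using w' by simp
    moreover have "x ^ fact d \<in> nonunits" using that(2) by (rule power_nonunits) (rule fact_gt_zero)
    ultimately show ?thesis using power_int_nonunit(2)[OF w'(3,2)] that(1) unfolding P_def by metis
  qed
  define Q where "Q n \<longleftrightarrow> (\<exists>x\<in>F. x \<noteq> 0 \<and> x \<in> nonunits \<and> P x (int n))" for n
  obtain k0 where k0: "P w k0" using ex w' by blast
  have "Q (nat k0)" unfolding Q_def using w' k0 pos[OF k0] by (intro bexI[of _ w]) auto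
  define n where "n = (LEAST n. Q n)"
  have "Q n" unfolding n_def using \<open>Q (nat k0)\<close> by (rule LeastI)
  then obtain y where y: "y \<in> F" "y \<noteq> 0" "y \<in> nonunits" "P y (int n)" by (auto simp: Q_def)
  have "z / y \<in> V" if z: "z \<in> F" "z \<in> nonunits" for z
  proof (cases "z = 0")
    case False
    then obtain k where k: "P z k" using ex z by blast
    have "k > 0" using pos[OF k z(2)] .
    hence "Q (nat k)" using z False k by (auto simp: Q_def)
    hence "n \<le> nat k" unfolding n_def by (rule Least_le)
    hence kn: "k - int n \<ge> 0" using \<open>k > 0\<close> by simp
    have "(z / y) ^ fact d = w powi (k - int n) * (z ^ fact d / w powi k * inverse (y ^ fact d / w powi int n))"
      using w' y(2) by (simp add: power_divide power_int_diff field_simps)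
    also have "\<dots> \<in> V"
    proof -
      define a where "a = z ^ fact d / w powi k"
      define b where "b = y ^ fact d / w powi int n"
      have ab: "a \<in> V" "a \<notin> nonunits" "b \<in> V" "b \<notin> nonunits" using k y(4) by (auto simp: P_def a_def b_def)
      have "a * inverse b \<in> V" "a * inverse b \<notin> nonunits"
        using ab unit_inverse[OF ab(3,4)] unit_inverse_unit[OF ab(3,4)] unit_mult by blast+
      then show ?thesis unfolding a_def[symmetric] b_def[symmetric]
        using power_int_nonunit(1)[OF w'(3,2)] kn by blast
    qed
    finally have zy: "(z / y) ^ fact d \<in> V" .
    \<comment> \<open>A root of an element of \<open>V\<close> is in \<open>V\<close>, so the
      comparison of d!-th powers descends.\<close>
    show ?thesis
    proof (rule ccontr)
      assume "z / y \<notin> V"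
      hence "inverse (z / y) \<in> nonunits" using val[of "z / y"] nonunits_iff[of "inverse (z / y)"] False y(2) by auto
      hence "inverse (z / y) ^ fact d \<in> nonunits" by (rule power_nonunits) simp
      hence "(z / y) ^ fact d * inverse (z / y) ^ fact d \<in> nonunits" using zy by (rule nonunits_mult[rotated])
      then show False using False y(2) by (simp add: power_mult_distrib[symmetric])
    qed
  qed auto
  then show thesis using that[of y] y by (auto simp: unif_def)
qed

text \<open>Modulo nonunits every integral x in \<open>F\<close> satisfies a polynomial of degree at
  most \<open>d\<close> with coefficients in \<open>R\<close> and a unit as leading coefficient.
  There are finitely many of these, and x is congruent to one of their roots.\<close>

lemma residues_extend:
  assumes E: "subfield_of E" and F: "subfield_of F" and R: "residues E R"
    and deg: "\<And>x. x \<in> F \<Longrightarrow> \<exists>h \<in> polys_over E. h \<noteq> 0 \<and> Polynomial.degree h \<le> d \<and> poly h x = 0"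
  obtains R' where "residues F R'"
proof -
  interpret E: subfield_of E by fact
  have Rfin: "finite R" "R \<subseteq> V" and R: "\<And>x. x \<in> E \<Longrightarrow> x \<in> V \<Longrightarrow> \<exists>r\<in>R. x - r \<in> nonunits"
    using R by (auto simp: residues_def)
  define mk where "mk = (\<lambda>(m, f). \<Sum>i\<le>m. Polynomial.monom (f i) i :: 'k poly)"
  define H where "H = {h \<in> mk ` (SIGMA m:{..d}. {..m} \<rightarrow>\<^sub>E R). h \<in> polys_over V \<and> Polynomial.lead_coeff h \<notin> nonunits}"
  define R' where "R' = (\<Union>h\<in>H. {x. poly h x = 0} \<inter> V)"
  have "finite (mk ` (SIGMA m:{..d}. {..m} \<rightarrow>\<^sub>E R))"
    using Rfin by (intro finite_imageI finite_SigmaI finite_PiE) auto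
  hence Hfin: "finite H" by (simp add: H_def)
  have "finite {x. poly h x = 0}" if "h \<in> H" for h
    using that unit_nonzero[of "Polynomial.lead_coeff h"] by (intro poly_roots_finite) (auto simp: H_def)
  hence "finite R'" unfolding R'_def using Hfin by auto
  moreover have "\<exists>r\<in>R'. x - r \<in> nonunits" if x: "x \<in> F" "x \<in> V" for x
  proof -
    obtain h where h: "h \<in> polys_over E" "h \<noteq> 0" "Polynomial.degree h \<le> d" "poly h x = 0" using deg[OF x(1)] by blast
    \<comment> \<open>Dividing by the largest coefficient makes the polynomial integral with some
      coefficient equal to 1.\<close>
    define C where "C = Polynomial.coeff h ` {..Polynomial.degree h} - {0}"
    have "finite C" "0 \<notin> C" "C \<noteq> {}" using h(2) by (auto simp: C_def intro!: exI[of _ "Polynomial.degree h"])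
    then obtain c where c: "c \<in> C" "\<And>z. z \<in> C \<Longrightarrow> z / c \<in> V" using finite_max[of C] by metis
    define g where "g = Polynomial.smult (inverse c) h"
    have cE: "c \<in> E" "c \<noteq> 0" using c(1) h(1) by (auto simp: C_def polys_over_def)
    have g: "Polynomial.coeff g i \<in> E" "Polynomial.coeff g i \<in> V" for i
    proof -
      show "Polynomial.coeff g i \<in> E" using cE h(1) by (auto simp: g_def polys_over_def)
      show "Polynomial.coeff g i \<in> V"
      proof (cases "Polynomial.coeff h i = 0")
        case False
        hence "Polynomial.coeff h i \<in> C" by (auto simp: C_def le_degree)
        then show ?thesis using c(2)[of "Polynomial.coeff h i"] by (simp add: g_def divide_inverse mult.commute)
      qed (simp add: g_def)
    qed
    obtain i0 where "Polynomial.coeff h i0 = c" using c(1) by (auto simp: C_def)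
    hence g1: "Polynomial.coeff g i0 = 1" using cE by (simp add: g_def)
    have gx: "poly g x = 0" using h(4) by (simp add: g_def)
    have gdeg: "Polynomial.degree g \<le> d" using h(3) cE by (simp add: g_def)
    define M where "M = {i. Polynomial.coeff g i \<notin> nonunits}"
    have Md: "M \<subseteq> {..d}"
    proof
      fix i assume "i \<in> M"
      hence "Polynomial.coeff g i \<noteq> 0" by (auto simp: M_def)
      then show "i \<in> {..d}" using le_degree[of g i] gdeg by simp
    qed
    hence Mfin: "finite M" by (rule finite_subset) simp
    have "i0 \<in> M" using g1 by (simp add: M_def)
    \<comment> \<open>Coefficients above the last unit one are nonunits and are dropped; this keeps
      the leading coefficient of the reduced polynomial a unit.\<close>
    define m where "m = Max M"
    have mM: "m \<in> M" unfolding m_def using Mfin \<open>i0 \<in> M\<close> by (intro Max_in) auto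
    have above: "Polynomial.coeff g i \<in> nonunits" if "i > m" for i
      using that Max_ge[OF Mfin, of i] by (force simp: m_def M_def)
    have "\<forall>i. \<exists>r\<in>R. Polynomial.coeff g i - r \<in> nonunits" using R g by blast
    then obtain \<rho> where \<rho>: "\<And>i. \<rho> i \<in> R" "\<And>i. Polynomial.coeff g i - \<rho> i \<in> nonunits" by metis
    define f where "f = mk (m, restrict \<rho> {..m})"
    have fc: "Polynomial.coeff f i = (if i \<le> m then \<rho> i else 0)" for i
      by (auto simp: f_def mk_def coeff_sum coeff_monom if_distrib cong: if_cong)
    have fcm: "Polynomial.coeff f m \<notin> nonunits"
    proof
      assume "Polynomial.coeff f m \<in> nonunits"
      hence "Polynomial.coeff g m \<in> nonunits"
        using nonunits_add[OF \<rho>(2)[of m], of "\<rho> m"] by (simp add: fc)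
      then show False using mM by (simp add: M_def)
    qed
    have "Polynomial.degree f \<le> m" by (rule degree_le) (simp add: fc)
    moreover have "Polynomial.coeff f m \<noteq> 0" using fcm by auto
    ultimately have fdeg: "Polynomial.degree f = m" by (simp add: le_degree antisym)
    have fV: "f \<in> polys_over V" using \<rho>(1) Rfin by (auto simp: polys_over_def fc)
    have fH: "f \<in> H"
      unfolding H_def f_def[symmetric]
    proof (intro CollectI conjI)
      show "f \<in> mk ` (SIGMA m:{..d}. {..m} \<rightarrow>\<^sub>E R)"
        unfolding f_def using mM Md \<rho>(1) by (intro imageI) auto
    qed (use fV fcm fdeg in simp_all)
    have "poly (f - g) x \<in> nonunits"
      unfolding poly_altdef
    proof (intro nonunits_sum nonunits_mult' power x)
      fix i
      show "Polynomial.coeff (f - g) i \<in> nonunits"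
        using nonunits_cong_sym[OF \<rho>(2)[of i]] nonunits_uminus[OF above[of i]] by (auto simp: fc not_le)
    qed
    hence fx: "poly f x \<in> nonunits" using gx by simp
    define c' where "c' = Polynomial.lead_coeff f"
    have c': "c' \<in> V" "c' \<notin> nonunits" "c' \<noteq> 0" using fV fcm fdeg by (auto simp: c'_def polys_over_def)
    have ic: "inverse c' \<in> V" using c' by (intro unit_inverse)
    define f' where "f' = Polynomial.smult (inverse c') f"
    have lead: "Polynomial.lead_coeff f' = 1" using c' by (simp add: f'_def c'_def)
    have mon: "monic_over V f'" unfolding monic_over_iff using lead fV ic by (auto simp: f'_def)
    obtain A where A: "\<And>z. z \<in># A \<Longrightarrow> poly f' z = 0" "\<And>y. poly f' y = (\<Prod>z\<in>#A. y - z)"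
      using alg_closed_split[OF lead] by metis
    have AV: "z \<in> V" if "z \<in># A" for z using integrally_closed[OF mon A(1)[OF that]] .
    have "(\<Prod>z\<in>#A. x - z) \<in> nonunits" using fx ic unfolding A(2)[symmetric] by (simp add: f'_def nonunits_mult)
    then obtain z where z: "z \<in># A" "x - z \<in> nonunits" using nonunits_prod_mset[of "\<lambda>z. x - z" A] AV x by blast
    have "poly f z = 0" using A(1)[OF z(1)] c'(3) by (simp add: f'_def)
    hence "z \<in> R'" using fH AV[OF z(1)] by (auto simp: R'_def)
    then show ?thesis using z by blast
  qed
  ultimately show thesis using that[of R'] by (auto simp: residues_def R'_def)
qed


section \<open>Roots of unity and Frobenius modulo the maximal ideal\<close>

lemma coprime_unit:
  assumes "\<not> p dvd m" shows "of_nat m \<notin> nonunits"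
proof
  assume m: "of_nat m \<in> nonunits"
  have "coprime m p" using assms prime by (metis coprime_commute prime_imp_coprime)
  then obtain a b where ab: "a * int m + b * int p = 1"
    using bezout_int[of "int m" "int p"] by (auto simp: coprime_iff_gcd_eq_1)
  have int: "of_int a \<in> V" for a by (cases a) auto
  have "of_int a * of_nat m + of_int b * of_nat p \<in> nonunits"
    by (intro nonunits_add nonunits_mult m p_nonunits int)
  moreover have "of_int a * of_nat m + of_int b * of_nat p = (of_int (a * int m + b * int p) :: 'k)" by simp
  ultimately show False unfolding ab by simp
qed

lemma root_of_unity_V:
  assumes "y ^ m = 1" "m > 0" shows "y \<in> V" "y \<notin> nonunits"
proof -
  have "inverse y ^ m = 1" using assms(1) by (simp add: power_inverse)
  have "\<not> (z \<in> nonunits)" if "z ^ m = 1" for z using power_nonunits[of z m] that assms(2) by auto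
  from this[OF assms(1)] show y: "y \<notin> nonunits" .
  show "y \<in> V"
  proof (rule ccontr)
    assume "y \<notin> V"
    hence "inverse y \<in> nonunits" using val[of y] nonunits_iff[of "inverse y"] by (cases "y = 0") auto
    then show False using power_nonunits[of "inverse y" m] \<open>inverse y ^ m = 1\<close> assms(2) by auto
  qed
qed

text \<open>If y were not 1, then 1 + y + ... + y^(m-1) would be 0; but it is congruent to m, a
  unit.\<close>

lemma root_of_unity_eq_1:
  assumes "y ^ m = 1" "\<not> p dvd m" "y - 1 \<in> nonunits" shows "y = 1"
proof (rule ccontr)
  assume "y \<noteq> 1"
  have "m > 0" using assms(2) by (cases m) auto
  have y: "y \<in> V" using root_of_unity_V[OF assms(1) \<open>m > 0\<close>] by simp
  have "(y - 1) * (\<Sum>i<m. y ^ i) = 0" using power_diff_1_eq[of y m] assms(1) by simp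
  hence s: "(\<Sum>i<m. y ^ i) = 0" using \<open>y \<noteq> 1\<close> by simp
  have "(\<Sum>i<m. y ^ i - 1 ^ i) \<in> nonunits"
    using assms(3) y by (intro nonunits_sum nonunits_cong_power) auto
  moreover have "(\<Sum>i<m. y ^ i - 1 ^ i) = - of_nat m" using s by (simp add: sum_subtractf)
  ultimately have "of_nat m \<in> nonunits" using nonunits_uminus by force
  then show False using coprime_unit[OF assms(2)] by blast
qed

lemma roots_of_unity_eq:
  assumes "a ^ m = 1" "b ^ m = 1" "\<not> p dvd m" "a - b \<in> nonunits" shows "a = b"
proof -
  have "m > 0" using assms(3) by (cases m) auto
  note b = root_of_unity_V[OF assms(2) this]
  have "b \<noteq> 0" using b by auto
  have "a / b - 1 = (a - b) * inverse b" using \<open>b \<noteq> 0\<close> by (simp add: field_simps)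
  hence "a / b - 1 \<in> nonunits" using assms(4) unit_inverse[OF b] by (simp add: nonunits_mult')
  moreover have "(a / b) ^ m = 1" using assms(1,2) by (simp add: power_divide)
  ultimately have "a / b = 1" using root_of_unity_eq_1 assms(3) by blast
  then show ?thesis using \<open>b \<noteq> 0\<close> by simp
qed

text \<open>x^m - 1 is the product of the differences x - z over the m-th roots of unity, so one of
  the factors must be a nonunit.\<close>

lemma near_root_of_unity:
  assumes x: "x \<in> V" "x ^ m - 1 \<in> nonunits" and m: "m > 0"
  obtains z where "z ^ m = 1" "x - z \<in> nonunits"
proof -
  define f where "f = Polynomial.monom 1 m - (1 :: 'k poly)"
  have pf: "poly f y = y ^ m - 1" for y by (simp add: f_def poly_monom)
  have "Polynomial.degree f \<le> m" unfolding f_def by (intro degree_diff_le) (auto simp: degree_monom_le)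
  moreover have cm: "Polynomial.coeff f m = 1" using m by (simp add: f_def coeff_1)
  ultimately have "Polynomial.degree f = m" by (metis antisym le_degree one_neq_zero)
  then have "Polynomial.lead_coeff f = 1" using cm by simp
  then obtain A where A: "\<And>z. z \<in># A \<Longrightarrow> poly f z = 0" "\<And>y. poly f y = (\<Prod>z\<in>#A. y - z)"
    by (rule alg_closed_split) (rule that)
  have root: "z ^ m = 1" if "z \<in># A" for z using A(1)[OF that] pf[of z] by simp
  have "(\<Prod>z\<in>#A. x - z) \<in> nonunits" using x(2) A(2)[of x] pf[of x] by simp
  moreover have "x - z \<in> V" if "z \<in># A" for z using root_of_unity_V(1)[OF root[OF that] m] x(1) by blast
  ultimately obtain z where "z \<in># A" "x - z \<in> nonunits" using nonunits_prod_mset[of "\<lambda>z. x - z" A] by blast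
  then show thesis using that root by blast
qed

lemma frobenius_add:
  assumes "a \<in> V" "b \<in> V"
  shows "(a + b) ^ p - (a ^ p + b ^ p) \<in> nonunits"
proof -
  have split: "{..p} = insert 0 (insert p {1..<p})" using p_gt_1 by auto
  have "(a + b) ^ p = (\<Sum>k\<le>p. of_nat (p choose k) * a ^ k * b ^ (p - k))" by (rule binomial_ring)
  also have "\<dots> = a ^ p + b ^ p + (\<Sum>k\<in>{1..<p}. of_nat (p choose k) * a ^ k * b ^ (p - k))"
    unfolding split using p_gt_1 by (simp add: algebra_simps)
  finally have eq: "(a + b) ^ p - (a ^ p + b ^ p) = (\<Sum>k\<in>{1..<p}. of_nat (p choose k) * a ^ k * b ^ (p - k))" by simp
  show ?thesis unfolding eq
  proof (intro nonunits_sum nonunits_mult' power assms)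
    fix k assume "k \<in> {1..<p}"
    hence "p dvd (p choose k)" using prime by (intro dvd_choose_prime) auto
    then obtain c where "p choose k = p * c" by blast
    then show "of_nat (p choose k) \<in> nonunits" by (simp add: nonunits_mult' p_nonunits)
  qed
qed

lemma frobenius_pow_add:
  assumes "a \<in> V" "b \<in> V"
  shows "(a + b) ^ (p ^ k) - (a ^ (p ^ k) + b ^ (p ^ k)) \<in> nonunits"
proof (induction k)
  case (Suc k)
  define A B C where "A = a ^ (p ^ k)" and "B = b ^ (p ^ k)" and "C = (a + b) ^ (p ^ k)"
  have "A \<in> V" "B \<in> V" "C \<in> V" using assms by (auto simp: A_def B_def C_def)
  have "C ^ p - (A + B) ^ p \<in> nonunits" using Suc \<open>A \<in> V\<close> \<open>B \<in> V\<close> \<open>C \<in> V\<close>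
    by (intro nonunits_cong_power) (auto simp: A_def B_def C_def)
  from nonunits_cong_trans[OF this frobenius_add[OF \<open>A \<in> V\<close> \<open>B \<in> V\<close>]]
  show ?case by (simp add: A_def B_def C_def power_mult[symmetric] mult.commute)
qed simp

text \<open>Frobenius is additive modulo nonunits, and a p-th power is a nonunit only if its base
  is.\<close>

lemma frobenius_inj:
  assumes "a \<in> V" "b \<in> V" "a ^ p - b ^ p \<in> nonunits" shows "a - b \<in> nonunits"
proof -
  have "((a - b) + b) ^ p - ((a - b) ^ p + b ^ p) \<in> nonunits" using assms by (intro frobenius_add) auto
  hence "a ^ p - (a - b) ^ p - b ^ p \<in> nonunits" by (simp add: algebra_simps)
  from nonunits_diff[OF assms(3) this] have "(a - b) ^ p \<in> nonunits" by (simp add: algebra_simps)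
  then show ?thesis using assms nonunits_power by blast
qed

text \<open>Pigeonhole gives a common exponent, whose \<open>p\<close>-part is removed by injectivity of Frobenius.\<close>

lemma residues_exponent:
  assumes R: "residues E R" and E: "subfield_of E"
  obtains m where "m > 0" "\<not> p dvd m"
    "\<And>x. x \<in> E \<Longrightarrow> x \<in> V \<Longrightarrow> x \<notin> nonunits \<Longrightarrow> x ^ m - 1 \<in> nonunits"
proof -
  interpret E: subfield_of E by fact
  have Rfin: "finite R" and R: "\<And>x. x \<in> E \<Longrightarrow> x \<in> V \<Longrightarrow> \<exists>r\<in>R. x - r \<in> nonunits"
    using R by (auto simp: residues_def)
  have pow: "\<exists>n. 0 < n \<and> n \<le> card R \<and> x ^ n - 1 \<in> nonunits" if x: "x \<in> E" "x \<in> V" "x \<notin> nonunits" for x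
  proof -
    have "\<forall>i. \<exists>r\<in>R. x ^ i - r \<in> nonunits" using R x by blast
    then obtain \<rho> where \<rho>: "\<And>i. \<rho> i \<in> R" "\<And>i::nat. x ^ i - \<rho> i \<in> nonunits" by metis
    have "card (\<rho> ` {..card R}) \<le> card R" using \<rho>(1) Rfin by (intro card_mono) auto
    hence "\<not> inj_on \<rho> {..card R}" by (intro pigeonhole) auto
    then obtain i j where ij: "i < j" "j \<le> card R" "\<rho> i = \<rho> j"
      unfolding inj_on_def by (metis atMost_iff linorder_neqE_nat)
    have "x ^ j - x ^ i \<in> nonunits"
      using nonunits_cong_trans[OF \<rho>(2)[of j], of "x ^ i"] nonunits_cong_sym[OF \<rho>(2)[of i]] ij(3) by simp
    moreover have "x ^ j - x ^ i = x ^ i * (x ^ (j - i) - 1)"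
      using ij(1) by (simp add: right_diff_distrib power_add[symmetric])
    ultimately have "x ^ i * (x ^ (j - i) - 1) \<in> nonunits" by simp
    moreover have "x ^ i \<notin> nonunits" using nonunits_power x by blast
    ultimately have "x ^ (j - i) - 1 \<in> nonunits" using nonunits_prime x by blast
    then show ?thesis using ij by (intro exI[of _ "j - i"]) auto
  qed
  have "R \<noteq> {}" using R[of 1] by auto
  hence "card R > 0" using Rfin by (simp add: card_gt_0_iff)
  \<comment> \<open>The factorial is a common multiple of all the exponents. Only its part prime to
    p is kept, since distinct roots of unity of this order must later be incongruent.\<close>
  have "(fact (card R) :: nat) \<noteq> 0" "\<not> p dvd 1" using p_gt_1 by auto
  then obtain a m where am: "(fact (card R) :: nat) = p ^ a * m" "\<not> p dvd m"
    using multiplicity_decompose'[of "fact (card R) :: nat" p] p_gt_1 by (metis nat_dvd_1_iff_1)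
  have desc: "x ^ m - 1 \<in> nonunits" if "x \<in> V" "x ^ (p ^ a * m) - 1 \<in> nonunits" for x a
    using that(2)
  proof (induction a)
    case (Suc a)
    have "(x ^ (p ^ a * m)) ^ p - 1 ^ p \<in> nonunits" using Suc.prems by (simp add: power_mult[symmetric] mult_ac)
    hence "x ^ (p ^ a * m) - 1 \<in> nonunits" by (rule frobenius_inj[rotated 2]) (use that(1) in auto)
    then show ?case by (rule Suc.IH)
  qed simp
  show thesis
  proof (rule that)
    show "m > 0" using am(2) by (cases m) auto
    show "\<not> p dvd m" by (rule am(2))
    fix x assume x: "x \<in> E" "x \<in> V" "x \<notin> nonunits"
    obtain n where n: "0 < n" "n \<le> card R" "x ^ n - 1 \<in> nonunits" using pow[OF x] by blast
    obtain l where l: "fact (card R) = n * l" using n(1,2) by (metis dvd_def dvd_fact Suc_leI One_nat_def)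
    have "(x ^ n) ^ l - 1 ^ l \<in> nonunits" using n(3) x by (intro nonunits_cong_power) auto
    hence "x ^ (p ^ a * m) - 1 \<in> nonunits" using l am(1) by (simp add: power_mult)
    then show "x ^ m - 1 \<in> nonunits" using desc x by blast
  qed
qed

section \<open>Uniformisers and Teichmueller representatives of tame extensions\<close>

lemma Gal_stable:
  assumes "E0 \<subseteq> E" "\<tau> \<in> carrier (abs_Gal E)"
  shows "\<tau> x \<in> V \<longleftrightarrow> x \<in> V" and "\<tau> x \<in> nonunits \<longleftrightarrow> x \<in> nonunits"
proof -
  have t: "\<tau> \<in> carrier (abs_Gal E0)" using assms abs_Gal_mono by blast
  interpret field_auto \<tau> using t by (rule abs_Gal_auto)
  have V: "\<tau> x \<in> V \<longleftrightarrow> x \<in> V" for x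
    using stable[OF t] stable[OF abs_Gal_inv[OF t], of "\<tau> x"] abs_Gal_inv_apply(2)[OF t] by auto
  show "\<tau> x \<in> V \<longleftrightarrow> x \<in> V" by (rule V)
  show "\<tau> x \<in> nonunits \<longleftrightarrow> x \<in> nonunits"
    using V[of x] V[of "inverse x"] by (auto simp: nonunits_def)
qed

lemma alg_E: "E0 \<subseteq> E \<Longrightarrow> alg_over E x"
  using alg_over_mono alg by blast

lemma fixed_in:
  assumes "subfield_of E" "E0 \<subseteq> E" "\<And>\<tau>. \<tau> \<in> carrier (abs_Gal E) \<Longrightarrow> \<tau> x = x" shows "x \<in> E"
  by (rule abs_Gal_fixed[OF assms(1)]) (rule alg_E[OF assms(2)], rule assms(3))

text \<open>
  Instead of using completeness of \<open>F\<close>, the Teichmueller representatives and the \<open>e\<close>-th root of a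
  principal unit are found in the algebraic closure. They are unique, hence fixed by the Galois
  group of \<open>F\<close>, hence in \<open>F\<close>.
\<close>

lemma tame_structure:
  assumes F: "subfield_of F" "E0 \<subseteq> F" and w: "unif F w" and R: "residues F R"
    and u: "u \<in> F" "u / w ^ e \<in> V" "u / w ^ e \<notin> nonunits" and e: "\<not> p dvd e" and r: "r ^ e = u"
  obtains w' m where "unif F w'" "m > 0" "\<not> p dvd m" "(w' / r) ^ m = 1"
    "\<And>x. x \<in> F \<Longrightarrow> x \<in> V \<Longrightarrow> x \<notin> nonunits \<Longrightarrow> \<exists>z\<in>F. z ^ m = 1 \<and> x - z \<in> nonunits"
proof -
  interpret F: subfield_of F by fact
  have wF: "w \<in> F" "w \<noteq> 0" "w \<in> nonunits" using w by (auto simp: unif_def)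
  have "e > 0" using e by (cases e) auto
  have "u \<noteq> 0" using u(3) by auto
  hence "r \<noteq> 0" using r \<open>e > 0\<close> by (auto simp: power_0_left)
  obtain m where m: "m > 0" "\<not> p dvd m"
    "\<And>x. x \<in> F \<Longrightarrow> x \<in> V \<Longrightarrow> x \<notin> nonunits \<Longrightarrow> x ^ m - 1 \<in> nonunits"
    by (rule residues_exponent[OF R F(1)]) (rule that)
  have unique: "z \<in> F" if z: "z ^ n = 1" "\<not> p dvd n" "x - z \<in> nonunits" "x \<in> F" for x z n
  proof (rule fixed_in[OF F])
    fix \<tau> assume t: "\<tau> \<in> carrier (abs_Gal F)"
    interpret field_auto \<tau> using t by (rule abs_Gal_auto)
    have "\<tau> (x - z) \<in> nonunits" using Gal_stable(2)[OF F(2) t] z(3) by blast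
    hence "x - \<tau> z \<in> nonunits" using abs_Gal_fix[OF t z(4)] by simp
    hence "\<tau> z - z \<in> nonunits" using nonunits_diff[OF z(3)] by force
    moreover have "\<tau> z ^ n = 1" using z(1) one power by metis
    ultimately show "\<tau> z = z" using roots_of_unity_eq z(1,2) by blast
  qed
  have teich: "\<exists>z\<in>F. z ^ m = 1 \<and> x - z \<in> nonunits" if x: "x \<in> F" "x \<in> V" "x \<notin> nonunits" for x
  proof -
    obtain z where "z ^ m = 1" "x - z \<in> nonunits" using near_root_of_unity[OF x(2) m(3)[OF x] m(1)] by blast
    then show ?thesis using unique m(2) x(1) by blast
  qed
  \<comment> \<open>The unit w^e / u is a root of unity \<xi> times a principal unit. Dividing w by
    the e-th root y of the principal unit gives w'^e = u \<xi>, so that w' / r is a root of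
    unity.\<close>
  define g where "g = w ^ e / u"
  have g: "g \<in> F" "g \<in> V" "g \<notin> nonunits"
    using wF u unit_inverse[OF u(2,3)] unit_inverse_unit[OF u(2,3)] by (auto simp: g_def)
  obtain \<xi> where \<xi>: "\<xi> \<in> F" "\<xi> ^ m = 1" "g - \<xi> \<in> nonunits" using teich[OF g] by blast
  have \<xi>V: "\<xi> \<in> V" "\<xi> \<notin> nonunits" using root_of_unity_V[OF \<xi>(2) m(1)] by auto
  have \<xi>0: "\<xi> \<noteq> 0" using \<xi>V by auto
  obtain y0 where y0: "y0 ^ e = g / \<xi>" using nth_root_exists[OF \<open>e > 0\<close>] by blast
  have g1: "g / \<xi> - 1 \<in> nonunits"
  proof -
    have "g / \<xi> - 1 = (g - \<xi>) * inverse \<xi>" using \<xi>0 by (simp add: field_simps)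
    then show ?thesis using \<xi>(3) unit_inverse[OF \<xi>V] by (simp add: nonunits_mult')
  qed
  have gV: "g / \<xi> \<in> V" "g / \<xi> \<notin> nonunits"
    using unit_divide[OF g(2) \<xi>V] unit_mult[OF g(2) unit_inverse[OF \<xi>V] g(3) unit_inverse_unit[OF \<xi>V]]
    by (auto simp: divide_inverse)
  have "y0 \<in> V"
  proof (rule ccontr)
    assume "y0 \<notin> V"
    hence "inverse y0 \<in> nonunits" using val[of y0] nonunits_iff[of "inverse y0"] by (cases "y0 = 0") auto
    hence "inverse (g / \<xi>) \<in> nonunits" using power_nonunits[OF _ \<open>e > 0\<close>] y0 by (metis power_inverse)
    then show False using unit_inverse_unit[OF gV] by blast
  qed
  obtain z where z: "z ^ e = 1" "y0 - z \<in> nonunits"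
    using near_root_of_unity[OF \<open>y0 \<in> V\<close> _ \<open>e > 0\<close>] g1 y0 by auto
  have zV: "z \<in> V" "z \<notin> nonunits" "z \<noteq> 0" using root_of_unity_V[OF z(1) \<open>e > 0\<close>] by auto
  define y where "y = y0 / z"
  have ye: "y ^ e = g / \<xi>" using y0 z(1) by (simp add: y_def power_divide)
  have y1: "y - 1 \<in> nonunits"
  proof -
    have "y - 1 = (y0 - z) * inverse z" using zV(3) by (simp add: y_def field_simps)
    then show ?thesis using z(2) unit_inverse[OF zV(1,2)] by (simp add: nonunits_mult')
  qed
  have yV: "y \<in> V" "y \<notin> nonunits"
    using unit_divide[OF \<open>y0 \<in> V\<close> zV(1,2)] unit_add_nonunit[of 1 "y - 1"] y1 by (auto simp: y_def)
  have y0': "y \<noteq> 0" using yV by auto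
  have yF: "y \<in> F"
  proof (rule fixed_in[OF F])
    fix \<tau> assume t: "\<tau> \<in> carrier (abs_Gal F)"
    interpret field_auto \<tau> using t by (rule abs_Gal_auto)
    have "\<tau> (y - 1) \<in> nonunits" using Gal_stable(2)[OF F(2) t] y1 by blast
    hence "\<tau> y - y \<in> nonunits" using nonunits_diff[OF _ y1, of "\<tau> (y - 1)"] by simp
    hence "(\<tau> y - y) * inverse y \<in> nonunits" using unit_inverse[OF yV] by (rule nonunits_mult')
    moreover have "(\<tau> y - y) * inverse y = \<tau> y / y - 1" using y0' by (simp add: field_simps)
    moreover have "\<tau> y ^ e = y ^ e"
      using abs_Gal_fix[OF t, of "g / \<xi>"] g(1) \<xi>(1) ye by (metis F.divide power)
    hence "(\<tau> y / y) ^ e = 1" using y0' by (simp add: power_divide)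
    ultimately have "\<tau> y / y = 1" using root_of_unity_eq_1 e by metis
    then show "\<tau> y = y" using y0' by simp
  qed
  define w' where "w' = w / y"
  have "unif F w'"
    unfolding unif_def
  proof (intro conjI ballI impI)
    show "w' \<in> F" "w' \<noteq> 0" using wF yF y0' by (auto simp: w'_def)
    show "w' \<in> nonunits" using wF(3) unit_inverse[OF yV] by (simp add: w'_def divide_inverse nonunits_mult')
    fix x assume "x \<in> F" "x \<in> nonunits"
    hence "x / w * y \<in> V" using w yV by (intro mult) (auto simp: unif_def)
    then show "x / w' \<in> V" by (simp add: w'_def)
  qed
  moreover have "w' ^ e = u * \<xi>"
    using wF \<open>u \<noteq> 0\<close> \<xi>0 ye by (simp add: w'_def power_divide g_def)
  hence "(w' / r) ^ e = \<xi>" using r \<open>u \<noteq> 0\<close> by (simp add: power_divide)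
  hence "(w' / r) ^ (e * m) = 1" using \<xi>(2) by (simp add: power_mult)
  moreover have "\<not> p dvd e * m" using e m(2) prime by (simp add: prime_dvd_mult_iff)
  moreover have "e * m > 0" using \<open>e > 0\<close> m(1) by simp
  moreover have "\<exists>z\<in>F. z ^ (e * m) = 1 \<and> x - z \<in> nonunits" if "x \<in> F" "x \<in> V" "x \<notin> nonunits" for x
    using teich[OF that] by (metis mult.commute power_mult power_one)
  ultimately show thesis using that[of w' "e * m"] by blast
qed

text \<open>The expansion of x in digits, without limits: subtracting a fixed digit and dividing by
  the fixed element w, again and again, shows that \<tau> x - x is divisible by every power of w,
  hence zero by \<open>separated\<close>.\<close>

lemma fixes_field:
  assumes F: "subfield_of F" and \<tau>: "\<tau> \<in> carrier (abs_Gal E0)" and w: "unif F w" "\<tau> w = w"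
    and teich: "\<And>x. x \<in> F \<Longrightarrow> x \<in> V \<Longrightarrow> x \<notin> nonunits \<Longrightarrow> \<exists>z\<in>F. \<tau> z = z \<and> x - z \<in> nonunits"
    and x: "x \<in> F"
  shows "\<tau> x = x"
proof -
  interpret F: subfield_of F by fact
  interpret t: field_auto \<tau> using \<tau> by (rule abs_Gal_auto)
  have wF: "w \<in> F" "w \<noteq> 0" "w \<in> nonunits" using w by (auto simp: unif_def)
  have *: "\<tau> x = x" if x: "x \<in> F" "x \<in> V" for x
  proof -
    have step: "\<exists>x'. x' \<in> F \<and> x' \<in> V \<and> \<tau> x - x = w ^ k * (\<tau> x' - x')" for k
    proof (induction k)
      case (Suc k)
      then obtain x' where x': "x' \<in> F" "x' \<in> V" "\<tau> x - x = w ^ k * (\<tau> x' - x')" by blast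
      \<comment> \<open>The digit of a nonunit is 0.\<close>
      obtain z where z: "z \<in> F" "\<tau> z = z" "x' - z \<in> nonunits"
        using teich[OF x'(1,2)] by (cases "x' \<in> nonunits") (auto intro: that[of 0])
      define x'' where "x'' = (x' - z) / w"
      have "x'' \<in> F" "x'' \<in> V" using w(1) z x' by (auto simp: x''_def unif_def)
      moreover have "\<tau> x' - x' = w * (\<tau> x'' - x'')" using wF w(2) z(2) by (simp add: x''_def field_simps)
      ultimately show ?case using x'(3) by (intro exI[of _ x'']) simp
    qed (use x in auto)
    have div: "(\<tau> x - x) / w ^ k \<in> V" for k
    proof -
      obtain x' where "x' \<in> V" "\<tau> x - x = w ^ k * (\<tau> x' - x')" using step by blast
      then show ?thesis using wF stable[OF \<tau>] by auto
    qed
    obtain r where r: "w ^ r / of_nat p \<in> V" using arch[OF wF(2)] wF nonunits_iff by blast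
    have "\<tau> x - x = 0"
    proof (rule separated)
      fix j
      have "((\<tau> x - x) / w ^ (r * j)) * (w ^ r / of_nat p) ^ j \<in> V" using div r by (intro mult power)
      then show "(\<tau> x - x) / of_nat p ^ j \<in> V" using wF by (simp add: power_mult power_divide)
    qed
    then show ?thesis by simp
  qed
  show ?thesis
  proof (cases "x \<in> V")
    case False
    hence "\<tau> (inverse x) = inverse x" using val[of x] x by (intro *) auto
    then show ?thesis by simp
  qed (use * x in auto)
qed

end

section \<open>Residue fields and ramification indices\<close>

lemma (in valuation_subring) max_ideal_eq:
  assumes "subfield_of E" shows "max_ideal (V \<inter> E) = nonunits \<inter> E"
proof -
  interpret E: subfield_of E by fact
  show ?thesis by (auto simp: max_ideal_def nonunits_def)
qed

text \<open>Lagrange's bound modulo the maximal ideal: each element of \<open>B\<close> is congruent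
  to some exact root of f, and incongruent elements go to different roots.\<close>

lemma (in valuation_subring) incongruent_roots_le_degree:
  fixes f :: "'k poly"
  assumes split: "\<And>y. poly f y = (\<Prod>z\<in>#A. y - z)" "\<And>z. z \<in># A \<Longrightarrow> z \<in> V"
    and B: "B \<subseteq> V" "\<And>b. b \<in> B \<Longrightarrow> poly f b \<in> nonunits"
      "\<And>a b. a \<in> B \<Longrightarrow> b \<in> B \<Longrightarrow> a - b \<in> nonunits \<Longrightarrow> a = b"
  shows "card B \<le> size A"
proof -
  have "\<exists>z\<in>#A. b - z \<in> nonunits" if b: "b \<in> B" for b
  proof (rule nonunits_prod_mset)
    show "(\<Prod>z\<in>#A. b - z) \<in> nonunits" using B(2)[OF b] split(1) by simp
    show "b - z \<in> V" if "z \<in># A" for z using split(2)[OF that] B(1) b by blast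
  qed
  then obtain \<rho> where \<rho>: "\<And>b. b \<in> B \<Longrightarrow> \<rho> b \<in># A" "\<And>b. b \<in> B \<Longrightarrow> b - \<rho> b \<in> nonunits" by metis
  have "inj_on \<rho> B"
  proof
    fix a b assume ab: "a \<in> B" "b \<in> B" "\<rho> a = \<rho> b"
    have "a - b \<in> nonunits" using nonunits_diff[OF \<rho>(2)[OF ab(1)] \<rho>(2)[OF ab(2)]] ab(3) by simp
    then show "a = b" using B(3) ab by blast
  qed
  hence "card B \<le> card (set_mset A)" using \<rho>(1) by (intro card_inj_on_le[where f = \<rho>]) auto
  also have "\<dots> \<le> size A"
    unfolding size_multiset_overloaded_eq card_eq_sum by (intro sum_mono) (auto simp: Suc_le_eq)
  finally show ?thesis .
qed

context stable_valuation
begin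

definition residue_class :: "'k set \<Rightarrow> 'k \<Rightarrow> 'k set" where
  "residue_class E x = {y \<in> V \<inter> E. x - y \<in> nonunits}"

context
  fixes E :: "'k set"
  assumes E: "subfield_of E"
begin

interpretation E: subfield_of E by (rule E)

lemma residue_class_eq_iff:
  assumes "x \<in> V \<inter> E" "y \<in> V \<inter> E"
  shows "residue_class E x = residue_class E y \<longleftrightarrow> x - y \<in> nonunits"
proof
  assume "residue_class E x = residue_class E y"
  moreover have "y \<in> residue_class E y" using assms by (simp add: residue_class_def)
  ultimately have "y \<in> residue_class E x" by simp
  then show "x - y \<in> nonunits" by (simp add: residue_class_def)
next
  assume *: "x - y \<in> nonunits"
  have "x - z \<in> nonunits \<longleftrightarrow> y - z \<in> nonunits" for z
    using nonunits_cong_trans[OF *] nonunits_cong_trans[OF nonunits_cong_sym[OF *]] by blast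
  then show "residue_class E x = residue_class E y" by (auto simp: residue_class_def)
qed

lemma residue_field_eq: "residue_field (V \<inter> E) = residue_class E ` (V \<inter> E)"
  unfolding residue_field_def quotient_def max_ideal_eq[OF E]
  by (auto simp: residue_class_def Image_def)

lemma finite_residue_field:
  assumes "residues E R" shows "finite (residue_field (V \<inter> E))"
proof -
  have R: "finite R" "\<And>x. x \<in> V \<inter> E \<Longrightarrow> \<exists>r\<in>R. x - r \<in> nonunits" using assms by (auto simp: residues_def)
  have "residue_field (V \<inter> E) \<subseteq> (\<lambda>r. {y \<in> V \<inter> E. r - y \<in> nonunits}) ` R"
  proof
    fix c assume "c \<in> residue_field (V \<inter> E)"
    then obtain x where x: "x \<in> V \<inter> E" "c = residue_class E x" by (auto simp: residue_field_eq)
    obtain r where r: "r \<in> R" "x - r \<in> nonunits" using R x by blast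
    have "x - z \<in> nonunits \<longleftrightarrow> r - z \<in> nonunits" for z
      using nonunits_cong_trans[OF r(2)] nonunits_cong_trans[OF nonunits_cong_sym[OF r(2)]] by blast
    then show "c \<in> (\<lambda>r. {y \<in> V \<inter> E. r - y \<in> nonunits}) ` R"
      using x r(1) by (auto simp: residue_class_def)
  qed
  then show ?thesis using R(1) finite_subset by blast
qed

definition representative :: "'k set \<Rightarrow> 'k" where
  "representative c = (SOME x. x \<in> V \<inter> E \<and> c = residue_class E x)"

lemma representative:
  assumes "c \<in> residue_field (V \<inter> E)"
  shows "representative c \<in> V" "representative c \<in> E" "residue_class E (representative c) = c"
proof -
  have "\<exists>x. x \<in> V \<inter> E \<and> c = residue_class E x" using assms by (auto simp: residue_field_eq)
  from someI_ex[OF this] show "representative c \<in> V" "representative c \<in> E" "residue_class E (representative c) = c"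
    by (auto simp: representative_def)
qed

lemma representative_class:
  assumes "x \<in> V \<inter> E" shows "x - representative (residue_class E x) \<in> nonunits"
proof -
  have "residue_class E x \<in> residue_field (V \<inter> E)" using assms by (simp add: residue_field_eq)
  from representative[OF this] show ?thesis
    using residue_class_eq_iff[OF assms] by (metis IntI)
qed

text \<open>The residue field is presented as two groups whose operations go through chosen
  representatives, so that Sylow's and Lagrange's theorems for group records apply.\<close>

definition residue_add_group :: "'k set monoid" where
  "residue_add_group = \<lparr>carrier = residue_field (V \<inter> E),
     monoid.mult = (\<lambda>a b. residue_class E (representative a + representative b)), one = residue_class E 0\<rparr>"

definition residue_mult_group :: "'k set monoid" where
  "residue_mult_group = \<lparr>carrier = residue_class E ` {x \<in> V \<inter> E. x \<notin> nonunits},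
     monoid.mult = (\<lambda>a b. residue_class E (representative a * representative b)), one = residue_class E 1\<rparr>"

lemma residue_class_add:
  assumes "x \<in> V \<inter> E" "y \<in> V \<inter> E"
  shows "residue_class E (representative (residue_class E x) + representative (residue_class E y)) = residue_class E (x + y)"
proof -
  have c: "residue_class E x \<in> residue_field (V \<inter> E)" "residue_class E y \<in> residue_field (V \<inter> E)"
    using assms by (auto simp: residue_field_eq)
  have "x + y - (representative (residue_class E x) + representative (residue_class E y)) \<in> nonunits"
    using nonunits_add[OF representative_class[OF assms(1)] representative_class[OF assms(2)]] by (simp add: algebra_simps)
  then show ?thesis
    using assms representative[OF c(1)] representative[OF c(2)] by (subst eq_commute, subst residue_class_eq_iff) auto
qed

lemma residue_class_mult:
  assumes "x \<in> V \<inter> E" "y \<in> V \<inter> E"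
  shows "residue_class E (representative (residue_class E x) * representative (residue_class E y)) = residue_class E (x * y)"
proof -
  have c: "residue_class E x \<in> residue_field (V \<inter> E)" "residue_class E y \<in> residue_field (V \<inter> E)"
    using assms by (auto simp: residue_field_eq)
  have "x * y - representative (residue_class E x) * representative (residue_class E y) \<in> nonunits"
    using assms representative[OF c(1)] by (intro nonunits_cong_mult representative_class) auto
  then show ?thesis
    using assms representative[OF c(1)] representative[OF c(2)] by (subst eq_commute, subst residue_class_eq_iff) auto
qed

lemma residue_add_group: "group residue_add_group"
proof (rule groupI)
  fix a assume "a \<in> carrier residue_add_group"
  then obtain x where x: "x \<in> V \<inter> E" "a = residue_class E x" by (auto simp: residue_add_group_def residue_field_eq)
  have "- x \<in> V \<inter> E" using x by auto
  then show "\<exists>b\<in>carrier residue_add_group. b \<otimes>\<^bsub>residue_add_group\<^esub> a = \<one>\<^bsub>residue_add_group\<^esub>"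
    using x residue_class_add[of "- x" x] by (intro bexI[of _ "residue_class E (- x)"]) (auto simp: residue_add_group_def residue_field_eq)
qed (auto simp: residue_add_group_def residue_field_eq residue_class_add E.add add residue_class_mult add.assoc)

lemma residue_mult_group: "group residue_mult_group"
proof (rule groupI)
  fix a assume "a \<in> carrier residue_mult_group"
  then obtain x where x: "x \<in> V \<inter> E" "x \<notin> nonunits" "a = residue_class E x" by (auto simp: residue_mult_group_def)
  have i: "inverse x \<in> V \<inter> E" "inverse x \<notin> nonunits" using x unit_inverse unit_inverse_unit by auto
  have "x \<noteq> 0" using x by auto
  then show "\<exists>b\<in>carrier residue_mult_group. b \<otimes>\<^bsub>residue_mult_group\<^esub> a = \<one>\<^bsub>residue_mult_group\<^esub>"
    using x i residue_class_mult[of "inverse x" x] by (intro bexI[of _ "residue_class E (inverse x)"]) (auto simp: residue_mult_group_def)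
next
  fix a b assume "a \<in> carrier residue_mult_group" "b \<in> carrier residue_mult_group"
  then obtain x y where "x \<in> V \<inter> E" "x \<notin> nonunits" "a = residue_class E x"
    "y \<in> V \<inter> E" "y \<notin> nonunits" "b = residue_class E y" by (auto simp: residue_mult_group_def)
  moreover from this have "x * y \<in> V \<inter> E" "x * y \<notin> nonunits" using unit_mult by auto
  ultimately show "a \<otimes>\<^bsub>residue_mult_group\<^esub> b \<in> carrier residue_mult_group"
    by (auto simp: residue_mult_group_def residue_class_mult)
qed (auto simp: residue_mult_group_def residue_class_mult E.mult mult mult.assoc)

lemma residue_add_pow:
  assumes "x \<in> V \<inter> E"
  shows "residue_class E x [^]\<^bsub>residue_add_group\<^esub> n = residue_class E (of_nat n * x)"
proof (induction n)
  case (Suc n)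
  have "of_nat n * x \<in> V \<inter> E" using assms by auto
  then show ?case using Suc assms residue_class_add[of "of_nat n * x" x]
    by (simp add: residue_add_group_def nat_pow_def algebra_simps)
qed (simp add: residue_add_group_def nat_pow_def)

lemma residue_mult_pow:
  assumes "x \<in> V \<inter> E"
  shows "residue_class E x [^]\<^bsub>residue_mult_group\<^esub> n = residue_class E (x ^ n)"
proof (induction n)
  case (Suc n)
  have "x ^ n \<in> V \<inter> E" using assms by auto
  then show ?case using Suc assms residue_class_mult[of "x ^ n" x]
    by (simp add: residue_mult_group_def nat_pow_def mult.commute)
qed (simp add: residue_mult_group_def nat_pow_def)

lemma residue_card:
  assumes R: "residues E R" and q: "q = card (residue_field (V \<inter> E))"
  shows residue_card_power: "\<exists>k>0. q = p ^ k"
    and residue_fermat: "\<And>x. x \<in> V \<Longrightarrow> x \<in> E \<Longrightarrow> x ^ q - x \<in> nonunits"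
proof -
  interpret A: group residue_add_group by (rule residue_add_group)
  interpret M: group residue_mult_group by (rule residue_mult_group)
  have fin: "finite (residue_field (V \<inter> E))" by (rule finite_residue_field[OF R])
  have orderA: "Coset.order residue_add_group = q" by (simp add: Coset.order_def residue_add_group_def q)
  have carrM: "carrier residue_mult_group = residue_field (V \<inter> E) - {residue_class E 0}"
    using residue_class_eq_iff[of _ 0] by (auto simp: residue_mult_group_def residue_field_eq)
  have r0: "residue_class E 0 \<in> residue_field (V \<inter> E)" by (simp add: residue_field_eq)
  have orderM: "Coset.order residue_mult_group = q - 1" unfolding Coset.order_def carrM q using r0 fin by simp
  have q0: "q > 0" using r0 fin by (auto simp: q card_gt_0_iff)
  have A1: "residue_class E 1 \<in> carrier residue_add_group" by (simp add: residue_add_group_def residue_field_eq)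
  \<comment> \<open>The order of the additive group annihilates the class of 1, so q is a nonunit
    and p divides it.\<close>
  have "residue_class E 1 [^]\<^bsub>residue_add_group\<^esub> q = residue_class E 0"
    using A.pow_order_eq_1[OF A1] orderA by (simp add: residue_add_group_def)
  hence "of_nat q \<in> nonunits" using residue_add_pow[of 1 q] residue_class_eq_iff[of "of_nat q" 0] by simp
  hence "p dvd q" using coprime_unit by blast
  \<comment> \<open>An element of prime order r in the additive group comes from a unit x with r x a
    nonunit. So r itself is a nonunit, which forces r = p.\<close>
  have "r = p" if r: "Factorial_Ring.prime r" "r dvd q" for r
  proof -
    obtain m where "q = r ^ 1 * m" using r(2) by auto
    then obtain H where H: "subgroup H residue_add_group" "card H = r ^ 1"
      using sylow_thm[OF r(1) A.group_axioms, of 1 m] orderA fin by (auto simp: residue_add_group_def)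
    have "card H > 1" using H(2) r(1) prime_gt_1_nat by simp
    then obtain h where h: "h \<in> H" "h \<noteq> residue_class E 0"
      by (metis One_nat_def card.empty card_insert_disjoint card_mono empty_iff finite.emptyI finite.insertI insertCI not_le subsetI zero_less_one less_numeral_extra(4))
    interpret H: subgroup H residue_add_group by (rule H(1))
    interpret HG: group "residue_add_group\<lparr>carrier := H\<rparr>" using H.subgroup_is_group[OF A.group_axioms] .
    obtain x where x: "x \<in> V \<inter> E" "h = residue_class E x"
      using H.mem_carrier[OF h(1)] by (auto simp: residue_add_group_def residue_field_eq)
    have "h [^]\<^bsub>residue_add_group\<lparr>carrier := H\<rparr>\<^esub> r = \<one>\<^bsub>residue_add_group\<^esub>"
      using HG.pow_order_eq_1[of h] h(1) H(2) by (simp add: Coset.order_def)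
    hence "h [^]\<^bsub>residue_add_group\<^esub> r = residue_class E 0"
      unfolding A.nat_pow_consistent[of h r H, symmetric] by (simp add: residue_add_group_def)
    hence "of_nat r * x \<in> nonunits"
      using residue_add_pow[OF x(1)] x residue_class_eq_iff[of "of_nat r * x" 0] by auto
    moreover have "x \<notin> nonunits" using h(2) x residue_class_eq_iff[of x 0] by auto
    ultimately have "of_nat r \<in> nonunits" using nonunits_prime x(1) by auto
    hence "p dvd r" using coprime_unit by blast
    then show "r = p" using r(1) prime primes_dvd_imp_eq by blast
  qed
  then have "prime_factors q \<subseteq> {p}" by (auto simp: in_prime_factors_iff)
  hence "q = p ^ multiplicity p q"
    using q0 \<open>p dvd q\<close> prime prod_prime_factors[of q] by (cases "prime_factors q = {}") (auto dest: subset_singletonD simp: prime_factors_dvd)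
  moreover have "multiplicity p q > 0" using \<open>p dvd q\<close> q0 prime by (simp add: prime_multiplicity_gt_zero_iff)
  ultimately show "\<exists>k>0. q = p ^ k" by blast
  show "x ^ q - x \<in> nonunits" if x: "x \<in> V" "x \<in> E" for x
  proof (cases "x \<in> nonunits")
    case True
    then show ?thesis using q0 by (intro nonunits_diff power_nonunits)
  next
    case False
    have "residue_class E x \<in> carrier residue_mult_group" using x False by (auto simp: residue_mult_group_def)
    from M.pow_order_eq_1[OF this] have "residue_class E x [^]\<^bsub>residue_mult_group\<^esub> (q - 1) = residue_class E 1"
      using orderM by (simp add: residue_mult_group_def)
    hence "x ^ (q - 1) - 1 \<in> nonunits"
      using residue_mult_pow[of x "q - 1"] residue_class_eq_iff[of "x ^ (q - 1)" 1] x by auto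
    hence "x * (x ^ (q - 1) - 1) \<in> nonunits" using x by (intro nonunits_mult)
    moreover have "x * (x ^ (q - 1) - 1) = x ^ q - x" using q0 by (cases q) (auto simp: algebra_simps)
    ultimately show ?thesis by simp
  qed
qed

text \<open>Otherwise \<open>y\<close> and representatives of the q classes would be q + 1
  incongruent roots of X^q - X modulo the maximal ideal.\<close>

lemma frobenius_fixed_residue:
  assumes R: "residues E R" and q: "q = card (residue_field (V \<inter> E))"
    and y: "y \<in> V" "y ^ q - y \<in> nonunits"
  obtains c where "c \<in> V" "c \<in> E" "y - c \<in> nonunits"
proof (rule ccontr)
  note found = that
  assume no: "\<not> thesis"
  obtain k where k: "k > 0" "q = p ^ k" using residue_card_power[OF R q] by blast
  have q1: "q > 1" using k p_gt_1 by (metis one_less_power)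
  define C where "C = residue_field (V \<inter> E)"
  have Cfin: "finite C" unfolding C_def by (rule finite_residue_field[OF R])
  define B where "B = insert y (representative ` C)"
  have rep: "representative c \<in> V" "representative c \<in> E" if "c \<in> C" for c using representative that by (auto simp: C_def)
  have yC: "y - representative c \<notin> nonunits" if "c \<in> C" for c using no found rep[OF that] by blast
  have inj: "c = d" if "c \<in> C" "d \<in> C" "representative c - representative d \<in> nonunits" for c d
  proof -
    have "residue_class E (representative c) = residue_class E (representative d)"
      using residue_class_eq_iff[of "representative c" "representative d"] rep that by blast
    then show ?thesis using representative(3)[of c] representative(3)[of d] that(1,2) unfolding C_def by metis
  qed
  have "y \<notin> representative ` C" using yC by force
  moreover have "inj_on representative C" using inj by (force intro: inj_onI)
  ultimately have "card B = Suc q" using Cfin by (simp add: B_def card_image q C_def)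
  define f where "f = Polynomial.monom 1 q - (Polynomial.monom 1 1 :: 'k poly)"
  have pf: "poly f y = y ^ q - y" for y by (simp add: f_def poly_monom)
  have "Polynomial.degree f \<le> q" unfolding f_def using q1
    by (intro degree_diff_le) (auto simp: degree_monom_eq)
  moreover have cq: "Polynomial.coeff f q = 1" using q1 by (simp add: f_def)
  ultimately have deg: "Polynomial.degree f = q" by (metis antisym le_degree one_neq_zero)
  have "f \<noteq> 0" using cq by auto
  have lead: "Polynomial.lead_coeff f = 1" using cq deg by simp
  have mon: "monic_over V f" unfolding monic_over_iff using lead by (auto simp: f_def)
  obtain A where A: "size A = q" "f = (\<Prod>x\<in>#A. [:- x, 1:])"
    using alg_closed_imp_factorization[OF \<open>f \<noteq> 0\<close>] lead deg by auto
  have ev: "poly f y = (\<Prod>x\<in>#A. y - x)" for y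
    unfolding A(2) by (induction A) (auto simp: algebra_simps)
  have "z \<in> V" if "z \<in># A" for z
    using that by (intro integrally_closed[OF mon]) (auto simp: ev prod_mset_zero_iff)
  then have "card B \<le> size A"
  proof (rule incongruent_roots_le_degree[OF ev])
    show "B \<subseteq> V" using y rep by (auto simp: B_def)
    show "poly f b \<in> nonunits" if "b \<in> B" for b
      using that y residue_fermat[OF R q] rep by (auto simp: B_def pf)
    show "a = b" if "a \<in> B" "b \<in> B" "a - b \<in> nonunits" for a b
      using that yC inj nonunits_cong_sym[OF that(3)] by (auto simp: B_def)
  qed
  then show False using \<open>card B = Suc q\<close> A(1) by simp
qed

text \<open>
  \<open>\<phi>\<close> induces the \<open>q\<close>-Frobenius on the subring generated by \<open>E\<close> and \<open>z\<close>. The polynomial with roots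
  \<open>z\<^bsup>q\<^sup>i\<^esup>\<close> is therefore defined over \<open>E\<close> modulo the maximal ideal.
\<close>

lemma frobenius_orbit:
  assumes R: "residues E R" and q: "q = card (residue_field (V \<inter> E))" and E0: "E0 \<subseteq> E"
    and \<phi>: "\<phi> \<in> carrier (abs_Gal E)" "\<phi> z = z ^ q" and z: "z ^ N = 1" "\<not> p dvd N"
    and \<omega>: "\<omega> \<in> carrier (abs_Gal E)"
  shows "\<exists>j. \<omega> z = z ^ (q ^ j)"
proof -
  interpret f: field_auto \<phi> using \<phi>(1) by (rule abs_Gal_auto)
  interpret w: field_auto \<omega> using \<omega> by (rule abs_Gal_auto)
  have "N > 0" using z(2) by (cases N) auto
  obtain k where k: "k > 0" "q = p ^ k" using residue_card_power[OF R q] by blast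
  have q0: "q > 0" using k p_gt_1 by simp
  have z0: "z \<in> V" "z \<notin> nonunits" using root_of_unity_V[OF z(1) \<open>N > 0\<close>] by auto
  \<comment> \<open>\<phi> is not known to act as Frobenius on all of \<open>V\<close>, so the
    elements on which it does are collected; they form a ring containing z.\<close>
  define W where "W = {y \<in> V. \<phi> y - y ^ q \<in> nonunits}"
  have Wadd: "x + y \<in> W" if "x \<in> W" "y \<in> W" for x y
  proof -
    have xy: "x \<in> V" "y \<in> V" "\<phi> x - x ^ q \<in> nonunits" "\<phi> y - y ^ q \<in> nonunits" using that by (auto simp: W_def)
    from nonunits_diff[OF nonunits_add[OF xy(3,4)] frobenius_pow_add[OF xy(1,2), of k, folded k(2)]]
    show ?thesis using that by (auto simp: W_def algebra_simps)
  qed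
  interpret W: subring_of W
  proof
    show "0 \<in> W" "1 \<in> W" using q0 by (auto simp: W_def power_0_left)
    show "x + y \<in> W" if "x \<in> W" "y \<in> W" for x y by (rule Wadd[OF that])
    show "x * y \<in> W" if "x \<in> W" "y \<in> W" for x y
    proof -
      have "\<phi> x * \<phi> y - x ^ q * y ^ q \<in> nonunits"
        using that Gal_stable(1)[OF E0 \<phi>(1)] by (intro nonunits_cong_mult) (auto simp: W_def)
      then show ?thesis using that by (auto simp: W_def power_mult_distrib)
    qed
    show "- x \<in> W" if "x \<in> W" for x
    proof -
      have "(x + - x) ^ q - (x ^ q + (- x) ^ q) \<in> nonunits"
        using frobenius_pow_add[of x "- x" k] k(2) that by (auto simp: W_def)
      hence "- (x ^ q + (- x) ^ q) \<in> nonunits" using q0 by (simp add: power_0_left)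
      from nonunits_uminus[OF this] have "x ^ q + (- x) ^ q \<in> nonunits" unfolding minus_minus .
      moreover have "\<phi> x - x ^ q \<in> nonunits" using that by (simp add: W_def)
      ultimately have "- (\<phi> x - x ^ q + (x ^ q + (- x) ^ q)) \<in> nonunits"
        using nonunits_uminus nonunits_add by blast
      then show ?thesis using that by (auto simp: W_def algebra_simps)
    qed
  qed
  have zW: "z \<in> W" using z0 \<phi>(2) by (simp add: W_def)
  \<comment> \<open>The orbit of z under \<phi>, finite because z is a root of unity. Its polynomial
    is fixed by \<phi>, so each coefficient c is congruent to c^q, hence to an element of
    \<open>E\<close>, on which \<omega> acts trivially.\<close>
  define D where "D = range (\<lambda>i. z ^ (q ^ i))"
  have root: "y ^ N = 1" if "y \<in> D" for y
    using that z(1) by (auto simp: D_def) (metis mult.commute power_mult power_one)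
  have "z ^ j = z ^ (j mod N)" for j
    using power_add[of z "N * (j div N)" "j mod N"] z(1) by (simp add: power_mult)
  then have "D \<subseteq> (\<lambda>i. z ^ i) ` {..<N}" using \<open>N > 0\<close> by (force simp: D_def)
  then have Dfin: "finite D" by (rule finite_subset) simp
  have phi_D: "\<phi> ` D \<subseteq> D"
  proof (rule image_subsetI)
    fix y assume "y \<in> D"
    then obtain i where "y = z ^ (q ^ i)" by (auto simp: D_def)
    then have "\<phi> y = z ^ (q ^ Suc i)" using \<phi>(2) by (simp add: power_mult[symmetric])
    then show "\<phi> y \<in> D" unfolding D_def by (rule range_eqI)
  qed
  have injD: "inj_on \<phi> D" by (simp add: inj_on_def)
  have phi_D': "\<phi> ` D = D" by (rule endo_inj_surj[OF Dfin phi_D injD])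
  define g where "g = (\<Prod>y\<in>D. [:- y, 1:])"
  have gW: "g \<in> polys_over W"
    unfolding g_def using zW by (intro W.polys_over_prod W.polys_over_pCons W.uminus) (auto simp: D_def)
  have "map_poly \<phi> g = (\<Prod>y\<in>D. [:- \<phi> y, 1:])"
    unfolding g_def by (simp add: f.map_poly_prod map_poly_pCons)
  also have "\<dots> = (\<Prod>y\<in>\<phi> ` D. [:- y, 1:])" by (simp add: prod.reindex[OF injD])
  finally have phi_g: "\<phi> (Polynomial.coeff g i) = Polynomial.coeff g i" for i
    unfolding phi_D' g_def[symmetric] by (metis coeff_map_poly f.zero)
  have cong: "\<omega> (Polynomial.coeff g i) - Polynomial.coeff g i \<in> nonunits" for i
  proof -
    define c where "c = Polynomial.coeff g i"
    have c: "c \<in> V" "\<phi> c - c ^ q \<in> nonunits" using gW by (auto simp: c_def W_def polys_over_def)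
    have "c ^ q - c \<in> nonunits" using nonunits_cong_sym[OF c(2)] phi_g[of i] by (simp add: c_def)
    then obtain l where l: "l \<in> V" "l \<in> E" "c - l \<in> nonunits" using frobenius_fixed_residue[OF R q c(1)] by blast
    have "\<omega> (c - l) \<in> nonunits" using Gal_stable(2)[OF E0 \<omega>] l(3) by blast
    hence "\<omega> c - l \<in> nonunits" using abs_Gal_fix[OF \<omega> l(2)] by simp
    then show ?thesis using nonunits_cong_trans nonunits_cong_sym[OF l(3)] by (auto simp: c_def)
  qed
  have gz: "poly g z = 0"
  proof -
    have "z \<in> D" unfolding D_def by (rule range_eqI[of _ _ 0]) simp
    then show ?thesis using Dfin by (auto simp: g_def poly_prod)
  qed
  have wz: "\<omega> z \<in> V" using Gal_stable(1)[OF E0 \<omega>] z0 by blast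
  have "\<omega> (poly g z) = poly (map_poly \<omega> g) (\<omega> z)"
    by (simp add: poly_altdef coeff_map_poly degree_map_poly)
  hence "poly (map_poly \<omega> g) (\<omega> z) = 0" using gz by simp
  moreover have "poly (map_poly \<omega> g - g) (\<omega> z) \<in> nonunits"
    unfolding poly_altdef using cong wz by (intro nonunits_sum nonunits_mult' power) (auto simp: coeff_map_poly)
  ultimately have "- poly g (\<omega> z) \<in> nonunits" by simp
  from nonunits_uminus[OF this] have "poly g (\<omega> z) \<in> nonunits" by simp
  hence "(\<Prod>y\<in>D. \<omega> z - y) \<in> nonunits" by (simp add: g_def poly_prod)
  moreover have "y \<in> V" if "y \<in> D" for y using root_of_unity_V[OF root[OF that] \<open>N > 0\<close>] by blast
  ultimately obtain y where y: "y \<in> D" "\<omega> z - y \<in> nonunits"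
    using nonunits_prod[OF Dfin, of "\<lambda>y. \<omega> z - y"] wz by blast
  have "\<omega> z ^ N = 1" using z(1) w.power w.one by metis
  hence "\<omega> z = y" using roots_of_unity_eq root[OF y(1)] z(2) y(2) by blast
  then show ?thesis using y(1) by (auto simp: D_def)
qed

end

section \<open>Ramification indices\<close>

lemma uniformiser_iff_unif:
  assumes "subfield_of E" shows "uniformiser (V \<inter> E) w \<longleftrightarrow> unif E w"
proof -
  interpret E: subfield_of E by fact
  have pE: "of_nat p \<in> nonunits \<inter> E" using p_nonunits by simp
  have p0: "(of_nat p :: 'k) \<noteq> 0" using p_gt_1 by simp
  show ?thesis
  proof
    assume u: "uniformiser (V \<inter> E) w"
    hence eq: "nonunits \<inter> E = {w * y | y. y \<in> V \<inter> E}" and wV: "w \<in> V \<inter> E"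
      by (auto simp: uniformiser_def max_ideal_eq[OF assms])
    have "w * 1 \<in> nonunits \<inter> E" unfolding eq by (auto intro!: exI[of _ 1])
    moreover have "w \<noteq> 0" using pE p0 unfolding eq by auto
    moreover have "x / w \<in> V" if x: "x \<in> E" "x \<in> nonunits" for x
    proof -
      have "x \<in> {w * y | y. y \<in> V \<inter> E}" using x eq by blast
      then show ?thesis using \<open>w \<noteq> 0\<close> by auto
    qed
    ultimately show "unif E w" using wV by (auto simp: unif_def)
  next
    assume w: "unif E w"
    show "uniformiser (V \<inter> E) w"
      unfolding uniformiser_def max_ideal_eq[OF assms]
    proof (intro conjI equalityI subsetI)
      show "w \<in> V \<inter> E" using w nonunits_V by (auto simp: unif_def)
      fix x assume "x \<in> nonunits \<inter> E"
      then have "x / w \<in> V \<inter> E" "x = w * (x / w)" using w by (auto simp: unif_def)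
      then show "x \<in> {w * y | y. y \<in> V \<inter> E}" by blast
    qed (use w in \<open>auto simp: unif_def nonunits_mult'\<close>)
  qed
qed

text \<open>The definite description ranges over all uniformisers, so uniqueness of the exponent is
  required. A change of uniformisers multiplies u / w^e by a unit only, and w^(e' - e) is a unit
  only if e' = e.\<close>

lemma ramification_index_eq:
  assumes L: "subfield_of L" and F: "subfield_of F" "L \<subseteq> F" and u: "unif L u" and w: "unif F w"
    and e: "u / w ^ e \<in> V" "u / w ^ e \<notin> nonunits"
  shows "ramification_index (V \<inter> L) (V \<inter> F) = e"
proof -
  interpret L: subfield_of L by fact
  interpret F: subfield_of F by fact
  have assoc: "x / y \<in> V \<and> x / y \<notin> nonunits" if "unif E x" "unif E y" for E x y
  proof -
    have "x / y \<in> V" "y / x \<in> V" "x \<noteq> 0" "y \<noteq> 0" using that by (auto simp: unif_def)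
    then show ?thesis using nonunits_iff[of "x / y"] by simp
  qed
  have ideal_eq: "{a * y | y. y \<in> V \<inter> F} = {b * y | y. y \<in> V \<inter> F} \<longleftrightarrow> a / b \<in> V \<and> a / b \<notin> nonunits"
    if ab: "a \<in> F" "b \<in> F" "a \<noteq> 0" "b \<noteq> 0" for a b
  proof
    assume eq: "{a * y | y. y \<in> V \<inter> F} = {b * y | y. y \<in> V \<inter> F}"
    have self: "c \<in> {c * y | y. y \<in> V \<inter> F}" for c by (rule CollectI, rule exI[of _ 1]) simp
    have "a \<in> {b * y | y. y \<in> V \<inter> F}" using self[of a] unfolding eq .
    then have "a / b \<in> V" using ab by auto
    moreover have "b \<in> {a * y | y. y \<in> V \<inter> F}" using self[of b] unfolding eq .
    then have "b / a \<in> V" using ab by auto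
    ultimately have "a / b \<in> V" "b / a \<in> V" by simp_all
    then show "a / b \<in> V \<and> a / b \<notin> nonunits" using nonunits_iff[of "a / b"] ab by simp
  next
    assume *: "a / b \<in> V \<and> a / b \<notin> nonunits"
    then have i: "b / a \<in> V" using unit_inverse[of "a / b"] by simp
    have "a * y = b * (a / b * y)" "b * y = a * (b / a * y)" for y using ab by auto
    moreover have "a / b * y \<in> V \<inter> F" "b / a * y \<in> V \<inter> F" if "y \<in> V \<inter> F" for y
      using mult[of "a / b" y] mult[of "b / a" y] F.mult[of "a / b" y] F.mult[of "b / a" y] * i that ab
        F.divide[of a b] F.divide[of b a] by (auto simp del: times_divide_eq_left)
    ultimately show "{a * y | y. y \<in> V \<inter> F} = {b * y | y. y \<in> V \<inter> F}"
      unfolding set_eq_iff mem_Collect_eq by metis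
  qed
  have w0: "w \<in> F" "w \<noteq> 0" "w \<in> nonunits" and u0: "u \<in> F" "u \<noteq> 0" using w u F(2) by (auto simp: unif_def)
  show ?thesis
    unfolding ramification_index_def
  proof (rule the_equality)
    show "\<exists>u w. uniformiser (V \<inter> L) u \<and> uniformiser (V \<inter> F) w \<and>
        {u * y | y. y \<in> V \<inter> F} = {w ^ e * y | y. y \<in> V \<inter> F}"
      using ideal_eq[of u "w ^ e"] e u w w0 u0 uniformiser_iff_unif[OF L] uniformiser_iff_unif[OF F(1)]
      by (intro exI[of _ u] exI[of _ w]) (auto simp: F.power)
  next
    fix e' assume "\<exists>u w. uniformiser (V \<inter> L) u \<and> uniformiser (V \<inter> F) w \<and>
        {u * y | y. y \<in> V \<inter> F} = {w ^ e' * y | y. y \<in> V \<inter> F}"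
    then obtain u' w' where u': "unif L u'" and w': "unif F w'"
      and eq: "{u' * y | y. y \<in> V \<inter> F} = {w' ^ e' * y | y. y \<in> V \<inter> F}"
      using uniformiser_iff_unif[OF L] uniformiser_iff_unif[OF F(1)] by auto
    have w'0: "w' \<in> F" "w' \<noteq> 0" and u'0: "u' \<in> F" "u' \<noteq> 0" using w' u' F(2) by (auto simp: unif_def)
    have e': "u' / w' ^ e' \<in> V" "u' / w' ^ e' \<notin> nonunits"
      using ideal_eq[of u' "w' ^ e'"] eq w'0 u'0 by (auto simp: F.power)
    define c where "c = (u / w ^ e) * inverse (u' / w' ^ e') * (u' / u) * inverse ((w' / w) ^ e')"
    have wp: "(w' / w) ^ e' \<in> V" "(w' / w) ^ e' \<notin> nonunits"
      using assoc[OF w' w] nonunits_power[of "w' / w" e'] by auto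
    have "x1 * x2 * x3 * x4 \<in> V \<and> x1 * x2 * x3 * x4 \<notin> nonunits"
      if "x1 \<in> V" "x1 \<notin> nonunits" "x2 \<in> V" "x2 \<notin> nonunits" "x3 \<in> V" "x3 \<notin> nonunits"
        "x4 \<in> V" "x4 \<notin> nonunits" for x1 x2 x3 x4
      using that by (intro conjI unit_mult mult)
    from this[OF e unit_inverse[OF e'] unit_inverse_unit[OF e'] _ _ unit_inverse[OF wp] unit_inverse_unit[OF wp], of "u' / u"]
    have c: "c \<in> V" "c \<notin> nonunits" unfolding c_def using assoc[OF u' u] by blast+
    have "w powi (int e' - int e) * 1 = c"
      using w0 u0 w'0 u'0 by (simp add: c_def power_int_diff power_divide field_simps)
    hence "w powi (int e' - int e) * 1 \<in> V" "w powi (int e' - int e) * 1 \<notin> nonunits" using c by auto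
    then show "e' = e" using power_int_nonunit[OF w0(3,2), of 1 "int e' - int e"] by simp
  qed
qed

end

section \<open>Generators of the tame Galois group\<close>

text \<open>The powers of \<open>z\<close> are m distinct roots of X^m - 1, which has no more than m
  roots.\<close>

lemma primitive_root_powers:
  fixes z :: "'k::field"
  assumes z: "primitive_root_of_unity m z" and m: "m > 0"
  shows "z ^ m = 1" "\<And>k. z ^ k = 1 \<longleftrightarrow> m dvd k" "\<And>y. y ^ m = 1 \<Longrightarrow> \<exists>i. y = z ^ i"
proof -
  show zm: "z ^ m = 1" using z by (simp add: primitive_root_of_unity_def)
  have z0: "z \<noteq> 0" using zm m by (auto simp: power_0_left)
  have red: "z ^ k = z ^ (k mod m)" for k
    using power_add[of z "m * (k div m)" "k mod m"] zm by (simp add: power_mult)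
  show dvd: "z ^ k = 1 \<longleftrightarrow> m dvd k" for k
  proof
    assume "z ^ k = 1"
    hence "z ^ (k mod m) = 1" using red by simp
    hence "\<not> 0 < k mod m" using z m by (auto simp: primitive_root_of_unity_def)
    then show "m dvd k" by auto
  qed (auto simp: zm power_mult)
  have inj: "inj_on (\<lambda>i. z ^ i) {..<m}"
  proof (rule linorder_inj_onI)
    fix i j assume ij: "i < j" "i \<in> {..<m}" "j \<in> {..<m}"
    show "z ^ i \<noteq> z ^ j"
    proof
      assume "z ^ i = z ^ j"
      hence "z ^ (j - i) = 1" using z0 ij by (simp add: power_diff)
      hence "m dvd (j - i)" using dvd by blast
      then show False using ij by (auto dest: dvd_imp_le)
    qed
  qed auto
  define f where "f = Polynomial.monom 1 m - (1 :: 'k poly)"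
  have pf: "poly f y = y ^ m - 1" for y by (simp add: f_def poly_monom)
  have "Polynomial.coeff f m = 1" using m by (simp add: f_def coeff_1)
  hence f0: "f \<noteq> 0" by auto
  have "Polynomial.degree f \<le> m" unfolding f_def by (intro degree_diff_le) (auto simp: degree_monom_le)
  hence "card {y. poly f y = 0} \<le> m" using card_poly_roots_bound[OF f0] by simp
  moreover have "(\<lambda>i. z ^ i) ` {..<m} \<subseteq> {y. poly f y = 0}"
    using zm by (auto simp: pf) (metis mult.commute power_mult power_one)
  moreover have "card ((\<lambda>i. z ^ i) ` {..<m}) = m" using inj by (simp add: card_image)
  ultimately have "(\<lambda>i. z ^ i) ` {..<m} = {y. poly f y = 0}"
    using poly_roots_finite[OF f0] by (intro card_seteq) auto
  then show "\<exists>i. y = z ^ i" if "y ^ m = 1" for y using that by (auto simp: pf set_eq_iff image_iff)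
qed

text \<open>
  If \<open>x + y\<close> or \<open>x * y\<close> were outside \<open>M\<close>, an automorphism of \<open>M\<close>, being extensional, would give
  \<open>undefined\<close> there. Replacing \<open>x\<close> and \<open>y\<close> by multiples shows that this is impossible.
\<close>

lemma Gal_nonempty_subfield:
  fixes M :: "'k::field_char_0 set"
  assumes fields: "\<And>x. x \<in> M \<Longrightarrow> \<exists>F. subfield_of F \<and> x \<in> F \<and> F \<subseteq> M"
    and M: "M \<noteq> {}" and \<tau>: "\<tau> \<in> carrier (Gal L M)"
  shows "subfield_of M"
proof -
  have bij: "bij_betw \<tau> M M" and ext: "\<And>x. x \<notin> M \<Longrightarrow> \<tau> x = undefined"
    and hom: "\<And>x y. x \<in> M \<Longrightarrow> y \<in> M \<Longrightarrow> \<tau> (x + y) = \<tau> x + \<tau> y"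
      "\<And>x y. x \<in> M \<Longrightarrow> y \<in> M \<Longrightarrow> \<tau> (x * y) = \<tau> x * \<tau> y"
    using \<tau> by (auto simp: Gal_def Bij_def extensional_def)
  have M0: "0 \<in> M" "1 \<in> M"
    using M fields subring_of.zero subring_of.one subfield_of.axioms(1) by (metis ex_in_conv subsetD)+
  have mult: "of_nat n * x \<in> M" "- x \<in> M" "inverse x \<in> M" if x: "x \<in> M" for x n
  proof -
    obtain F where F: "subfield_of F" "x \<in> F" "F \<subseteq> M" using fields[OF x] by blast
    interpret F: subfield_of F by fact
    show "of_nat n * x \<in> M" "- x \<in> M" "inverse x \<in> M" using F(2,3) by blast+
  qed
  have double: "\<tau> (2 * x) = 2 * \<tau> x" if "x \<in> M" for x
    unfolding mult_2 by (rule hom(1)[OF that that])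
  have two: "2 * x \<in> M" if "x \<in> M" for x using mult(1)[OF that, of 2] by simp
  have \<tau>0: "\<tau> 0 = 0" using hom(1)[OF M0(1) M0(1)] by (metis add_cancel_right_left)
  have inj: "x = y" if "\<tau> x = \<tau> y" "x \<in> M" "y \<in> M" for x y
    using bij that by (meson bij_betw_def inj_onD)
  have neg: "\<tau> (- x) = - \<tau> x" if "x \<in> M" for x
  proof -
    have "\<tau> (x + - x) = \<tau> x + \<tau> (- x)" using that mult(2) by (intro hom) auto
    then show ?thesis using \<tau>0 by (simp add: eq_neg_iff_add_eq_0 add.commute)
  qed
  have half: "x \<in> M" if "2 * x \<in> M" for x
  proof -
    obtain F where F: "subfield_of F" "2 * x \<in> F" "F \<subseteq> M" using fields[OF \<open>2 * x \<in> M\<close>] by blast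
    interpret F: subfield_of F by fact
    have "2 * x / of_nat 2 \<in> F" using F(2) F.of_nat by (rule F.divide)
    then show ?thesis using F(3) by auto
  qed
  have add: "x + y \<in> M" if xy: "x \<in> M" "y \<in> M" for x y
  proof (rule ccontr)
    assume no: "x + y \<notin> M"
    hence no2: "2 * x + 2 * y \<notin> M" using half[of "x + y"] by (auto simp: distrib_left)
    have "\<tau> x + \<tau> y = undefined" using ext[OF no] hom(1)[OF xy] by simp
    moreover have "2 * \<tau> x + 2 * \<tau> y = undefined"
      using ext[OF no2] hom(1)[OF two[OF xy(1)] two[OF xy(2)]] double xy by simp
    ultimately have "2 * (\<tau> x + \<tau> y) = \<tau> x + \<tau> y" by (metis distrib_left)
    hence "\<tau> x + \<tau> y = 0" by (simp add: add.commute)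
    hence "\<tau> x = \<tau> (- y)" unfolding neg[OF xy(2)] by (rule eq_neg_iff_add_eq_0[THEN iffD2])
    hence "x = - y" using inj xy mult(2) by blast
    then show False using no M0 by simp
  qed
  have mul: "x * y \<in> M" if xy: "x \<in> M" "y \<in> M" for x y
  proof (rule ccontr)
    assume no: "x * y \<notin> M"
    hence no2: "2 * x * y \<notin> M" using half[of "x * y"] by (auto simp: mult.assoc)
    have "\<tau> x * \<tau> y = undefined" using ext[OF no] hom(2)[OF xy] by simp
    moreover have "2 * \<tau> x * \<tau> y = undefined"
      using ext[OF no2] hom(2)[OF two[OF xy(1)] xy(2)] double xy by simp
    ultimately have "2 * (\<tau> x * \<tau> y) = \<tau> x * \<tau> y" by (metis mult.assoc)
    hence "\<tau> x = \<tau> 0 \<or> \<tau> y = \<tau> 0" using \<tau>0 by simp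
    hence "x = 0 \<or> y = 0" using inj xy M0 by blast
    then show False using no M0 by auto
  qed
  show ?thesis by unfold_locales (use M0 add mul mult in auto)
qed

locale tame_galois = stable_valuation V p E0 for V :: "'k::{alg_closed_field, field_char_0} set" and p E0 +
  fixes L Lt R :: "'k set" and u :: 'k and q :: nat and \<zeta> rt :: "nat \<Rightarrow> 'k" and \<phi> \<sigma> :: "'k \<Rightarrow> 'k"
  assumes L: "subfield L (ambient :: 'k ring)" and E0L: "E0 \<subseteq> L" and u: "unif L u" and R: "residues L R"
    and integral: "x \<in> V \<Longrightarrow> \<exists>f. monic_over (V \<inter> L) f \<and> poly f x = 0"
    and q: "q = card (residue_field (V \<inter> L))" and Lt: "Lt = max_tame p (V \<inter> L) L"
    and \<zeta>_prim: "\<And>m. coprime m q \<Longrightarrow> primitive_root_of_unity m (\<zeta> m)"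
    and \<zeta>_compat: "\<And>m n. coprime m q \<Longrightarrow> coprime n q \<Longrightarrow> \<zeta> (m * n) ^ m = \<zeta> n"
    and rt: "\<And>m. coprime m q \<Longrightarrow> rt m ^ m = u"
    and rt_compat: "\<And>m n. coprime m q \<Longrightarrow> coprime n q \<Longrightarrow> rt (m * n) ^ m = rt n"
    and \<phi>: "\<phi> \<in> carrier (Gal L Lt)"
    and \<phi>_\<zeta>: "\<And>m. coprime m q \<Longrightarrow> \<phi> (\<zeta> m) = \<zeta> m ^ q"
    and \<phi>_rt: "\<And>m. coprime m q \<Longrightarrow> \<phi> (rt m) = rt m"
    and \<sigma>: "\<sigma> \<in> carrier (Gal L Lt)"
    and \<sigma>_\<zeta>: "\<And>m. coprime m q \<Longrightarrow> \<sigma> (\<zeta> m) = \<zeta> m"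
    and \<sigma>_rt: "\<And>m. coprime m q \<Longrightarrow> \<sigma> (rt m) = \<zeta> m * rt m"
begin

sublocale L: subfield_of L
  using L by (rule subfield_of_ambient)

lemma q_power: "\<exists>k>0. q = p ^ k"
  by (rule residue_card_power[OF L.subfield_of_axioms R q])

lemma coprime_q_iff: "coprime m q \<longleftrightarrow> \<not> p dvd m"
proof -
  obtain k where "k > 0" "q = p ^ k" using q_power by blast
  then have "coprime m q \<longleftrightarrow> coprime m p" by simp
  also have "\<dots> \<longleftrightarrow> \<not> p dvd m"
    using prime by (metis coprime_commute coprime_absorb_left not_prime_unit prime_imp_coprime)
  finally show ?thesis .
qed

lemma coprime_q_pos: "coprime m q \<Longrightarrow> m > 0"
  unfolding coprime_q_iff by (cases m) auto

lemma integral_closure_eq: "integral_closure (V \<inter> L) F = V \<inter> F"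
proof (intro equalityI subsetI)
  fix x assume "x \<in> integral_closure (V \<inter> L) F"
  then obtain f where f: "monic_over (V \<inter> L) f" "poly f x = 0" "x \<in> F" by (auto simp: integral_closure_def)
  then have "monic_over V f" by (auto simp: monic_over_def)
  then show "x \<in> V \<inter> F" using integrally_closed f by blast
qed (use integral in \<open>auto simp: integral_closure_def\<close>)

lemma u_props: "u \<in> L" "u \<noteq> 0" "u \<in> nonunits"
  using u by (auto simp: unif_def)

lemma rt_nonzero: "coprime m q \<Longrightarrow> rt m \<noteq> 0"
  using rt[of m] u_props coprime_q_pos[of m] by (auto simp: power_0_left)

text \<open>Collects the structure of one tame extension. The exponent of \<open>u\<close> with
  respect to a uniformiser is positive because \<open>u\<close> is a nonunit. It is the ramification
  index, and tameness makes it prime to p, so that \<open>rt e\<close> is available.\<close>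

lemma tame_data:
  assumes F: "tamely_ramified p (V \<inter> L) L F"
  obtains e w m where "ramification_index (V \<inter> L) (V \<inter> F) = e" "coprime e q" "unif F w" "coprime m q"
    "(w / rt e) ^ m = 1"
    "\<forall>x\<in>F. x \<in> V \<longrightarrow> x \<notin> nonunits \<longrightarrow> (\<exists>z\<in>F. z ^ m = 1 \<and> x - z \<in> nonunits)"
proof -
  have ext: "finite_field_ext L F" and cop: "coprime (ramification_index (V \<inter> L) (V \<inter> F)) p"
    using F by (auto simp: tamely_ramified_def integral_closure_eq)
  have Fs: "subfield_of F" and LF: "L \<subseteq> F"
    using ext subfield_of_ambient by (auto simp: finite_field_ext_def)
  obtain d where d: "\<And>x. x \<in> F \<Longrightarrow> \<exists>h \<in> polys_over L. h \<noteq> 0 \<and> Polynomial.degree h \<le> d \<and> poly h x = 0"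
    by (rule finite_ext_bounded_degree[OF ext]) (rule that)
  obtain w where w: "unif F w" by (rule unif_exists[OF L.subfield_of_axioms Fs LF u d]) auto
  obtain R' where R': "residues F R'" by (rule residues_extend[OF L.subfield_of_axioms Fs R d]) auto
  have uF: "u \<in> F" using u_props LF by blast
  have w0: "w \<in> nonunits" "w \<noteq> 0" using w by (auto simp: unif_def)
  obtain k where k: "u / w powi k \<in> V" "u / w powi k \<notin> nonunits"
    by (rule unif_decomp[OF Fs w uF u_props(2)])
  have "w powi k * (u / w powi k) = u" using w0 by simp
  hence "w powi k * (u / w powi k) \<in> nonunits" using u_props by (simp only:)
  hence "k > 0" using power_int_nonunit(2)[OF w0 k, of k] by blast
  define e where "e = nat k"
  have e: "u / w ^ e \<in> V" "u / w ^ e \<notin> nonunits" using k \<open>k > 0\<close> by (auto simp: e_def power_int_def)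
  have ri: "ramification_index (V \<inter> L) (V \<inter> F) = e"
    by (rule ramification_index_eq[OF L.subfield_of_axioms Fs LF u w e])
  have pe: "\<not> p dvd e" using cop prime unfolding ri by (metis coprime_absorb_right not_prime_unit coprime_commute)
  hence eq: "coprime e q" by (simp add: coprime_q_iff)
  have E0F: "E0 \<subseteq> F" using E0L LF by blast
  obtain w' m where "unif F w'" "m > 0" "\<not> p dvd m" "(w' / rt e) ^ m = 1"
    "\<And>x. x \<in> F \<Longrightarrow> x \<in> V \<Longrightarrow> x \<notin> nonunits \<Longrightarrow> \<exists>z\<in>F. z ^ m = 1 \<and> x - z \<in> nonunits"
    by (rule tame_structure[OF Fs E0F w R' uF e pe rt[OF eq]]) (rule that)
  then show thesis using that[OF ri eq, of w' m] by (auto simp: coprime_q_iff)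
qed

lemma tame_mem:
  assumes "x \<in> Lt" obtains F where "tamely_ramified p (V \<inter> L) L F" "x \<in> F"
  using assms by (auto simp: Lt max_tame_def)

lemma tame_subset: "tamely_ramified p (V \<inter> L) L F \<Longrightarrow> F \<subseteq> Lt"
  by (auto simp: Lt max_tame_def)

lemma tame_fields: "tamely_ramified p (V \<inter> L) L F \<Longrightarrow> subfield_of F \<and> L \<subseteq> F"
  using subfield_of_ambient by (auto simp: tamely_ramified_def finite_field_ext_def)

lemma L_subset_Lt: "L \<subseteq> Lt"
proof -
  interpret A: field "ambient :: 'k ring" by rule
  have "finite_field_ext L L"
    using L A.dimension_one[OF L] by (auto simp: finite_field_ext_def A.finite_dimension_def)
  moreover have "ramification_index (V \<inter> L) (V \<inter> L) = 1"
    using u_props by (intro ramification_index_eq[OF L.subfield_of_axioms L.subfield_of_axioms _ u u]) auto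
  ultimately have "tamely_ramified p (V \<inter> L) L L" by (simp add: tamely_ramified_def integral_closure_eq)
  then show ?thesis by (rule tame_subset)
qed

text \<open>Tameness of composita is bypassed: the existence of \<sigma> as an extensional
  automorphism of the union of all tame extensions forces this union to be a field.\<close>

sublocale Lt: subfield_of Lt
proof (rule Gal_nonempty_subfield[OF _ _ \<sigma>])
  show "Lt \<noteq> {}" using L_subset_Lt L.zero by blast
  show "\<exists>F. subfield_of F \<and> x \<in> F \<and> F \<subseteq> Lt" if "x \<in> Lt" for x
    using tame_mem[OF that] tame_fields tame_subset by metis
qed

lemma Gal_Lt:
  assumes "\<tau> \<in> carrier (Gal L Lt)"
  shows "bij_betw \<tau> Lt Lt" "\<And>x. x \<notin> Lt \<Longrightarrow> \<tau> x = undefined" "\<And>x. x \<in> L \<Longrightarrow> \<tau> x = x" "hom_on Lt \<tau>"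
proof -
  show "bij_betw \<tau> Lt Lt" and ext: "\<And>x. x \<notin> Lt \<Longrightarrow> \<tau> x = undefined" and fixL: "\<And>x. x \<in> L \<Longrightarrow> \<tau> x = x"
    using assms by (auto simp: Gal_def Bij_def extensional_def)
  show "hom_on Lt \<tau>" using assms fixL[of 1] by (auto simp: Gal_def hom_on_def)
qed

lemma rt_1: "rt 1 = u" using rt[of 1] by simp

lemma zeta_primitive:
  assumes "coprime m q"
  shows "\<zeta> m ^ m = 1" "\<zeta> m ^ k = 1 \<longleftrightarrow> m dvd k" "y ^ m = 1 \<Longrightarrow> \<exists>i. y = \<zeta> m ^ i"
  using primitive_root_powers[OF \<zeta>_prim[OF assms] coprime_q_pos[OF assms]] by auto

text \<open>Outside \<open>Lt\<close> both \<sigma> and \<phi> take the default value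
  \<open>undefined\<close>, so their prescribed values at \<open>rt m\<close> would coincide. This
  gives \<zeta> m = 1, hence m = 1; but rt 1 is the uniformiser and lies in
  \<open>L\<close>.\<close>

lemma rt_Lt: assumes m: "coprime m q" shows "rt m \<in> Lt"
proof (rule ccontr)
  assume no: "rt m \<notin> Lt"
  have "\<sigma> (rt m) = undefined" "\<phi> (rt m) = undefined" using Gal_Lt(2)[OF \<sigma> no] Gal_Lt(2)[OF \<phi> no] by auto
  hence "\<zeta> m * rt m = rt m" using \<phi>_rt[OF m] \<sigma>_rt[OF m] by simp
  hence "\<zeta> m ^ 1 = 1" using rt_nonzero[OF m] by simp
  hence "m = 1" using zeta_primitive(2)[OF m, of 1] by simp
  then show False using no rt_1 u_props(1) L_subset_Lt by auto
qed

lemma zeta_Lt: assumes m: "coprime m q" shows "\<zeta> m \<in> Lt"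
proof -
  have "\<sigma> (rt m) \<in> Lt" using Gal_Lt(1)[OF \<sigma>] rt_Lt[OF m] by (auto simp: bij_betw_def)
  hence "\<zeta> m * rt m / rt m \<in> Lt" using rt_Lt[OF m] \<sigma>_rt[OF m] by (metis Lt.divide)
  then show ?thesis using rt_nonzero[OF m] by simp
qed

text \<open>All lifts are considered, not a chosen one: they differ by automorphisms fixing
  \<open>Lt\<close>, and this is how the wild part of the Galois group is reached.\<close>

definition lifts :: "('k \<Rightarrow> 'k) \<Rightarrow> ('k \<Rightarrow> 'k) \<Rightarrow> bool" where
  "lifts \<tau> f \<longleftrightarrow> \<tau> \<in> carrier (abs_Gal L) \<and> (\<forall>x\<in>Lt. \<tau> x = f x)"

lemma alg_L: "alg_over L x"
  by (rule alg_E[OF E0L])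

lemma lift_exists:
  assumes "f \<in> carrier (Gal L Lt)" obtains \<tau> where "lifts \<tau> f"
proof -
  obtain \<tau> where "\<tau> \<in> carrier (abs_Gal L)" "\<And>x. x \<in> Lt \<Longrightarrow> \<tau> x = f x"
    by (rule hom_on_extend[OF L.subfield_of_axioms alg_L Lt.subring_of_axioms L_subset_Lt Gal_Lt(4)[OF assms]])
      (erule Gal_Lt(3)[OF assms], rule that)
  then show thesis using that by (auto simp: lifts_def)
qed

lemma lifts_D:
  assumes "lifts \<tau> \<sigma>" "lifts \<omega> \<phi>" "coprime m q"
  shows "\<tau> (\<zeta> m) = \<zeta> m" "\<tau> (rt m) = \<zeta> m * rt m" "\<omega> (\<zeta> m) = \<zeta> m ^ q" "\<omega> (rt m) = rt m"
    "\<tau> \<in> carrier (abs_Gal L)" "\<omega> \<in> carrier (abs_Gal L)"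
  using assms zeta_Lt rt_Lt \<sigma>_\<zeta> \<sigma>_rt \<phi>_\<zeta> \<phi>_rt by (auto simp: lifts_def)

lemma root_of_unity_fixed:
  assumes \<tau>: "\<tau> \<in> carrier (abs_Gal L)" "\<tau> (\<zeta> m) = \<zeta> m" and m: "coprime m q" and z: "z ^ m = 1"
  shows "\<tau> z = z"
  using zeta_primitive(3)[OF m z] \<tau>(2) field_auto.power[OF abs_Gal_auto[OF \<tau>(1)]] by auto

text \<open>One index N = m e serves the whole of \<open>F\<close>: powers of \<zeta> N and rt N
  give \<zeta> m and rt e, hence the Teichmueller representatives and a uniformiser of
  \<open>F\<close>.\<close>

lemma tame_fixed:
  assumes F: "tamely_ramified p (V \<inter> L) L F"
  obtains N where "coprime N q"
    "\<And>\<tau> x. \<tau> \<in> carrier (abs_Gal L) \<Longrightarrow> \<tau> (\<zeta> N) = \<zeta> N \<Longrightarrow> \<tau> (rt N) = rt N \<Longrightarrow> x \<in> F \<Longrightarrow> \<tau> x = x"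
proof -
  obtain e w m where d: "coprime e q" "unif F w" "coprime m q" "(w / rt e) ^ m = 1"
    "\<forall>x\<in>F. x \<in> V \<longrightarrow> x \<notin> nonunits \<longrightarrow> (\<exists>z\<in>F. z ^ m = 1 \<and> x - z \<in> nonunits)"
    by (rule tame_data[OF F]) (rule that)
  have Fs: "subfield_of F" using tame_fields[OF F] by blast
  have N: "coprime (m * e) q" using d(1,3) by simp
  show thesis
  proof (rule that[OF N])
    fix \<tau> x assume \<tau>: "\<tau> \<in> carrier (abs_Gal L)" and z: "\<tau> (\<zeta> (m * e)) = \<zeta> (m * e)"
      and r: "\<tau> (rt (m * e)) = rt (m * e)" and x: "x \<in> F"
    interpret t: field_auto \<tau> using \<tau> by (rule abs_Gal_auto)
    have zm: "\<tau> (\<zeta> m) = \<zeta> m" using \<zeta>_compat[OF d(1,3)] z t.power by (metis mult.commute)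
    have re: "\<tau> (rt e) = rt e" using rt_compat[OF d(3,1)] r t.power by metis
    have "\<tau> (w / rt e) = w / rt e" by (rule root_of_unity_fixed[OF \<tau> zm d(3,4)])
    hence tw: "\<tau> w = w" using re rt_nonzero[OF d(1)] by (simp add: field_simps)
    have t0: "\<tau> \<in> carrier (abs_Gal E0)" using \<tau> abs_Gal_mono[OF E0L] by blast
    show "\<tau> x = x"
    proof (rule fixes_field[OF Fs t0 d(2) tw _ x])
      fix y assume "y \<in> F" "y \<in> V" "y \<notin> nonunits"
      then obtain z where "z \<in> F" "z ^ m = 1" "y - z \<in> nonunits" using d(5) by blast
      then show "\<exists>z\<in>F. \<tau> z = z \<and> y - z \<in> nonunits" using root_of_unity_fixed[OF \<tau> zm d(3)] by blast
    qed
  qed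
qed

text \<open>With e = 1 the uniformiser of \<open>F\<close> is a root of unity times \<open>u\<close>
  itself, and \<sigma> fixes both factors.\<close>

lemma sigma_fixes_unramified:
  assumes F: "unramified (V \<inter> L) L F" and \<tau>: "lifts \<tau> \<sigma>" and x: "x \<in> F"
  shows "\<tau> x = x"
proof -
  have t: "tamely_ramified p (V \<inter> L) L F" and r: "ramification_index (V \<inter> L) (V \<inter> F) = 1"
    using F by (auto simp: unramified_def tamely_ramified_def integral_closure_eq)
  obtain e w m where d: "ramification_index (V \<inter> L) (V \<inter> F) = e" "coprime e q" "unif F w" "coprime m q" "(w / rt e) ^ m = 1"
    "\<forall>x\<in>F. x \<in> V \<longrightarrow> x \<notin> nonunits \<longrightarrow> (\<exists>z\<in>F. z ^ m = 1 \<and> x - z \<in> nonunits)"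
    by (rule tame_data[OF t]) (rule that)
  have e: "rt e = u" using d(1) r rt_1 by simp
  have Fs: "subfield_of F" using tame_fields[OF t] by blast
  have \<tau>L: "\<tau> \<in> carrier (abs_Gal L)" and zm: "\<tau> (\<zeta> m) = \<zeta> m"
    using \<tau> zeta_Lt[OF d(4)] \<sigma>_\<zeta>[OF d(4)] by (auto simp: lifts_def)
  interpret t: field_auto \<tau> using \<tau>L by (rule abs_Gal_auto)
  have "\<tau> (w / rt e) = w / rt e" by (rule root_of_unity_fixed[OF \<tau>L zm d(4,5)])
  hence "\<tau> w / \<tau> u = w / u" using e by simp
  hence tw: "\<tau> w = w" using abs_Gal_fix[OF \<tau>L u_props(1)] u_props(2) by simp
  have t0: "\<tau> \<in> carrier (abs_Gal E0)" using \<tau>L abs_Gal_mono[OF E0L] by blast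
  show "\<tau> x = x"
  proof (rule fixes_field[OF Fs t0 d(3) tw _ x])
    fix y assume "y \<in> F" "y \<in> V" "y \<notin> nonunits"
    then obtain z where "z \<in> F" "z ^ m = 1" "y - z \<in> nonunits" using d(6) by blast
    then show "\<exists>z\<in>F. \<tau> z = z \<and> y - z \<in> nonunits" using root_of_unity_fixed[OF \<tau>L zm d(4)] by blast
  qed
qed

lemma unramified_subset_Lt: "unramified (V \<inter> L) L F \<Longrightarrow> F \<subseteq> Lt"
  by (rule tame_subset) (auto simp: unramified_def tamely_ramified_def)

lemma agree_on_Lt:
  assumes \<tau>: "\<tau> \<in> carrier (abs_Gal L)" "\<omega> \<in> carrier (abs_Gal L)"
    and z: "\<And>N. coprime N q \<Longrightarrow> \<tau> (\<zeta> N) = \<omega> (\<zeta> N)" "\<And>N. coprime N q \<Longrightarrow> \<tau> (rt N) = \<omega> (rt N)" and x: "x \<in> Lt"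
  shows "\<tau> x = \<omega> x"
proof -
  obtain F where F: "tamely_ramified p (V \<inter> L) L F" "x \<in> F" by (rule tame_mem[OF x])
  obtain N where N: "coprime N q"
    "\<And>\<tau> x. \<tau> \<in> carrier (abs_Gal L) \<Longrightarrow> \<tau> (\<zeta> N) = \<zeta> N \<Longrightarrow> \<tau> (rt N) = rt N \<Longrightarrow> x \<in> F \<Longrightarrow> \<tau> x = x"
    by (rule tame_fixed[OF F(1)]) (rule that)
  have "(Hilbert_Choice.inv \<omega> \<circ> \<tau>) x = x"
  proof (rule N(2))
    show "Hilbert_Choice.inv \<omega> \<circ> \<tau> \<in> carrier (abs_Gal L)" by (intro abs_Gal_comp abs_Gal_inv \<tau>)
  qed (use z N(1) F(2) abs_Gal_inv_apply(2)[OF \<tau>(2)] in auto)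
  then show ?thesis using abs_Gal_inv_apply(1)[OF \<tau>(2), of "\<tau> x"] by simp
qed

text \<open>Both sides agree on every \<zeta> N and rt N, which decides equality on
  \<open>Lt\<close>. So the relation between \<sigma> and \<phi> is derived from their
  values.\<close>

lemma frobenius_relation:
  assumes s: "lifts \<tau> \<sigma>" and f: "lifts \<omega> \<phi>" and x: "x \<in> Lt"
  shows "\<omega> (\<tau> x) = (\<tau> ^^ q) (\<omega> x)"
proof -
  have G: "\<tau> \<in> carrier (abs_Gal L)" "\<omega> \<in> carrier (abs_Gal L)" using s f by (auto simp: lifts_def)
  interpret t: field_auto \<tau> using G(1) by (rule abs_Gal_auto)
  interpret w: field_auto \<omega> using G(2) by (rule abs_Gal_auto)
  have pow: "(\<tau> ^^ i) (\<zeta> N ^ j) = \<zeta> N ^ j" "(\<tau> ^^ i) (rt N) = \<zeta> N ^ i * rt N" if "coprime N q" for i j N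
    by (induction i) (auto simp: lifts_D[OF s f that])
  have "(\<omega> \<circ> \<tau>) x = (\<tau> ^^ q \<circ> \<omega>) x"
    by (rule agree_on_Lt[of "\<omega> \<circ> \<tau>" "\<tau> ^^ q \<circ> \<omega>"])
      (auto intro!: abs_Gal_comp abs_Gal_funpow G simp: lifts_D(1-4)[OF s f] pow x)
  then show ?thesis by simp
qed

text \<open>At a finite level N the automorphism \<theta> raises \<zeta> N to a power of q and
  multiplies rt N by a power of \<zeta> N. The two exponents give the word, which may depend on
  \<open>x\<close>.\<close>

lemma agrees_with_word:
  assumes s: "lifts \<tau> \<sigma>" and f: "lifts \<omega> \<phi>" and \<theta>: "\<theta> \<in> carrier (abs_Gal L)" and x: "x \<in> Lt"
  obtains k j where "\<theta> x = (\<tau> ^^ k) ((\<omega> ^^ j) x)"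
proof -
  have G: "\<tau> \<in> carrier (abs_Gal L)" "\<omega> \<in> carrier (abs_Gal L)" using s f by (auto simp: lifts_def)
  interpret t: field_auto \<tau> using G(1) by (rule abs_Gal_auto)
  interpret w: field_auto \<omega> using G(2) by (rule abs_Gal_auto)
  interpret h: field_auto \<theta> using \<theta> by (rule abs_Gal_auto)
  obtain F where F: "tamely_ramified p (V \<inter> L) L F" "x \<in> F" by (rule tame_mem[OF x])
  obtain N where N: "coprime N q"
    "\<And>\<tau> x. \<tau> \<in> carrier (abs_Gal L) \<Longrightarrow> \<tau> (\<zeta> N) = \<zeta> N \<Longrightarrow> \<tau> (rt N) = rt N \<Longrightarrow> x \<in> F \<Longrightarrow> \<tau> x = x"
    by (rule tame_fixed[OF F(1)]) (rule that)
  note D = lifts_D[OF s f N(1)]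
  have pN: "\<not> p dvd N" using N(1) by (simp add: coprime_q_iff)
  obtain j where j: "\<theta> (\<zeta> N) = \<zeta> N ^ (q ^ j)"
    using frobenius_orbit[OF L.subfield_of_axioms R q E0L G(2) D(3) zeta_primitive(1)[OF N(1)] pN \<theta>] by blast
  have r0: "rt N \<noteq> 0" by (rule rt_nonzero[OF N(1)])
  have "\<theta> (rt N) ^ N = u" using h.power[of "rt N" N] rt[OF N(1)] abs_Gal_fix[OF \<theta> u_props(1)] by simp
  hence "(\<theta> (rt N) / rt N) ^ N = 1" using rt[OF N(1)] u_props(2) by (simp add: power_divide)
  then obtain k where "\<theta> (rt N) / rt N = \<zeta> N ^ k" using zeta_primitive(3)[OF N(1)] by blast
  hence k: "\<theta> (rt N) = \<zeta> N ^ k * rt N" using r0 by (simp add: field_simps)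
  have pw: "(\<tau> ^^ i) (\<zeta> N ^ l) = \<zeta> N ^ l" "(\<tau> ^^ i) (rt N) = \<zeta> N ^ i * rt N"
    "(\<omega> ^^ i) (\<zeta> N) = \<zeta> N ^ (q ^ i)" "(\<omega> ^^ i) (rt N) = rt N" for i l
    by (induction i) (auto simp: D power_mult[symmetric] mult.commute)
  define h where "h = \<tau> ^^ k \<circ> \<omega> ^^ j"
  have hG: "h \<in> carrier (abs_Gal L)" unfolding h_def by (intro abs_Gal_comp abs_Gal_funpow G)
  have hz: "h (\<zeta> N) = \<theta> (\<zeta> N)" "h (rt N) = \<theta> (rt N)" using j k by (auto simp: h_def pw)
  have "(Hilbert_Choice.inv h \<circ> \<theta>) x = x"
  proof (rule N(2))
    show "Hilbert_Choice.inv h \<circ> \<theta> \<in> carrier (abs_Gal L)" by (intro abs_Gal_comp abs_Gal_inv hG \<theta>)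
  qed (use F(2) hz[symmetric] abs_Gal_inv_apply(2)[OF hG] in auto)
  then have "\<theta> x = h x" using abs_Gal_inv_apply(1)[OF hG, of "\<theta> x"] by simp
  then show thesis using that[of k j] by (simp add: h_def)
qed

text \<open>Composing a lift with an automorphism that fixes \<open>Lt\<close> gives another lift,
  so an element fixed by all lifts is fixed by the whole Galois group of \<open>Lt\<close>.\<close>

lemma fixed_by_lifts_Lt:
  assumes "\<And>\<tau>. lifts \<tau> \<sigma> \<Longrightarrow> \<tau> x = x" shows "x \<in> Lt"
proof (rule fixed_in[OF Lt.subfield_of_axioms])
  show "E0 \<subseteq> Lt" using E0L L_subset_Lt by blast
  fix \<tau> assume t: "\<tau> \<in> carrier (abs_Gal Lt)"
  obtain \<sigma>1 where s: "lifts \<sigma>1 \<sigma>" by (rule lift_exists[OF \<sigma>])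
  have "\<tau> \<in> carrier (abs_Gal L)" using t abs_Gal_mono[OF L_subset_Lt] by blast
  hence "lifts (\<sigma>1 \<circ> \<tau>) \<sigma>" using s abs_Gal_comp[of \<sigma>1 L \<tau>] abs_Gal_fix[OF t] by (auto simp: lifts_def)
  from assms[OF this] assms[OF s] have "\<sigma>1 (\<tau> x) = \<sigma>1 x" by simp
  then show "\<tau> x = x" using s field_auto.eq_iff[OF abs_Gal_auto] by (auto simp: lifts_def)
qed

text \<open>A fixed point of \<open>S\<close> lies in \<open>Lt\<close>, where any automorphism acts
  on it like a word in lifts and hence trivially. So \<open>S\<close> has no more fixed points than
  the whole group, and \<open>abs_Gal_subgroup_eq\<close> applies.\<close>

theorem generated_by_lifts:
  assumes S: "S \<subseteq> carrier (abs_Gal L)" "\<And>\<tau> \<omega>. \<tau> \<in> S \<Longrightarrow> \<omega> \<in> S \<Longrightarrow> \<tau> \<circ> \<omega> \<in> S"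
      "\<And>\<tau>. \<tau> \<in> S \<Longrightarrow> Hilbert_Choice.inv \<tau> \<in> S"
    and Z: "finite Z" "\<And>\<tau>. \<tau> \<in> carrier (abs_Gal L) \<Longrightarrow> \<forall>x\<in>Z. \<tau> x = x \<Longrightarrow> \<tau> \<in> S"
    and lifts: "\<And>\<tau>. lifts \<tau> \<sigma> \<Longrightarrow> \<tau> \<in> S" "\<And>\<tau>. lifts \<tau> \<phi> \<Longrightarrow> \<tau> \<in> S"
    and \<omega>: "\<omega> \<in> carrier (abs_Gal L)"
  shows "\<omega> \<in> S"
proof (rule abs_Gal_subgroup_eq[OF alg_L S Z _ \<omega>])
  fix x \<theta> assume fixed: "\<forall>\<tau>\<in>S. \<tau> x = x" and \<theta>: "\<theta> \<in> carrier (abs_Gal L)"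
  obtain \<sigma>1 where s: "lifts \<sigma>1 \<sigma>" by (rule lift_exists[OF \<sigma>])
  obtain \<phi>1 where f: "lifts \<phi>1 \<phi>" by (rule lift_exists[OF \<phi>])
  have "x \<in> Lt" using fixed_by_lifts_Lt fixed lifts(1) by blast
  then obtain k j where kj: "\<theta> x = (\<sigma>1 ^^ k) ((\<phi>1 ^^ j) x)" by (rule agrees_with_word[OF s f \<theta>])
  have "(\<phi>1 ^^ j) x = x" "(\<sigma>1 ^^ k) x = x" for j k
    using fixed lifts s f by (induction j, simp_all) (induction k, simp_all)
  then show "\<theta> x = x" using kj by simp
qed

text \<open>Write y = w^k c with a unit c. A lift of \<sigma> multiplies w by \<zeta> e and changes
  c only by a nonunit, so invariance makes the k-th power of \<zeta> e congruent, and therefore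
  equal, to 1. Hence e divides k, and w^e has the value of \<open>u\<close>.\<close>

lemma sigma_invariant_value:
  assumes y: "\<And>\<tau>. lifts \<tau> \<sigma> \<Longrightarrow> \<tau> y = y" "y \<noteq> 0"
  obtains j :: int where "y / u powi j \<in> V" "y / u powi j \<notin> nonunits"
proof -
  have "y \<in> Lt" using fixed_by_lifts_Lt y(1) by blast
  then obtain F where F: "tamely_ramified p (V \<inter> L) L F" "y \<in> F" by (rule tame_mem)
  obtain e w m where d: "coprime e q" "unif F w" "coprime m q" "(w / rt e) ^ m = 1"
    "\<forall>x\<in>F. x \<in> V \<longrightarrow> x \<notin> nonunits \<longrightarrow> (\<exists>z\<in>F. z ^ m = 1 \<and> x - z \<in> nonunits)"
    by (rule tame_data[OF F(1)]) (rule that)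
  have Fs: "subfield_of F" using tame_fields[OF F(1)] by blast
  interpret F: subfield_of F by fact
  have w: "w \<in> F" "w \<noteq> 0" "w \<in> nonunits" using d(2) by (auto simp: unif_def)
  obtain k :: int where k: "y / w powi k \<in> V" "y / w powi k \<notin> nonunits"
    by (rule unif_decomp[OF Fs d(2) F(2) y(2)])
  define c where "c = y / w powi k"
  have c: "c \<in> V" "c \<notin> nonunits" "c \<noteq> 0" unfolding c_def by (fact k, fact k, fact unit_nonzero[OF k(2)])
  have cF: "c \<in> F" using w F(2) F.power[of w] F.inverse[of w] by (auto simp: c_def power_int_def)
  have yc: "y = w powi k * c" using w(2) by (simp add: c_def)
  obtain \<tau> where t: "lifts \<tau> \<sigma>" by (rule lift_exists[OF \<sigma>])
  have \<tau>L: "\<tau> \<in> carrier (abs_Gal L)" using t by (simp add: lifts_def)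
  have zm: "\<tau> (\<zeta> m) = \<zeta> m" and re: "\<tau> (rt e) = \<zeta> e * rt e"
    using t zeta_Lt[OF d(3)] \<sigma>_\<zeta>[OF d(3)] rt_Lt[OF d(1)] \<sigma>_rt[OF d(1)] by (auto simp: lifts_def)
  interpret t: field_auto \<tau> using \<tau>L by (rule abs_Gal_auto)
  have "\<tau> (w / rt e) = w / rt e" by (rule root_of_unity_fixed[OF \<tau>L zm d(3,4)])
  hence tw: "\<tau> w = \<zeta> e * w" using re rt_nonzero[OF d(1)] zeta_primitive(1)[OF d(1)] coprime_q_pos[OF d(1)]
    by (cases "\<zeta> e = 0") (auto simp: field_simps power_0_left)
  obtain z where z: "z \<in> F" "z ^ m = 1" "c - z \<in> nonunits" using d(5) cF c by blast
  have "\<tau> (c - z) \<in> nonunits" using Gal_stable(2)[OF E0L \<tau>L] z(3) by blast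
  hence "\<tau> c - z \<in> nonunits" using root_of_unity_fixed[OF \<tau>L zm d(3) z(2)] by simp
  hence cc: "\<tau> c - c \<in> nonunits" using nonunits_cong_trans nonunits_cong_sym[OF z(3)] by blast
  define x where "x = \<zeta> e powi k"
  have ze: "\<zeta> e ^ e = 1" by (rule zeta_primitive(1)[OF d(1)])
  have ze0: "\<zeta> e \<noteq> 0" using ze coprime_q_pos[OF d(1)] by (auto simp: power_0_left)
  have xe: "x ^ e = 1"
  proof -
    have "x ^ e = (\<zeta> e ^ e) powi k" unfolding x_def by (simp add: power_int_power power_int_power' mult.commute)
    then show ?thesis using ze by simp
  qed
  have xV: "x \<in> V" "x \<notin> nonunits" using root_of_unity_V[OF xe coprime_q_pos[OF d(1)]] by auto
  have "\<tau> y = x * (w powi k * \<tau> c)" unfolding yc by (simp add: tw power_int_mult_distrib x_def)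
  hence "w powi k * (x * \<tau> c) = w powi k * c" using y(1)[OF t] yc by (metis mult.left_commute)
  hence "x * \<tau> c = c" using w(2) by simp
  hence "(x - 1) * c = - (x * (\<tau> c - c))" by (simp add: algebra_simps)
  hence "(x - 1) * c \<in> nonunits" using nonunits_uminus[OF nonunits_mult[OF xV(1) cc]] by simp
  hence "x - 1 \<in> nonunits" using nonunits_prime[of "x - 1" c] xV c by auto
  hence "x = 1" using root_of_unity_eq_1[OF xe] d(1) by (simp add: coprime_q_iff)
  have "int e dvd k"
  proof -
    have e0: "int e > 0" using coprime_q_pos[OF d(1)] by simp
    have "\<zeta> e powi k = (\<zeta> e ^ e) powi (k div int e) * \<zeta> e powi (k mod int e)"
      using ze0 power_int_add[of "\<zeta> e" "int e * (k div int e)" "k mod int e"] by (simp add: power_int_mult)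
    hence "\<zeta> e powi (k mod int e) = 1" using \<open>x = 1\<close> ze by (simp add: x_def)
    hence "\<zeta> e ^ nat (k mod int e) = 1" using e0 by (simp add: power_int_def)
    hence "e dvd nat (k mod int e)" using zeta_primitive(2)[OF d(1)] by blast
    moreover have "nat (k mod int e) < e" using e0 by (simp add: nat_less_iff)
    ultimately have "nat (k mod int e) = 0" by (auto dest: dvd_imp_le)
    hence "k mod int e = 0" using pos_mod_sign[OF e0, of k] by linarith
    then show ?thesis by (rule dvd_eq_mod_eq_0[THEN iffD2])
  qed
  then obtain l where l: "k = int e * l" by blast
  define x' where "x' = (w / rt e) powi k"
  have x': "x' ^ m = 1"
  proof -
    have "x' ^ m = ((w / rt e) ^ m) powi k" unfolding x'_def by (simp add: power_int_power power_int_power' mult.commute)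
    then show ?thesis using d(4) by simp
  qed
  have x'V: "x' \<in> V" "x' \<notin> nonunits" using root_of_unity_V[OF x' coprime_q_pos[OF d(3)]] by auto
  have "rt e powi k = u powi l" unfolding l using rt[OF d(1)] by (simp add: power_int_mult)
  moreover have "w powi k = x' * rt e powi k" using rt_nonzero[OF d(1)] by (simp add: x'_def power_int_divide_distrib)
  ultimately have "y / u powi l = x' * c" unfolding yc using u_props(2) by simp
  then show thesis using that[of l] x'V c unit_mult by (simp add: mult)
qed

end

section \<open>Galois algebras\<close>

lemma sum_cyclic_shift:
  fixes c :: "nat \<Rightarrow> 'a::comm_monoid_add"
  assumes "c n = c 0" shows "(\<Sum>i<n. c (Suc i)) = (\<Sum>i<n. c i)"
proof (cases n)
  case (Suc m)
  have "(\<Sum>i<n. c (Suc i)) = (\<Sum>i<m. c (Suc i)) + c n" by (simp add: Suc)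
  moreover have "(\<Sum>i<n. c i) = c 0 + (\<Sum>i<m. c (Suc i))" unfolding Suc by (rule sum.lessThan_Suc_shift)
  ultimately show ?thesis using assms by (simp add: add.commute)
qed simp

text \<open>Multiplication by q permutes the residues modulo n; this will absorb the action of
  \<phi>.\<close>

lemma sum_cyclic_scale:
  fixes c :: "nat \<Rightarrow> 'a::comm_monoid_add"
  assumes "coprime n q" and c: "\<And>i. c i = c (i mod n)"
  shows "(\<Sum>i<n. c (q * i)) = (\<Sum>i<n. c i)"
proof (cases "n = 0")
  case False
  have inj: "inj_on (\<lambda>i. q * i mod n) {..<n}"
  proof (rule inj_onI)
    fix i j assume ij: "i \<in> {..<n}" "j \<in> {..<n}" "q * i mod n = q * j mod n"
    have "[q * i = q * j] (mod n)" using ij(3) by (simp add: cong_def)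
    hence "[i = j] (mod n)" using assms(1) by (simp add: cong_mult_lcancel_nat coprime_commute)
    then show "i = j" using ij by (simp add: cong_def)
  qed
  have img: "(\<lambda>i. q * i mod n) ` {..<n} = {..<n}"
    using False by (intro endo_inj_surj inj) auto
  have "(\<Sum>i<n. c (q * i)) = (\<Sum>i<n. c (q * i mod n))" using c by (intro sum.cong refl)
  also have "\<dots> = (\<Sum>i\<in>(\<lambda>i. q * i mod n) ` {..<n}. c i)" by (simp add: sum.reindex[OF inj])
  finally show ?thesis by (simp add: img)
qed simp

lemma sum_powers_root_of_unity:
  fixes z :: "'k::field"
  assumes "z ^ n = 1" shows "(\<Sum>i<n. z ^ i) = (if z = 1 then of_nat n else 0)"
proof (cases "z = 1")
  case False
  have "(z - 1) * (\<Sum>i<n. z ^ i) = 0" using power_diff_1_eq[of z n] assms by simp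
  then show ?thesis using False by simp
qed simp

lemma monic_over_prod:
  assumes "subring_of A" "\<And>i. i \<in> I \<Longrightarrow> monic_over A (f i)"
  shows "monic_over A (\<Prod>i\<in>I. f i)"
  using assms unfolding monic_over_iff
  by (auto simp: lead_coeff_prod intro: subring_of.polys_over_prod)

text \<open>The definition asks for one polynomial that kills all values at once; the product of
  integral equations for the finitely many values does.\<close>

lemma (in stable_valuation) algebra_integers_eq:
  assumes L: "subfield_of L" and int: "\<And>x. x \<in> V \<Longrightarrow> \<exists>f. monic_over (V \<inter> L) f \<and> poly f x = 0"
    and G: "finite (carrier G)"
  shows "algebra_integers (V \<inter> L) L G \<rho> = {a \<in> galois_algebra L G \<rho>. \<forall>\<gamma>\<in>carrier G. a \<gamma> \<in> V}"
proof (intro equalityI subsetI)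
  fix a assume "a \<in> algebra_integers (V \<inter> L) L G \<rho>"
  then obtain f where f: "a \<in> galois_algebra L G \<rho>" "monic_over (V \<inter> L) f" "\<And>\<gamma>. \<gamma> \<in> carrier G \<Longrightarrow> poly f (a \<gamma>) = 0"
    by (auto simp: algebra_integers_def)
  have "monic_over V f" using f(2) by (auto simp: monic_over_def)
  then show "a \<in> {a \<in> galois_algebra L G \<rho>. \<forall>\<gamma>\<in>carrier G. a \<gamma> \<in> V}"
    using f integrally_closed by blast
next
  fix a assume a: "a \<in> {a \<in> galois_algebra L G \<rho>. \<forall>\<gamma>\<in>carrier G. a \<gamma> \<in> V}"
  interpret L: subfield_of L by fact
  have VL: "subring_of (V \<inter> L)" by unfold_locales auto
  have "\<forall>\<gamma>\<in>carrier G. \<exists>f. monic_over (V \<inter> L) f \<and> poly f (a \<gamma>) = 0" using a int by blast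
  then obtain f where f: "\<And>\<gamma>. \<gamma> \<in> carrier G \<Longrightarrow> monic_over (V \<inter> L) (f \<gamma>)" "\<And>\<gamma>. \<gamma> \<in> carrier G \<Longrightarrow> poly (f \<gamma>) (a \<gamma>) = 0"
    by metis
  have "monic_over (V \<inter> L) (\<Prod>\<gamma>\<in>carrier G. f \<gamma>)" using f(1) by (rule monic_over_prod[OF VL])
  moreover have "poly (\<Prod>\<gamma>\<in>carrier G. f \<gamma>) (a \<delta>) = 0" if "\<delta> \<in> carrier G" for \<delta>
    using f(2)[OF that] that G by (auto simp: poly_prod)
  ultimately show "a \<in> algebra_integers (V \<inter> L) L G \<rho>" using a by (auto simp: algebra_integers_def)
qed

locale tame_homomorphism = tame_galois + group G for G :: "('g, 'm) monoid_scheme" (structure) +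
  fixes \<pi> \<pi>' \<pi>nr \<pi>nr' :: "('a \<Rightarrow> 'a) \<Rightarrow> 'g" and Lnr :: "'a set" and s t :: 'g
  assumes finG: "finite (carrier G)" and Lnr: "Lnr = max_unramified (V \<inter> L) L"
    and \<pi>: "continuous_hom L G \<pi>"
    and \<pi>_tame: "factors_through L Lt G \<pi> \<pi>'"
    and s: "s = \<pi>' \<sigma>"
    and t: "t = \<pi>' \<phi>"
    and \<pi>nr: "continuous_hom L G \<pi>nr"
    and \<pi>nr_unramified: "factors_through L Lnr G \<pi>nr \<pi>nr'"
    and \<pi>nr_\<phi>: "\<pi>nr' (restrict \<phi> Lnr) = t"
begin

lemma hom_Gal:
  assumes "continuous_hom L G \<rho>"
  shows "\<tau> \<in> carrier (abs_Gal L) \<Longrightarrow> \<rho> \<tau> \<in> carrier G"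
    "\<tau> \<in> carrier (abs_Gal L) \<Longrightarrow> \<omega> \<in> carrier (abs_Gal L) \<Longrightarrow> \<rho> (\<tau> \<circ> \<omega>) = \<rho> \<tau> \<otimes> \<rho> \<omega>"
    "\<rho> id = \<one>"
    "\<tau> \<in> carrier (abs_Gal L) \<Longrightarrow> \<rho> (Hilbert_Choice.inv \<tau>) = inv (\<rho> \<tau>)"
proof -
  have h: "\<rho> \<in> hom (abs_Gal L) G" using assms by (simp add: continuous_hom_def)
  show c: "\<And>\<tau>. \<tau> \<in> carrier (abs_Gal L) \<Longrightarrow> \<rho> \<tau> \<in> carrier G" using h by (auto simp: hom_def)
  show m: "\<And>\<tau> \<omega>. \<tau> \<in> carrier (abs_Gal L) \<Longrightarrow> \<omega> \<in> carrier (abs_Gal L) \<Longrightarrow> \<rho> (\<tau> \<circ> \<omega>) = \<rho> \<tau> \<otimes> \<rho> \<omega>"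
    using hom_mult[OF h] abs_Gal_mult by metis
  have "\<rho> id \<otimes> \<rho> id = \<rho> id" using m[OF abs_Gal_id abs_Gal_id] by simp
  then show one: "\<rho> id = \<one>" using c[OF abs_Gal_id] by (metis l_cancel_one)
  show "\<rho> (Hilbert_Choice.inv \<tau>) = inv (\<rho> \<tau>)" if t: "\<tau> \<in> carrier (abs_Gal L)"
  proof -
    have "Hilbert_Choice.inv \<tau> \<circ> \<tau> = id" using abs_Gal_inv_apply(2)[OF t] by auto
    hence "\<rho> (Hilbert_Choice.inv \<tau>) \<otimes> \<rho> \<tau> = \<one>" using m[OF abs_Gal_inv[OF t] t] one by simp
    then show ?thesis using c[OF t] c[OF abs_Gal_inv[OF t]] by (metis inv_equality)
  qed
qed

lemma pi_agree:
  assumes "\<tau> \<in> carrier (abs_Gal L)" "\<omega> \<in> carrier (abs_Gal L)" "\<And>x. x \<in> Lt \<Longrightarrow> \<tau> x = \<omega> x"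
  shows "\<pi> \<tau> = \<pi> \<omega>"
proof -
  have "restrict \<tau> Lt = restrict \<omega> Lt" using assms(3) by auto
  then show ?thesis using \<pi>_tame assms(1,2) by (simp add: factors_through_def)
qed

lemma pi_lift: assumes "f \<in> carrier (Gal L Lt)" "lifts \<tau> f" shows "\<pi> \<tau> = \<pi>' f"
proof -
  have "restrict \<tau> Lt = f" using assms(2) Gal_Lt(2)[OF assms(1)] by (auto simp: lifts_def restrict_def)
  then show ?thesis using \<pi>_tame assms(2) by (auto simp: factors_through_def lifts_def)
qed

lemma Lnr_mem: assumes "x \<in> Lnr" obtains F where "unramified (V \<inter> L) L F" "x \<in> F"
  using assms by (auto simp: Lnr max_unramified_def)

text \<open>On the lifts \<open>\<pi>\<close> and \<open>\<pi>nr\<close> are compared only at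
  \<sigma> and \<phi>. They agree at \<phi>, while \<open>\<pi>nr\<close> kills \<sigma> because its
  lifts fix every unramified extension.\<close>

lemma lifts_values:
  shows "lifts \<tau> \<sigma> \<Longrightarrow> \<pi> \<tau> = s" "lifts \<tau> \<phi> \<Longrightarrow> \<pi> \<tau> = t"
    "lifts \<tau> \<sigma> \<Longrightarrow> \<pi>nr \<tau> = \<one>" "lifts \<tau> \<phi> \<Longrightarrow> \<pi>nr \<tau> = t"
proof -
  have nr: "\<pi>nr \<tau> = \<pi>nr' (restrict \<tau> Lnr)" if "\<tau> \<in> carrier (abs_Gal L)" for \<tau>
    using \<pi>nr_unramified that by (simp add: factors_through_def)
  show "lifts \<tau> \<sigma> \<Longrightarrow> \<pi> \<tau> = s" "lifts \<tau> \<phi> \<Longrightarrow> \<pi> \<tau> = t" using pi_lift \<sigma> \<phi> s t by auto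
  show "\<pi>nr \<tau> = \<one>" if l: "lifts \<tau> \<sigma>"
  proof -
    have "\<tau> x = id x" if "x \<in> Lnr" for x
      using sigma_fixes_unramified[OF _ l] Lnr_mem[OF that] by (metis id_apply)
    hence "restrict \<tau> Lnr = restrict id Lnr" by auto
    then show ?thesis using nr[of \<tau>] nr[OF abs_Gal_id] hom_Gal(3)[OF \<pi>nr] l by (simp add: lifts_def)
  qed
  show "\<pi>nr \<tau> = t" if l: "lifts \<tau> \<phi>"
  proof -
    have "\<tau> x = \<phi> x" if "x \<in> Lnr" for x
      using Lnr_mem[OF that] unramified_subset_Lt l unfolding lifts_def by blast
    hence "restrict \<tau> Lnr = restrict \<phi> Lnr" by auto
    then show ?thesis using nr[of \<tau>] \<pi>nr_\<phi> l by (simp add: lifts_def)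
  qed
qed

lemma s_carrier [simp]: "s \<in> carrier G" and t_carrier [simp]: "t \<in> carrier G"
proof -
  obtain \<tau> \<omega> where "lifts \<tau> \<sigma>" "lifts \<omega> \<phi>" using lift_exists \<sigma> \<phi> by metis
  then show "s \<in> carrier G" "t \<in> carrier G"
    using lifts_values(1,2) hom_Gal(1)[OF \<pi>] unfolding lifts_def by metis+
qed

lemma t_s_pow: "t \<otimes> s [^] (i::nat) = s [^] (q * i) \<otimes> t"
proof -
  obtain \<tau> where l: "lifts \<tau> \<sigma>" by (rule lift_exists[OF \<sigma>])
  obtain \<omega> where m: "lifts \<omega> \<phi>" by (rule lift_exists[OF \<phi>])
  have G: "\<tau> \<in> carrier (abs_Gal L)" "\<omega> \<in> carrier (abs_Gal L)" using l m by (auto simp: lifts_def)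
  have pw: "\<pi> (\<tau> ^^ k) = s [^] k" for k :: nat
  proof (induction k)
    case (Suc k)
    have "\<pi> (\<tau> ^^ Suc k) = \<pi> (\<tau> ^^ k \<circ> \<tau>)" by (simp only: funpow_Suc_right)
    also have "\<dots> = \<pi> (\<tau> ^^ k) \<otimes> \<pi> \<tau>" by (rule hom_Gal(2)[OF \<pi> abs_Gal_funpow[OF G(1)] G(1)])
    finally show ?case unfolding Suc lifts_values(1)[OF l] nat_pow_Suc .
  qed (use hom_Gal(3)[OF \<pi>] in \<open>simp add: id_def\<close>)
  have "\<pi> (\<omega> \<circ> \<tau>) = \<pi> (\<tau> ^^ q \<circ> \<omega>)"
    using frobenius_relation[OF l m] by (intro pi_agree abs_Gal_comp abs_Gal_funpow G) auto
  hence ts: "t \<otimes> s = s [^] q \<otimes> t"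
    using hom_Gal(2)[OF \<pi>] G abs_Gal_funpow lifts_values(1)[OF l] lifts_values(2)[OF m] pw by metis
  show ?thesis
  proof (induction i)
    case (Suc i)
    have "t \<otimes> s [^] Suc i = s [^] (q * i) \<otimes> (t \<otimes> s)" using Suc by (simp add: m_assoc[symmetric])
    also have "\<dots> = s [^] (q * i) \<otimes> s [^] q \<otimes> t" by (simp add: ts m_assoc)
    finally show ?case by (simp add: nat_pow_mult add.commute)
  qed simp
qed

definition n where "n = ord s"

lemma n_pos: "n > 0"
proof -
  have "s [^] Coset.order G = \<one>" by (rule pow_order_eq_1[OF s_carrier])
  hence "n dvd Coset.order G" by (simp add: n_def pow_eq_id)
  moreover have "Coset.order G > 0" using finG one_closed by (auto simp: Coset.order_def card_gt_0_iff)
  ultimately show ?thesis by (auto intro: gr0I)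
qed

lemma s_pow_n: "s [^] n = \<one>"
  by (simp add: n_def)

text \<open>With g = gcd n q and a = n / g the conjugation relation gives t s^a = s^(q a) t, and n
  divides q a. Hence s^a = 1, so n divides a and g = 1. Now \<zeta> n and rt n are available, and n
  is a unit.\<close>

lemma coprime_n: "coprime n q"
proof -
  define g where "g = gcd n q"
  have "g dvd n" "g dvd q" by (auto simp: g_def)
  then obtain a b where ab: "n = g * a" "q = g * b" by blast
  have "t \<otimes> s [^] a = s [^] (q * a) \<otimes> t" by (rule t_s_pow)
  also have "s [^] (q * a) = (s [^] n) [^] b" by (simp add: nat_pow_pow ab mult_ac)
  finally have "t \<otimes> s [^] a = t" by (simp add: s_pow_n)
  hence "s [^] a = \<one>" by (simp add: r_cancel_one')
  hence "n dvd a" by (simp add: n_def pow_eq_id)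
  hence "g = 1" using ab n_pos by (metis dvd_mult_cancel2 dvd_imp_le mult.commute nat_0_less_mult_iff mult_le_cancel2 nat_dvd_1_iff_1 nat_mult_1 dvd_triv_left)
  then show ?thesis by (simp add: g_def coprime_iff_gcd_eq_1)
qed

section \<open>Fourier coefficients along the cyclic group generated by s\<close>

definition z where "z = \<zeta> n"
definition r where "r = rt n"

lemma z_props: "z ^ n = 1" "z ^ k = 1 \<longleftrightarrow> n dvd k" "z \<in> V" "z \<noteq> 0"
  using zeta_primitive[OF coprime_n] root_of_unity_V[OF _ n_pos, of z] by (auto simp: z_def)

lemma r_props: "r ^ n = u" "r \<noteq> 0" "r \<in> V"
proof -
  show rn: "r ^ n = u" and r0: "r \<noteq> 0" using rt[OF coprime_n] rt_nonzero[OF coprime_n] by (auto simp: r_def)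
  show "r \<in> V"
  proof (rule ccontr)
    assume "r \<notin> V"
    hence "inverse r \<in> nonunits" using val[of r] nonunits_iff[of "inverse r"] r0 by auto
    hence "inverse r ^ n * r ^ n \<in> nonunits"
      using power_nonunits[OF _ n_pos] u_props(3) rn nonunits_V by (intro nonunits_mult') auto
    then show False using r0 by (simp add: power_mult_distrib[symmetric])
  qed
qed

lemma n_unit: "inverse (of_nat n) \<in> V" "(of_nat n :: 'a) \<noteq> 0"
  using coprime_unit[of n] coprime_n unit_inverse[of "of_nat n"] n_pos by (auto simp: coprime_q_iff)

text \<open>For \<open>c = r\<close> this is \<sigma>^i applied to \<beta>_s in closed form,
  periodic in i modulo n. The case \<open>c = inverse r\<close> gives the coefficients of the
  inverse operation.\<close>

definition coef :: "'a \<Rightarrow> nat \<Rightarrow> 'a" where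
  "coef c i = (\<Sum>k<n. z ^ (i * k) * c ^ k) / of_nat n"

lemma coef_periodic: "coef c (i mod n) = coef c i"
proof -
  have "z ^ (i mod n * k) = z ^ (i * k)" for k
  proof -
    have "i * k = n * (i div n * k) + i mod n * k" by (simp add: add_mult_distrib[symmetric] mult.assoc[symmetric])
    then show ?thesis using z_props(1) by (simp add: power_add power_mult)
  qed
  then show ?thesis by (simp add: coef_def)
qed

lemma coef_r_V: "coef r i \<in> V"
  unfolding coef_def divide_inverse using z_props r_props n_unit by (intro mult sum power)

lemma lift_coef_sigma:
  assumes "lifts \<tau> \<sigma>"
  shows "\<tau> (coef r i) = coef r (Suc i)" "\<tau> (coef (inverse r) (Suc i)) = coef (inverse r) i"
proof -
  interpret t: field_auto \<tau> using assms abs_Gal_auto by (auto simp: lifts_def)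
  have d: "\<tau> z = z" "\<tau> r = z * r"
    using assms zeta_Lt[OF coprime_n] rt_Lt[OF coprime_n] \<sigma>_\<zeta>[OF coprime_n] \<sigma>_rt[OF coprime_n]
    by (auto simp: lifts_def z_def r_def)
  show "\<tau> (coef r i) = coef r (Suc i)"
    by (simp add: coef_def d power_mult_distrib power_add mult_ac)
  have "z ^ (Suc i * k) * inverse (z * r) ^ k = z ^ (i * k) * inverse r ^ k" for k
    using z_props(4) by (simp add: power_mult_distrib power_add power_inverse field_simps)
  then show "\<tau> (coef (inverse r) (Suc i)) = coef (inverse r) i"
    by (simp add: coef_def d del: inverse_mult_distrib mult_Suc)
qed

lemma lift_coef_phi:
  assumes "lifts \<tau> \<phi>"
  shows "\<tau> (coef r i) = coef r (q * i)" "\<tau> (coef (inverse r) i) = coef (inverse r) (q * i)"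
proof -
  interpret t: field_auto \<tau> using assms abs_Gal_auto by (auto simp: lifts_def)
  have d: "\<tau> z = z ^ q" "\<tau> r = r"
    using assms zeta_Lt[OF coprime_n] rt_Lt[OF coprime_n] \<phi>_\<zeta>[OF coprime_n] \<phi>_rt[OF coprime_n]
    by (auto simp: lifts_def z_def r_def)
  show "\<tau> (coef r i) = coef r (q * i)" "\<tau> (coef (inverse r) i) = coef (inverse r) (q * i)"
    by (simp_all add: coef_def d power_mult[symmetric] mult.assoc)
qed

text \<open>The resolvend carries a(g) at the inverse of g, so translations by negative powers of s
  occur; naming them keeps all exponents natural.\<close>

definition S :: "nat \<Rightarrow> 'g" where "S i = inv (s [^] i)"

lemma S_carrier [simp]: "S i \<in> carrier G"
  by (simp add: S_def)

lemma S_simps: "S 0 = \<one>" "s \<otimes> S (Suc i) = S i" "S i \<otimes> S j = S (i + j)" "S (Suc i) \<otimes> s = S i"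
proof -
  show "S 0 = \<one>" by (simp add: S_def)
  have 1: "s [^] Suc i = s [^] i \<otimes> s" "s [^] Suc i = s \<otimes> s [^] i" using nat_pow_Suc2[OF s_carrier] by auto
  show "s \<otimes> S (Suc i) = S i" by (simp only: S_def 1(1)) (simp add: inv_mult_group m_assoc[symmetric])
  show "S (Suc i) \<otimes> s = S i" by (simp only: S_def 1(2)) (simp add: inv_mult_group m_assoc)
  show "S i \<otimes> S j = S (i + j)"
    using inv_mult_group[of "s [^] j" "s [^] i"] by (simp add: S_def nat_pow_mult add.commute)
qed

lemma S_periodic: "S (i mod n) = S i"
proof -
  have "s [^] i = s [^] (n * (i div n)) \<otimes> s [^] (i mod n)" by (simp add: nat_pow_mult)
  also have "\<dots> = s [^] (i mod n)" by (simp add: nat_pow_pow[symmetric] s_pow_n)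
  finally show ?thesis by (simp add: S_def)
qed

lemma t_S: "t \<otimes> S i = S (q * i) \<otimes> t"
proof -
  have "S (q * i) \<otimes> t = S (q * i) \<otimes> (t \<otimes> s [^] i) \<otimes> S i"
    by (simp add: S_def m_assoc)
  also have "\<dots> = S (q * i) \<otimes> s [^] (q * i) \<otimes> t \<otimes> S i" by (simp add: t_s_pow m_assoc)
  also have "\<dots> = t \<otimes> S i" by (simp add: S_def)
  finally show ?thesis by simp
qed

lemma S_n: "S n = S 0" and coef_n: "coef c n = coef c 0"
  using S_periodic[of n] coef_periodic[of c n] by simp_all

lemma galois_algebraD:
  assumes "f \<in> galois_algebra L G \<rho>"
  shows "f \<in> extensional (carrier G)"
    "\<tau> \<in> carrier (abs_Gal L) \<Longrightarrow> \<gamma> \<in> carrier G \<Longrightarrow> \<tau> (f \<gamma>) = f (\<rho> \<tau> \<otimes> \<gamma>)"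
  using assms by (auto simp: galois_algebra_def PiE_def)

text \<open>The automorphisms at which f is equivariant form a subgroup. It contains the stabiliser
  of finitely many elements, namely the values of f and a set controlling \<rho>, so the lifts
  suffice.\<close>

lemma galois_algebraI:
  assumes \<rho>: "continuous_hom L G \<rho>" and f: "f \<in> extensional (carrier G)"
    and lifts: "\<And>\<tau> \<gamma>. lifts \<tau> \<sigma> \<Longrightarrow> \<gamma> \<in> carrier G \<Longrightarrow> \<tau> (f \<gamma>) = f (\<rho> \<tau> \<otimes> \<gamma>)"
      "\<And>\<tau> \<gamma>. lifts \<tau> \<phi> \<Longrightarrow> \<gamma> \<in> carrier G \<Longrightarrow> \<tau> (f \<gamma>) = f (\<rho> \<tau> \<otimes> \<gamma>)"
  shows "f \<in> galois_algebra L G \<rho>"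
proof -
  define T where "T = {\<tau> \<in> carrier (abs_Gal L). \<forall>\<gamma>\<in>carrier G. \<tau> (f \<gamma>) = f (\<rho> \<tau> \<otimes> \<gamma>)}"
  obtain Z where Z: "finite Z" "\<And>\<tau>. \<tau> \<in> carrier (abs_Gal L) \<Longrightarrow> \<forall>x\<in>Z. \<tau> x = x \<Longrightarrow> \<rho> \<tau> = \<one>"
    by (rule continuous_hom_kernel[OF \<rho> group_axioms L]) (rule that)
  have "\<tau> \<in> T" if \<tau>: "\<tau> \<in> carrier (abs_Gal L)" for \<tau>
  proof (rule generated_by_lifts[OF _ _ _ _ _ _ _ \<tau>, where Z = "Z \<union> f ` carrier G"])
    show "T \<subseteq> carrier (abs_Gal L)" by (auto simp: T_def)
    show "finite (Z \<union> f ` carrier G)" using Z(1) finG by simp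
    show "\<tau> \<in> T" if "\<tau> \<in> carrier (abs_Gal L)" "\<forall>x\<in>Z \<union> f ` carrier G. \<tau> x = x" for \<tau>
      using Z(2)[OF that(1)] that by (auto simp: T_def)
    show "\<tau> \<circ> \<omega> \<in> T" if "\<tau> \<in> T" "\<omega> \<in> T" for \<tau> \<omega>
      using that hom_Gal(1,2)[OF \<rho>] by (auto simp: T_def m_assoc intro: abs_Gal_comp)
    show "Hilbert_Choice.inv \<tau> \<in> T" if "\<tau> \<in> T" for \<tau>
    proof -
      have \<tau>: "\<tau> \<in> carrier (abs_Gal L)" using that by (simp add: T_def)
      have "Hilbert_Choice.inv \<tau> (f \<gamma>) = f (inv (\<rho> \<tau>) \<otimes> \<gamma>)" if g: "\<gamma> \<in> carrier G" for \<gamma>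
      proof -
        have c: "\<rho> \<tau> \<in> carrier G" by (rule hom_Gal(1)[OF \<rho> \<tau>])
        have "\<tau> (f (inv (\<rho> \<tau>) \<otimes> \<gamma>)) = f (\<rho> \<tau> \<otimes> (inv (\<rho> \<tau>) \<otimes> \<gamma>))"
          using \<open>\<tau> \<in> T\<close> c g by (simp add: T_def)
        also have "\<rho> \<tau> \<otimes> (inv (\<rho> \<tau>) \<otimes> \<gamma>) = \<gamma>" using c g by (simp add: m_assoc[symmetric])
        finally show ?thesis using abs_Gal_inv_apply(2)[OF \<tau>] by metis
      qed
      then show ?thesis using abs_Gal_inv[OF \<tau>] hom_Gal(4)[OF \<rho> \<tau>] by (simp add: T_def)
    qed
    show "\<tau> \<in> T" if "lifts \<tau> \<sigma>" for \<tau> using lifts(1)[OF that] that by (simp add: T_def lifts_def)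
    show "\<tau> \<in> T" if "lifts \<tau> \<phi>" for \<tau> using lifts(2)[OF that] that by (simp add: T_def lifts_def)
  qed
  then show ?thesis using f by (auto simp: galois_algebra_def PiE_def T_def)
qed

text \<open>For \<open>c = r\<close> this is multiplication by the resolvend of \<varphi>_s, as
  \<open>resolvend_product\<close> shows; the parameter \<open>c\<close> lets the inverse operation
  share the definition.\<close>

definition ramify :: "'a \<Rightarrow> ('g \<Rightarrow> 'a) \<Rightarrow> 'g \<Rightarrow> 'a" where
  "ramify c f = (\<lambda>\<gamma>\<in>carrier G. \<Sum>i<n. coef c i * f (S i \<otimes> \<gamma>))"

lemma ramify_apply: "\<gamma> \<in> carrier G \<Longrightarrow> ramify c f \<gamma> = (\<Sum>i<n. coef c i * f (S i \<otimes> \<gamma>))"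
  by (simp add: ramify_def)

text \<open>\<phi> multiplies the index of \<open>coef\<close> by q, and moving t past
  \<open>S i\<close> does the same to the translation; the reindexed sum is unchanged since n and q
  are coprime.\<close>

lemma ramify_phi:
  assumes f: "f \<in> galois_algebra L G \<rho>" and l: "lifts \<tau> \<phi>" and \<rho>: "\<rho> \<tau> = t" and c: "c \<in> {r, inverse r}"
    and \<gamma>: "\<gamma> \<in> carrier G"
  shows "\<tau> (ramify c f \<gamma>) = ramify c f (t \<otimes> \<gamma>)"
proof -
  have \<tau>: "\<tau> \<in> carrier (abs_Gal L)" using l by (simp add: lifts_def)
  interpret t: field_auto \<tau> using \<tau> by (rule abs_Gal_auto)
  have "\<tau> (ramify c f \<gamma>) = (\<Sum>i<n. coef c (q * i) * f (t \<otimes> (S i \<otimes> \<gamma>)))"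
    using \<gamma> c lift_coef_phi[OF l] galois_algebraD(2)[OF f \<tau>] \<rho> by (auto simp: ramify_apply)
  also have "\<dots> = (\<Sum>i<n. coef c (q * i) * f (S (q * i) \<otimes> (t \<otimes> \<gamma>)))"
    using \<gamma> t_S by (simp add: m_assoc[symmetric])
  also have "\<dots> = (\<Sum>i<n. coef c i * f (S i \<otimes> (t \<otimes> \<gamma>)))"
    by (rule sum_cyclic_scale[OF coprime_n, of "\<lambda>i. coef c i * f (S i \<otimes> (t \<otimes> \<gamma>))"])
      (simp add: coef_periodic S_periodic)
  finally show ?thesis using \<gamma> by (simp add: ramify_apply)
qed

text \<open>A lift of \<sigma> fixes the values of f and raises the index of the coefficients by
  one; the shift reappears as a translation by s.\<close>

lemma ramify_galois:
  assumes f: "f \<in> galois_algebra L G \<pi>nr" shows "ramify r f \<in> galois_algebra L G \<pi>"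
proof (rule galois_algebraI[OF \<pi>])
  show "ramify r f \<in> extensional (carrier G)" by (simp add: ramify_def)
  fix \<tau> \<gamma> assume l: "lifts \<tau> \<sigma>" and \<gamma>: "\<gamma> \<in> carrier G"
  have \<tau>: "\<tau> \<in> carrier (abs_Gal L)" using l by (simp add: lifts_def)
  interpret t: field_auto \<tau> using \<tau> by (rule abs_Gal_auto)
  have "\<tau> (ramify r f \<gamma>) = (\<Sum>i<n. coef r (Suc i) * f (S i \<otimes> \<gamma>))"
    using \<gamma> lift_coef_sigma[OF l] galois_algebraD(2)[OF f \<tau>] lifts_values(3)[OF l] by (simp add: ramify_apply)
  also have "\<dots> = (\<Sum>i<n. coef r (Suc i) * f (S (Suc i) \<otimes> (s \<otimes> \<gamma>)))"
    using \<gamma> S_simps(4) by (simp add: m_assoc[symmetric])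
  also have "\<dots> = (\<Sum>i<n. coef r i * f (S i \<otimes> (s \<otimes> \<gamma>)))"
    by (rule sum_cyclic_shift[of "\<lambda>i. coef r i * f (S i \<otimes> (s \<otimes> \<gamma>))"]) (simp add: coef_n S_n)
  finally show "\<tau> (ramify r f \<gamma>) = ramify r f (\<pi> \<tau> \<otimes> \<gamma>)" using \<gamma> lifts_values(1)[OF l] by (simp add: ramify_apply)
next
  fix \<tau> \<gamma> assume "lifts \<tau> \<phi>" "\<gamma> \<in> carrier G"
  then show "\<tau> (ramify r f \<gamma>) = ramify r f (\<pi> \<tau> \<otimes> \<gamma>)"
    using ramify_phi[OF f] lifts_values(2,4) by simp
qed

text \<open>Here a lift of \<sigma> lowers the index of the coefficients and translates the values
  of f by s; the two effects cancel.\<close>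

lemma unramify_galois:
  assumes f: "f \<in> galois_algebra L G \<pi>" shows "ramify (inverse r) f \<in> galois_algebra L G \<pi>nr"
proof (rule galois_algebraI[OF \<pi>nr])
  show "ramify (inverse r) f \<in> extensional (carrier G)" by (simp add: ramify_def)
  fix \<tau> \<gamma> assume l: "lifts \<tau> \<sigma>" and \<gamma>: "\<gamma> \<in> carrier G"
  have \<tau>: "\<tau> \<in> carrier (abs_Gal L)" using l by (simp add: lifts_def)
  interpret t: field_auto \<tau> using \<tau> by (rule abs_Gal_auto)
  have "ramify (inverse r) f \<gamma> = (\<Sum>i<n. coef (inverse r) (Suc i) * f (S (Suc i) \<otimes> \<gamma>))"
    unfolding ramify_apply[OF \<gamma>]
    by (rule sum_cyclic_shift[of "\<lambda>i. coef (inverse r) i * f (S i \<otimes> \<gamma>)", symmetric]) (simp add: coef_n S_n)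
  hence "\<tau> (ramify (inverse r) f \<gamma>) = (\<Sum>i<n. coef (inverse r) i * f (s \<otimes> (S (Suc i) \<otimes> \<gamma>)))"
    using \<gamma> lift_coef_sigma[OF l] galois_algebraD(2)[OF f \<tau>] lifts_values(1)[OF l] by simp
  also have "\<dots> = (\<Sum>i<n. coef (inverse r) i * f (S i \<otimes> \<gamma>))"
    using \<gamma> S_simps(2) by (simp add: m_assoc[symmetric])
  finally show "\<tau> (ramify (inverse r) f \<gamma>) = ramify (inverse r) f (\<pi>nr \<tau> \<otimes> \<gamma>)"
    using \<gamma> lifts_values(3)[OF l] by (simp add: ramify_apply)
next
  fix \<tau> \<gamma> assume "lifts \<tau> \<phi>" "\<gamma> \<in> carrier G"
  then show "\<tau> (ramify (inverse r) f \<gamma>) = ramify (inverse r) f (\<pi>nr \<tau> \<otimes> \<gamma>)"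
    using ramify_phi[OF f] lifts_values(2,4) by simp
qed

text \<open>The component of f that is multiplied by z^k when \<gamma> is replaced by s
  \<gamma>.\<close>

definition isotypic :: "('g \<Rightarrow> 'a) \<Rightarrow> nat \<Rightarrow> 'g \<Rightarrow> 'a" where
  "isotypic f k \<gamma> = (\<Sum>i<n. z ^ (i * k) * f (S i \<otimes> \<gamma>)) / of_nat n"

text \<open>Interchanging the two sums shows that the operation multiplies the k-th component by
  r^(-k).\<close>

lemma unramify_eq:
  assumes "\<gamma> \<in> carrier G"
  shows "ramify (inverse r) f \<gamma> = (\<Sum>k<n. inverse r ^ k * isotypic f k \<gamma>)"
proof -
  have "ramify (inverse r) f \<gamma> = (\<Sum>i<n. \<Sum>k<n. inverse r ^ k * (z ^ (i * k) * f (S i \<otimes> \<gamma>) / of_nat n))"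
    unfolding ramify_apply[OF assms] coef_def sum_divide_distrib sum_distrib_right
    by (intro sum.cong refl) (simp add: mult_ac)
  also have "\<dots> = (\<Sum>k<n. \<Sum>i<n. inverse r ^ k * (z ^ (i * k) * f (S i \<otimes> \<gamma>) / of_nat n))" by (rule sum.swap)
  finally show ?thesis by (simp add: isotypic_def sum_distrib_left sum_divide_distrib)
qed

lemma isotypic_shift:
  assumes \<gamma>: "\<gamma> \<in> carrier G"
  shows "z ^ (l * k) * isotypic f k (S l \<otimes> \<gamma>) = isotypic f k \<gamma>"
proof -
  have one: "z ^ k * isotypic f k (S 1 \<otimes> \<delta>) = isotypic f k \<delta>" if \<delta>: "\<delta> \<in> carrier G" for \<delta>
  proof -
    have "z ^ k * (\<Sum>i<n. z ^ (i * k) * f (S i \<otimes> (S 1 \<otimes> \<delta>))) = (\<Sum>i<n. z ^ (Suc i * k) * f (S (Suc i) \<otimes> \<delta>))"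
      using \<delta> by (simp add: sum_distrib_left power_add mult_ac m_assoc[symmetric] S_simps)
    also have "\<dots> = (\<Sum>i<n. z ^ (i * k) * f (S i \<otimes> \<delta>))"
      by (rule sum_cyclic_shift[of "\<lambda>i. z ^ (i * k) * f (S i \<otimes> \<delta>)"]) (simp add: S_n power_mult z_props)
    finally show ?thesis by (simp add: isotypic_def)
  qed
  show ?thesis
  proof (induction l)
    case (Suc l)
    have "S (Suc l) \<otimes> \<gamma> = S 1 \<otimes> (S l \<otimes> \<gamma>)" using \<gamma> by (simp add: m_assoc[symmetric] S_simps)
    hence "z ^ (Suc l * k) * isotypic f k (S (Suc l) \<otimes> \<gamma>) = z ^ (l * k) * (z ^ k * isotypic f k (S 1 \<otimes> (S l \<otimes> \<gamma>)))"
      by (simp add: power_add mult_ac)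
    then show ?case using one[of "S l \<otimes> \<gamma>"] \<gamma> Suc by simp
  qed (use \<gamma> in \<open>simp add: S_simps\<close>)
qed

lemma ramify_unramify:
  assumes f: "f \<in> extensional (carrier G)" shows "ramify r (ramify (inverse r) f) = f"
proof
  fix \<gamma>
  show "ramify r (ramify (inverse r) f) \<gamma> = f \<gamma>"
  proof (cases "\<gamma> \<in> carrier G")
    case \<gamma>: True
    have iso: "isotypic f k (S l \<otimes> \<gamma>) = inverse z ^ (l * k) * isotypic f k \<gamma>" for k l
      using isotypic_shift[OF \<gamma>, of l k f] z_props(4) by (simp add: power_inverse field_simps)
    \<comment> \<open>Orthogonality of characters: \<open>ramify r\<close> multiplies the k-th
      component by r^k, which cancels the factor r^(-k) from the first operation.\<close>
    have orth: "(\<Sum>l<n. coef r l * inverse z ^ (l * k)) = r ^ k" if k: "k < n" for k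
    proof -
      have inner: "(\<Sum>l<n. z ^ (l * m) * inverse z ^ (l * k)) = (if m = k then of_nat n else 0)" if m: "m < n" for m
      proof -
        define x where "x = z ^ m * inverse z ^ k"
        have "x ^ n = 1" using z_props(1) by (simp add: x_def power_mult_distrib power_inverse power_mult[symmetric] mult.commute[of _ n]) (simp add: power_mult)
        moreover have "x = 1 \<longleftrightarrow> m = k"
        proof
          assume "x = 1"
          hence mk: "z ^ m = z ^ k" using z_props(4) by (simp add: x_def power_inverse field_simps)
          have *: "a = b" if "a \<le> b" "b < n" "z ^ a = z ^ b" for a b
          proof -
            have "z ^ (b - a) = 1" using that z_props(4) by (simp add: power_diff)
            hence "n dvd b - a" using z_props(2) by blast
            then show ?thesis using that by (auto dest: dvd_imp_le)
          qed
          show "m = k" using *[of m k] *[of k m] mk m k by (cases "m \<le> k") auto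
        qed (use z_props(4) in \<open>simp add: x_def power_inverse\<close>)
        moreover have "z ^ (l * m) * inverse z ^ (l * k) = x ^ l" for l
          by (simp add: x_def power_mult_distrib power_mult[symmetric] mult.commute)
        ultimately show ?thesis using sum_powers_root_of_unity[of x n] by simp
      qed
      have "(\<Sum>l<n. coef r l * inverse z ^ (l * k)) = (\<Sum>l<n. \<Sum>m<n. r ^ m * (z ^ (l * m) * inverse z ^ (l * k)) / of_nat n)"
        unfolding coef_def sum_divide_distrib sum_distrib_right by (intro sum.cong refl) (simp add: mult_ac)
      also have "\<dots> = (\<Sum>m<n. \<Sum>l<n. r ^ m * (z ^ (l * m) * inverse z ^ (l * k)) / of_nat n)" by (rule sum.swap)
      also have "\<dots> = (\<Sum>m<n. r ^ m * (if m = k then of_nat n else 0) / of_nat n)"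
        using inner by (intro sum.cong refl) (simp add: sum_distrib_left[symmetric] sum_divide_distrib[symmetric])
      also have "\<dots> = r ^ k" using k n_unit(2) by (simp add: if_distrib if_distribR cong: if_cong)
      finally show ?thesis .
    qed
    have "ramify r (ramify (inverse r) f) \<gamma> = (\<Sum>l<n. \<Sum>k<n. coef r l * inverse z ^ (l * k) * (inverse r ^ k * isotypic f k \<gamma>))"
      using \<gamma> by (simp add: ramify_apply[of \<gamma>] unramify_eq iso sum_distrib_left mult_ac)
    also have "\<dots> = (\<Sum>k<n. \<Sum>l<n. coef r l * inverse z ^ (l * k) * (inverse r ^ k * isotypic f k \<gamma>))" by (rule sum.swap)
    also have "\<dots> = (\<Sum>k<n. r ^ k * (inverse r ^ k * isotypic f k \<gamma>))"
      by (intro sum.cong refl) (simp add: sum_distrib_right[symmetric] orth)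
    also have "\<dots> = (\<Sum>k<n. isotypic f k \<gamma>)" using r_props(2) by (simp add: mult.assoc[symmetric] power_mult_distrib[symmetric])
    \<comment> \<open>The components add up to f, because the sum of z^(i k) over k vanishes unless
      i = 0.\<close>
    also have "\<dots> = (\<Sum>k<n. \<Sum>i<n. (z ^ i) ^ k * f (S i \<otimes> \<gamma>) / of_nat n)"
      by (simp add: isotypic_def sum_divide_distrib power_mult)
    also have "\<dots> = (\<Sum>i<n. \<Sum>k<n. (z ^ i) ^ k * f (S i \<otimes> \<gamma>) / of_nat n)" by (rule sum.swap)
    also have "\<dots> = (\<Sum>i<n. (if i = 0 then of_nat n else 0) * f (S i \<otimes> \<gamma>) / of_nat n)"
    proof (intro sum.cong refl)
      fix i assume i: "i \<in> {..<n}"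
      have "(z ^ i) ^ n = 1" using z_props(1) by (metis mult.commute power_mult power_one)
      moreover have "z ^ i = 1 \<longleftrightarrow> i = 0" using z_props(2) i by (auto dest: dvd_imp_le)
      ultimately show "(\<Sum>k<n. (z ^ i) ^ k * f (S i \<otimes> \<gamma>) / of_nat n) = (if i = 0 then of_nat n else 0) * f (S i \<otimes> \<gamma>) / of_nat n"
        using sum_powers_root_of_unity[of "z ^ i" n] by (simp add: sum_distrib_right[symmetric] sum_divide_distrib[symmetric])
    qed
    also have "\<dots> = f \<gamma>" using n_pos n_unit(2) \<gamma> by (simp add: if_distrib if_distribR S_simps cong: if_cong)
    finally show ?thesis .
  qed (use f in \<open>auto simp: ramify_def extensional_def\<close>)
qed

text \<open>
  Each summand \<open>r\<^sup>-\<^sup>k f\<^sub>k\<close> is invariant under the lifts of \<open>\<sigma>\<close>, so its value is an integral power of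
  that of \<open>u\<close>. Since \<open>k < n\<close> and \<open>f\<^sub>k\<close> is integral, this power is non-negative.
\<close>

lemma unramify_integral:
  assumes f: "f \<in> galois_algebra L G \<pi>" and int: "\<And>\<gamma>. \<gamma> \<in> carrier G \<Longrightarrow> f \<gamma> \<in> V" and \<gamma>: "\<gamma> \<in> carrier G"
  shows "ramify (inverse r) f \<gamma> \<in> V"
  unfolding unramify_eq[OF \<gamma>]
proof (rule sum)
  fix k assume "k \<in> {..<n}"
  hence k: "k < n" by simp
  define y where "y = inverse r ^ k * isotypic f k \<gamma>"
  have iV: "isotypic f k \<gamma> \<in> V" unfolding isotypic_def divide_inverse
    using int \<gamma> n_unit z_props by (intro mult sum power) auto
  show "y \<in> V"
  proof (cases "y = 0")
    case False
    have inv: "\<tau> y = y" if l: "lifts \<tau> \<sigma>" for \<tau>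
    proof -
      have \<tau>: "\<tau> \<in> carrier (abs_Gal L)" using l by (simp add: lifts_def)
      interpret t: field_auto \<tau> using \<tau> by (rule abs_Gal_auto)
      have d: "\<tau> z = z" "\<tau> r = z * r"
        using l zeta_Lt[OF coprime_n] rt_Lt[OF coprime_n] \<sigma>_\<zeta>[OF coprime_n] \<sigma>_rt[OF coprime_n]
        by (auto simp: lifts_def z_def r_def)
      have ss: "s \<otimes> (S i \<otimes> \<delta>) = S i \<otimes> (s \<otimes> \<delta>)" if "\<delta> \<in> carrier G" for i \<delta>
      proof -
        have "s \<otimes> S i = s \<otimes> (S i \<otimes> S 1) \<otimes> s" using S_simps(4)[of 0] by (simp add: S_simps(1) m_assoc)
        also have "\<dots> = S i \<otimes> s" by (simp add: S_simps)
        finally show ?thesis using that by (simp add: m_assoc[symmetric])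
      qed
      have "\<tau> (isotypic f k \<gamma>) = isotypic f k (s \<otimes> \<gamma>)"
        using \<gamma> galois_algebraD(2)[OF f \<tau>] lifts_values(1)[OF l] by (simp add: isotypic_def d ss)
      also have "\<dots> = z ^ k * isotypic f k \<gamma>"
        using isotypic_shift[of "s \<otimes> \<gamma>" 1 k f] \<gamma> S_simps(4)[of 0] by (simp add: S_simps(1) m_assoc[symmetric])
      finally show ?thesis using z_props(4) by (simp add: y_def d power_mult_distrib power_inverse field_simps)
    qed
    obtain j :: int where j: "y / u powi j \<in> V" "y / u powi j \<notin> nonunits"
      by (rule sigma_invariant_value[of y]) (erule inv, rule False, rule that)
    \<comment> \<open>The n-th power turns r^n into u, so that only integral exponents of u are
      compared: integrality of the component becomes k + j n >= 0.\<close>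
    define c where "c = (y / u powi j) ^ n"
    have c: "c \<in> V" "c \<notin> nonunits" using j nonunits_power by (auto simp: c_def)
    have "isotypic f k \<gamma> ^ n = (r ^ n) ^ k * y ^ n"
      using r_props(2) by (simp add: y_def power_mult_distrib power_inverse power_mult[symmetric] mult.commute[of k])
    also have "\<dots> = u ^ k * ((u powi j) ^ n * c)" using u_props(2) by (simp add: r_props c_def power_divide)
    also have "\<dots> = u powi (int k + j * int n) * c"
      using u_props(2) by (simp add: power_int_add power_int_mult mult.assoc)
    finally have "u powi (int k + j * int n) * c \<in> V" using iV power[of "isotypic f k \<gamma>" n] by simp
    hence kj: "int k + j * int n \<ge> 0" using power_int_nonunit(1)[OF u_props(3,2) c] by simp
    \<comment> \<open>The range k < n of the exponents in \<beta>_s is decisive here: k + j n >= 0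
      leaves no room for a negative j.\<close>
    have "j \<ge> 0"
    proof (rule ccontr)
      assume "\<not> j \<ge> 0"
      hence "j * int n \<le> - 1 * int n" by (intro mult_right_mono) auto
      then show False using kj k by simp
    qed
    hence "u powi j * (y / u powi j) \<in> V" using power_int_nonunit(1)[OF u_props(3,2) j] by blast
    moreover have "u powi j * (y / u powi j) = y" using u_props(2) by simp
    ultimately show ?thesis by (simp only:)
  qed simp
qed

lemma ramify_integral:
  assumes "\<And>\<gamma>. \<gamma> \<in> carrier G \<Longrightarrow> f \<gamma> \<in> V" "\<gamma> \<in> carrier G" shows "ramify r f \<gamma> \<in> V"
  unfolding ramify_apply[OF assms(2)] using assms coef_r_V by (intro sum mult) auto

lemma s_pow_inj: "inj_on (\<lambda>i. s [^] i) {..<n}"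
proof (rule linorder_inj_onI)
  fix i j assume ij: "i < j" "i \<in> {..<n}" "j \<in> {..<n}"
  show "s [^] i \<noteq> s [^] j"
  proof
    assume "s [^] i = s [^] j"
    hence "s [^] (j - i) = \<one>" using pow_eq_div2[of s j i] by simp
    hence "n dvd j - i" by (simp add: n_def pow_eq_id)
    then show False using ij by (auto dest: dvd_imp_le)
  qed
qed auto

text \<open>The least exponent chosen by \<open>orbit_map\<close> agrees with i modulo n, and
  \<open>coef\<close> is periodic, so the choice has no effect.\<close>

lemma orbit_map_eval:
  "orbit_map G s \<sigma> (kummer_element rt n) (s [^] i) = coef r i"
proof -
  obtain \<tau> where l: "lifts \<tau> \<sigma>" by (rule lift_exists[OF \<sigma>])
  \<comment> \<open>\<sigma> is meaningful only on \<open>Lt\<close>, so each iterate has to stay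
    there before a lift can take its place.\<close>
  have cL: "coef r i \<in> Lt" for i
    unfolding coef_def using zeta_Lt[OF coprime_n] rt_Lt[OF coprime_n]
    by (intro Lt.divide Lt.sum Lt.mult Lt.power) (auto simp: z_def r_def)
  have iter: "(\<sigma> ^^ i) (coef r 0) = coef r i" for i
  proof (induction i)
    case (Suc i)
    have "\<tau> (coef r i) = \<sigma> (coef r i)" using l cL by (simp add: lifts_def)
    then show ?case using Suc lift_coef_sigma(1)[OF l, of i] by simp
  qed simp
  have beta: "kummer_element rt n = coef r 0" by (simp add: kummer_element_def coef_def r_def)
  define j :: nat where "j = (LEAST j. s [^] i = s [^] j)"
  have j: "s [^] i = s [^] j" unfolding j_def by (rule LeastI[of "\<lambda>j. s [^] i = s [^] j" i]) simp
  have "i mod n = j mod n"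
  proof -
    have red: "s [^] m = s [^] (m mod n)" for m
      using nat_pow_mult[OF s_carrier, of "n * (m div n)" "m mod n"] by (simp add: nat_pow_pow[symmetric] s_pow_n)
    have "s [^] (i mod n) = s [^] (j mod n)" using j red by metis
    then show ?thesis using inj_onD[OF s_pow_inj] n_pos by auto
  qed
  hence "coef r i = coef r j" using coef_periodic by metis
  then show ?thesis unfolding orbit_map_def beta using iter[of j] by (auto simp: j_def)
qed

lemma resolvend_product:
  assumes a: "a \<in> extensional (carrier G)"
    and eq: "resolvend G a = group_algebra_mult G (resolvend G f) (resolvend G (orbit_map G s \<sigma> (kummer_element rt n)))"
  shows "a = ramify r f"
proof
  fix \<gamma>
  define \<psi> where "\<psi> = orbit_map G s \<sigma> (kummer_element rt n)"
  show "a \<gamma> = ramify r f \<gamma>"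
  proof (cases "\<gamma> \<in> carrier G")
    case \<gamma>: True
    have "a \<gamma> = resolvend G a (inv \<gamma>)" using \<gamma> by (simp add: resolvend_def)
    also have "\<dots> = (\<Sum>g\<in>carrier G. f (inv g) * \<psi> (\<gamma> \<otimes> g))"
      unfolding eq group_algebra_mult_def using \<gamma>
      by (simp add: resolvend_def inv_mult_group \<psi>_def)
    \<comment> \<open>The substitution h = \<gamma> g makes h the argument of \<varphi>_s, so that
      the sum can be restricted to its support.\<close>
    also have "\<dots> = (\<Sum>h\<in>carrier G. f (inv h \<otimes> \<gamma>) * \<psi> h)"
    proof -
      have "inv (\<gamma> \<otimes> g) \<otimes> \<gamma> = inv g" "inv \<gamma> \<otimes> (\<gamma> \<otimes> g) = g" "\<gamma> \<otimes> (inv \<gamma> \<otimes> g) = g"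
        if "g \<in> carrier G" for g
        using \<gamma> that inv_mult_group[of \<gamma> g] by (simp_all add: m_assoc, simp_all add: m_assoc[symmetric])
      then show ?thesis
        using \<gamma> by (intro sum.reindex_bij_witness[of _ "\<lambda>h. inv \<gamma> \<otimes> h" "\<lambda>g. \<gamma> \<otimes> g"]) auto
    qed
    also have "\<dots> = (\<Sum>h\<in>(\<lambda>i. s [^] i) ` {..<n}. f (inv h \<otimes> \<gamma>) * \<psi> h)"
    proof (rule sum.mono_neutral_right[OF finG])
      show "\<forall>h\<in>carrier G - (\<lambda>i. s [^] i) ` {..<n}. f (inv h \<otimes> \<gamma>) * \<psi> h = 0"
      proof
        fix h assume h: "h \<in> carrier G - (\<lambda>i. s [^] i) ` {..<n}"
        have "h \<noteq> s [^] i" for i :: nat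
        proof
          assume "h = s [^] i"
          hence "h = s [^] (i mod n)"
            using nat_pow_mult[OF s_carrier, of "n * (i div n)" "i mod n"] by (simp add: nat_pow_pow[symmetric] s_pow_n)
          then show False using h n_pos by auto
        qed
        then show "f (inv h \<otimes> \<gamma>) * \<psi> h = 0" using h by (simp add: \<psi>_def orbit_map_def)
      qed
    qed auto
    also have "\<dots> = (\<Sum>i<n. coef r i * f (S i \<otimes> \<gamma>))"
      by (simp add: sum.reindex[OF s_pow_inj] \<psi>_def orbit_map_eval S_def mult.commute)
    finally show ?thesis using \<gamma> by (simp add: ramify_apply)
  qed (use a in \<open>auto simp: ramify_def extensional_def\<close>)
qed

text \<open>\<open>ramify\<close> translates on the left and the group ring acts by translations on
  the right, so the two commute.\<close>

lemma ramify_orbit: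
  assumes c: "c \<in> carrier G \<rightarrow> V \<inter> L"
    and d: "d = (\<lambda>\<gamma>\<in>carrier G. \<Sum>g\<in>carrier G. c g * f (\<gamma> \<otimes> g))"
  shows "ramify r d = (\<lambda>\<gamma>\<in>carrier G. \<Sum>g\<in>carrier G. c g * ramify r f (\<gamma> \<otimes> g))"
proof
  fix \<gamma>
  show "ramify r d \<gamma> = (\<lambda>\<gamma>\<in>carrier G. \<Sum>g\<in>carrier G. c g * ramify r f (\<gamma> \<otimes> g)) \<gamma>"
  proof (cases "\<gamma> \<in> carrier G")
    case \<gamma>: True
    have "ramify r d \<gamma> = (\<Sum>i<n. \<Sum>g\<in>carrier G. c g * (coef r i * f (S i \<otimes> \<gamma> \<otimes> g)))"
      using \<gamma> by (simp add: ramify_apply d sum_distrib_left mult_ac)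
    also have "\<dots> = (\<Sum>g\<in>carrier G. \<Sum>i<n. c g * (coef r i * f (S i \<otimes> \<gamma> \<otimes> g)))" by (rule sum.swap)
    also have "\<dots> = (\<Sum>g\<in>carrier G. c g * ramify r f (\<gamma> \<otimes> g))"
      using \<gamma> by (intro sum.cong refl) (simp add: ramify_apply sum_distrib_left m_assoc)
    finally show ?thesis using \<gamma> by simp
  qed (simp add: ramify_def)
qed

lemma integers_eq: "algebra_integers (V \<inter> L) L G \<rho> = {a \<in> galois_algebra L G \<rho>. \<forall>\<gamma>\<in>carrier G. a \<gamma> \<in> V}"
  by (rule algebra_integers_eq[OF L.subfield_of_axioms integral finG])

text \<open>A generator lies in its own orbit; this is how its values are known to be
  integral.\<close>

lemma orbit_self:
  assumes "f \<in> extensional (carrier G)" shows "f \<in> group_ring_orbit (V \<inter> L) G f"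
proof -
  define c :: "'g \<Rightarrow> 'a" where "c g = (if g = \<one> then 1 else 0)" for g
  have "(\<Sum>g\<in>carrier G. c g * f (\<gamma> \<otimes> g)) = f \<gamma>" if "\<gamma> \<in> carrier G" for \<gamma>
    using that finG by (simp add: c_def if_distribR if_distrib sum.delta cong: if_cong)
  then have "f = (\<lambda>\<gamma>\<in>carrier G. \<Sum>g\<in>carrier G. c g * f (\<gamma> \<otimes> g))" using assms by (auto simp: extensional_def)
  moreover have "c \<in> carrier G \<rightarrow> V \<inter> L" by (auto simp: c_def)
  ultimately show ?thesis unfolding group_ring_orbit_def by blast
qed

lemma orbit_integral:
  assumes \<rho>: "continuous_hom L G \<rho>" and f: "f \<in> galois_algebra L G \<rho>" "\<And>\<gamma>. \<gamma> \<in> carrier G \<Longrightarrow> f \<gamma> \<in> V"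
    and h: "h \<in> group_ring_orbit (V \<inter> L) G f"
  shows "h \<in> galois_algebra L G \<rho>" "\<gamma> \<in> carrier G \<Longrightarrow> h \<gamma> \<in> V"
proof -
  obtain c where c: "c \<in> carrier G \<rightarrow> V \<inter> L" and hc: "h = (\<lambda>\<gamma>\<in>carrier G. \<Sum>g\<in>carrier G. c g * f (\<gamma> \<otimes> g))"
    using h by (auto simp: group_ring_orbit_def)
  show "h \<gamma> \<in> V" if "\<gamma> \<in> carrier G" for \<gamma>
    using that c f(2) unfolding hc by (auto intro!: sum mult)
  have "h (\<rho> \<tau> \<otimes> \<gamma>) = \<tau> (h \<gamma>)" if \<gamma>: "\<gamma> \<in> carrier G" and \<tau>: "\<tau> \<in> carrier (abs_Gal L)" for \<gamma> \<tau>
  proof -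
    interpret t: field_auto \<tau> using \<tau> by (rule abs_Gal_auto)
    have "\<tau> (c g) = c g" if "g \<in> carrier G" for g using c that abs_Gal_fix[OF \<tau>] by blast
    then show ?thesis
      using \<gamma> hom_Gal(1)[OF \<rho> \<tau>] galois_algebraD(2)[OF f(1) \<tau>] by (simp add: hc m_assoc)
  qed
  then show "h \<in> galois_algebra L G \<rho>" by (auto simp: galois_algebra_def hc)
qed

text \<open>The same group ring coefficients serve on both sides, because \<open>ramify\<close>
  commutes with the group ring. The inverse operation is what shows that \<open>ramify r\<close>
  reaches every integral element for \<open>\<pi>\<close>.\<close>

theorem nib_generator_ramify:
  assumes f: "nib_generator (V \<inter> L) L G \<pi>nr f"
  shows "nib_generator (V \<inter> L) L G \<pi> (ramify r f)"
proof -
  have fG: "f \<in> galois_algebra L G \<pi>nr" and fO: "algebra_integers (V \<inter> L) L G \<pi>nr = group_ring_orbit (V \<inter> L) G f"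
    using f by (auto simp: nib_generator_def)
  have fV: "f \<gamma> \<in> V" if "\<gamma> \<in> carrier G" for \<gamma>
    using orbit_self[OF galois_algebraD(1)[OF fG]] that unfolding fO[symmetric] integers_eq by blast
  have rG: "ramify r f \<in> galois_algebra L G \<pi>" by (rule ramify_galois[OF fG])
  have rV: "ramify r f \<gamma> \<in> V" if "\<gamma> \<in> carrier G" for \<gamma> by (rule ramify_integral[OF fV that])
  have "algebra_integers (V \<inter> L) L G \<pi> = group_ring_orbit (V \<inter> L) G (ramify r f)"
  proof (intro equalityI subsetI)
    fix h assume "h \<in> algebra_integers (V \<inter> L) L G \<pi>"
    hence h: "h \<in> galois_algebra L G \<pi>" "\<And>\<gamma>. \<gamma> \<in> carrier G \<Longrightarrow> h \<gamma> \<in> V" by (auto simp: integers_eq)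
    define d where "d = ramify (inverse r) h"
    have "d \<in> algebra_integers (V \<inter> L) L G \<pi>nr"
      unfolding integers_eq d_def using unramify_galois[OF h(1)] unramify_integral[OF h] by blast
    then obtain c where c: "c \<in> carrier G \<rightarrow> V \<inter> L" "d = (\<lambda>\<gamma>\<in>carrier G. \<Sum>g\<in>carrier G. c g * f (\<gamma> \<otimes> g))"
      unfolding fO group_ring_orbit_def by blast
    have "h = ramify r d" using ramify_unramify[OF galois_algebraD(1)[OF h(1)]] by (simp add: d_def)
    then show "h \<in> group_ring_orbit (V \<inter> L) G (ramify r f)"
      unfolding group_ring_orbit_def using ramify_orbit[OF c] c(1) by blast
  next
    fix h assume "h \<in> group_ring_orbit (V \<inter> L) G (ramify r f)"
    from orbit_integral[OF \<pi> rG rV this] show "h \<in> algebra_integers (V \<inter> L) L G \<pi>"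
      unfolding integers_eq by blast
  qed
  then show ?thesis using rG by (simp add: nib_generator_def)
qed

end

theorem theorem6p6:
  fixes p q :: nat
    and v :: "'k::{alg_closed_field, field_char_0} \<Rightarrow> real"
    and Qp L OL Lt Lnr :: "'k set"
    and unif :: 'k
    and \<zeta> rt :: "nat \<Rightarrow> 'k"
    and \<phi> \<sigma> :: "'k \<Rightarrow> 'k"
    and G :: "('g, 'm) monoid_scheme"
    and \<pi> \<pi>' \<pi>nr \<pi>nr' :: "('k \<Rightarrow> 'k) \<Rightarrow> 'g"
    and s t :: 'g
    and a_nr a \<phi>s :: "'g \<Rightarrow> 'k"
  assumes p: "Factorial_Ring.prime p"
    and Qp: "padic_numbers p v Qp"
    and L: "finite_field_ext Qp L"
    and Lc: "algebraic_closure (ambient :: 'k ring) L"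
    and OL: "OL = integral_closure (valuation_ring v Qp) L"
    and unif: "uniformiser OL unif"
    and q: "q = card (residue_field OL)"
    and Lt: "Lt = max_tame p OL L"
    and Lnr: "Lnr = max_unramified OL L"
    and \<zeta>_prim: "\<And>m. coprime m q \<Longrightarrow> primitive_root_of_unity m (\<zeta> m)"
    and \<zeta>_compat: "\<And>m n. coprime m q \<Longrightarrow> coprime n q \<Longrightarrow> \<zeta> (m * n) ^ m = \<zeta> n"
    and rt: "\<And>m. coprime m q \<Longrightarrow> rt m ^ m = unif"
    and rt_compat: "\<And>m n. coprime m q \<Longrightarrow> coprime n q \<Longrightarrow> rt (m * n) ^ m = rt n"
    and \<phi>: "\<phi> \<in> carrier (Gal L Lt)"
    and \<phi>_\<zeta>: "\<And>m. coprime m q \<Longrightarrow> \<phi> (\<zeta> m) = \<zeta> m ^ q"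
    and \<phi>_rt: "\<And>m. coprime m q \<Longrightarrow> \<phi> (rt m) = rt m"
    and \<sigma>: "\<sigma> \<in> carrier (Gal L Lt)"
    and \<sigma>_\<zeta>: "\<And>m. coprime m q \<Longrightarrow> \<sigma> (\<zeta> m) = \<zeta> m"
    and \<sigma>_rt: "\<And>m. coprime m q \<Longrightarrow> \<sigma> (rt m) = \<zeta> m * rt m"
    and G: "group G" "finite (carrier G)"
    and \<pi>: "continuous_hom L G \<pi>"
    and \<pi>_tame: "factors_through L Lt G \<pi> \<pi>'"
    and s: "s = \<pi>' \<sigma>"
    and t: "t = \<pi>' \<phi>"
    and \<pi>nr: "continuous_hom L G \<pi>nr"
    and \<pi>nr_unramified: "factors_through L Lnr G \<pi>nr \<pi>nr'"
    and \<pi>nr_\<phi>: "\<pi>nr' (restrict \<phi> Lnr) = t"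
    and \<phi>s: "\<phi>s = orbit_map G s \<sigma> (kummer_element rt (group.ord G s))"
    and a_nr: "nib_generator OL L G \<pi>nr a_nr"
    and a: "a \<in> carrier G \<rightarrow>\<^sub>E UNIV"
    and resolvend_a:
      "resolvend G a = group_algebra_mult G (resolvend G a_nr) (resolvend G \<phi>s)"
  shows "a \<in> galois_algebra L G \<pi> \<and> nib_generator OL L G \<pi> a"
proof -
  have alg: "alg_over Qp x" for x
    by (rule algebraic_closure_alg_over[OF L Lc])
  interpret P: padic_closure p v Qp
    using p Qp alg by unfold_locales
  define V where "V = integral_closure P.Zp UNIV"
  interpret S: stable_valuation V p Qp
    using P.integral_closure_valuation(1) by (simp add: V_def)
  have VQ: "V \<inter> Qp = P.Zp" using P.integral_closure_valuation(2) by (simp add: V_def)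
  have Lf: "subfield L ambient" and QL: "Qp \<subseteq> L" using L by (auto simp: finite_field_ext_def)
  have Ls: "subfield_of L" by (rule subfield_of_ambient[OF Lf])
  \<comment> \<open>The ring of integers of \<open>L\<close> is cut out of the valuation ring of the
    whole algebraic closure, so the results on V \<inter> L apply to it.\<close>
  have OLV: "OL = V \<inter> L" by (auto simp: OL V_def integral_closure_def)
  \<comment> \<open>The integers below p represent the residue field of \<open>Zp\<close>;
    finiteness then passes to \<open>L\<close> through the bounded degree.\<close>
  have "S.residues Qp (of_nat ` {..<p})"
    unfolding S.residues_def
  proof (intro conjI ballI impI)
    fix x assume "x \<in> Qp" "x \<in> V"
    hence "x \<in> P.Zp" using VQ by blast
    then obtain c where c: "c < p" "(x - of_nat c) / of_nat p \<in> P.Zp" by (rule P.Zp_residue)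
    have "of_nat p * ((x - of_nat c) / of_nat p) \<in> S.nonunits"
      using c(2) VQ by (intro S.nonunits_mult' S.p_nonunits) blast
    then show "\<exists>r\<in>of_nat ` {..<p}. x - r \<in> S.nonunits" using c(1) P.p_gt_1 by auto
  qed auto
  moreover obtain d where "\<And>x. x \<in> L \<Longrightarrow> \<exists>h\<in>polys_over Qp. h \<noteq> 0 \<and> Polynomial.degree h \<le> d \<and> poly h x = 0"
    by (rule finite_ext_bounded_degree[OF L]) (rule that)
  ultimately obtain R where R: "S.residues L R"
    by (rule S.residues_extend[OF P.Qp.subfield_of_axioms Ls])
  have integral: "\<exists>f. monic_over (V \<inter> L) f \<and> poly f x = 0" if "x \<in> V" for x
  proof -
    obtain f where f: "monic_over P.Zp f" "poly f x = 0" using \<open>x \<in> V\<close> by (auto simp: V_def integral_closure_def)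
    moreover have "P.Zp \<subseteq> V \<inter> L" using VQ QL by blast
    ultimately have "monic_over (V \<inter> L) f" by (auto simp: monic_over_def)
    then show ?thesis using f(2) by blast
  qed
  have unif': "S.unif L unif" using unif S.uniformiser_iff_unif[OF Ls] by (simp add: OLV)
  interpret T: tame_homomorphism V p Qp L Lt R unif q \<zeta> rt \<phi> \<sigma> G \<pi> \<pi>' \<pi>nr \<pi>nr' Lnr s t
  proof (intro tame_homomorphism.intro tame_galois.intro tame_galois_axioms.intro tame_homomorphism_axioms.intro
      S.stable_valuation_axioms G(1))
    show "primitive_root_of_unity m (\<zeta> m)" "rt m ^ m = unif" "\<phi> (\<zeta> m) = \<zeta> m ^ q" "\<phi> (rt m) = rt m"
      "\<sigma> (\<zeta> m) = \<zeta> m" "\<sigma> (rt m) = \<zeta> m * rt m" if "coprime m q" for m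
      using that \<zeta>_prim rt \<phi>_\<zeta> \<phi>_rt \<sigma>_\<zeta> \<sigma>_rt by blast+
    show "\<zeta> (m * n) ^ m = \<zeta> n" "rt (m * n) ^ m = rt n" if "coprime m q" "coprime n q" for m n
      using that \<zeta>_compat rt_compat by blast+
    show "\<exists>f. monic_over (V \<inter> L) f \<and> poly f x = 0" if "x \<in> V" for x using that by (rule integral)
  qed (use Lf QL unif' R q Lt Lnr \<phi> \<sigma> G \<pi> \<pi>_tame s t \<pi>nr \<pi>nr_unramified \<pi>nr_\<phi> in \<open>simp_all add: OLV\<close>)
  have "a = T.ramify T.r a_nr"
    using a resolvend_a \<phi>s by (intro T.resolvend_product) (auto simp: T.n_def PiE_def)
  moreover have "nib_generator OL L G \<pi> (T.ramify T.r a_nr)"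
    using a_nr unfolding OLV by (rule T.nib_generator_ramify)
  ultimately show ?thesis by (simp add: nib_generator_def)
qed

end
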